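(* Let $k,l\in\mathbb{N}$ and $\varepsilon>0$. For $n$ large, $$\sum_{D\in\mathcal{H}_n}\big|\mathcal{L}^{(l)}(q^{-1/2},\chi_D)\big|^{k}\ll_{k,l,\varepsilon}|\mathcal{H}_n|\,g^{\frac12k(k+1)+lk+\varepsilon},$$ where $\mathcal{L}^{(l)}(u,\chi_D)$ denotes the $l$-th derivative of $\mathcal{L}(u,\chi_D)$ with respect to $u$.
   Context: $\mathbb{F}_q$ is a fixed finite field of odd cardinality $q$ (implied constants may depend on $q$). $\mathcal{H}_n$ is the set of monic square-free polynomials of degree $n$ in $\mathbb{F}_q[t]$. The integers $n$ and $g$ are linked by $2g=n-1-\lambda$, where $\lambda=1$ if $n$ is even and $\lambda=0$ if $n$ is odd. For monic irreducible $P\in\mathbb{F}_q[t]$, $\left(\frac{f}{P}\right)$ is $0$ if $P\mid f$, $1$ if $P\nmid f$ and $f$ is a square mod $P$, and $-1$ otherwise. For $D$ monic square-free, $\chi_D(f)=\left(\frac{D}{f}\right)$ for monic $f$, extended multiplicatively in $f$ from the symbols $\left(\frac{D}{P}\right)$. The $L$-function is $$\mathcal{L}(u,\chi_D)=\sum_{f\ \mathrm{monic}}\chi_D(f)u^{\deg f}=\prod_{P}\big(1-\chi_D(P)u^{\deg P}\big)^{-1},\qquad |u|<1/q$$ (sum over all monic $f\in\mathbb{F}_q[t]$, including $f=1$; product over monic irreducibles). For $\deg D\ge1$ it is a polynomial in $u$ of degree at most $\deg D-1$, hence defined for all $u\in\mathbb{C}$. *)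

theory Defs
  imports "HOL-Complex_Analysis.Complex_Analysis" "HOL-Number_Theory.Number_Theory"
    "HOL-Computational_Algebra.Squarefree" "HOL-Library.Landau_Symbols"
begin

(* The finite field F_q is the type 'a, so q = CARD('a) and F_q[t] is 'a poly. *)

definition monic_polys :: "'a::field poly set" where
  "monic_polys = {f. lead_coeff f = 1}"

definition monic_squarefree :: "nat \<Rightarrow> 'a::field poly set" where
  "monic_squarefree n = {D \<in> monic_polys. squarefree D \<and> degree D = n}"

definition poly_legendre :: "'a::field poly \<Rightarrow> 'a poly \<Rightarrow> int" where
  "poly_legendre f P =
     (if P dvd f then 0 else if (\<exists>h. [h ^ 2 = f] (mod P)) then 1 else -1)"

(* The library's multiplicity function needs a factorial_semiring instance, which 'a poly does not
   have for an arbitrary field 'a.  Only used for f \<noteq> 0 and P irreducible. *)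
definition poly_multiplicity :: "'a::field poly \<Rightarrow> 'a poly \<Rightarrow> nat" where
  "poly_multiplicity P f = Max {m. P ^ m dvd f}"

definition quad_char :: "'a::field poly \<Rightarrow> 'a poly \<Rightarrow> int" where
  "quad_char D f =
     (\<Prod>P \<in> {P \<in> monic_polys. irreducible P \<and> P dvd f}.
        poly_legendre D P ^ poly_multiplicity P f)"

(* The L-function is the polynomial that agrees with the (absolutely convergent) series over
   all monic f in the disc |u| < 1/q.  Such a polynomial exists when D is monic, square-free
   and of positive degree; it is unique by L_poly_eqI below. *)
definition L_poly :: "'a::{field,finite} poly \<Rightarrow> complex poly" where
  "L_poly D = (THE p. \<forall>u. norm u < 1 / real CARD('a) \<longrightarrow>
     ((\<lambda>f. of_int (quad_char D f) * u ^ degree f) has_sum poly p u) monic_polys)"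

definition L_fun :: "'a::{field,finite} poly \<Rightarrow> complex \<Rightarrow> complex" where
  "L_fun D u = poly (L_poly D) u"

lemma L_poly_eqI:
  fixes D :: "'a::{field,finite} poly"
  assumes p: "\<And>u. norm u < 1 / real CARD('a) \<Longrightarrow>
    ((\<lambda>f. of_int (quad_char D f) * u ^ degree f) has_sum poly p u) monic_polys"
  shows "L_poly D = p"
  unfolding L_poly_def
proof (rule the_equality)
  show "\<forall>u. norm u < 1 / real CARD('a) \<longrightarrow>
    ((\<lambda>f. of_int (quad_char D f) * u ^ degree f) has_sum poly p u) monic_polys"
    using p by blast
next
  fix r :: "complex poly"
  assume r: "\<forall>u. norm u < 1 / real CARD('a) \<longrightarrow>
    ((\<lambda>f. of_int (quad_char D f) * u ^ degree f) has_sum poly r u) monic_polys"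
  have "poly (r - p) u = 0" if "u \<in> ball 0 (1 / real CARD('a))" for u
    using infsumI[OF p[of u]] infsumI[OF r[rule_format, of u]] that by simp
  then have "ball 0 (1 / real CARD('a)) \<subseteq> {u. poly (r - p) u = 0}"
    by blast
  moreover have "infinite (ball (0::complex) (1 / real CARD('a)))"
    using uncountable_ball[of "1 / real CARD('a)" "0::complex"] countable_finite by auto
  ultimately have "infinite {u. poly (r - p) u = 0}"
    using finite_subset by blast
  then have "r - p = 0"
    using poly_roots_finite by blast
  then show "r = p" by simp
qed

(* For n \<ge> 1 this is the integer g with 2g = n - 1 - \<lambda>. *)
definition genus :: "nat \<Rightarrow> nat" where
  "genus n = (n - 1 - (if even n then 1 else 0)) div 2"

end

theory Submission imports "HOL-Algebra.Algebraic_Closure_Type" "HOL-Real_Asymp.Real_Asymp" Defs begin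

text \<open>
  The argument is Soundararajan's method for moments of \<open>L\<close>-functions. Put \<open>q =
  CARD('a)\<close> and \<open>\<Lambda> = ln n\<close>.

  By quadratic reciprocity and orthogonality the sums of \<open>quad_char D\<close> over monic polynomials of
  fixed degree vanish from degree \<open>n\<close> on, so \<open>L_poly D\<close> is their generating
  polynomial. Stepanov's method bounds its inverse roots by \<open>sqrt q\<close>. For \<open>norm u = q powr
  (-1/2)\<close> this turns the logarithm of the \<open>L\<close>-function into a one-sided bound: for every
  \<open>K \<le> n\<close>, \<open>ln (norm (L_fun D u))\<close> is at most \<open>n / K + \<Lambda> / 2 +
  O(1)\<close> plus a weighted sum of \<open>Re (u ^ degree P)\<close> times the symbol of \<open>D\<close> at
  \<open>P\<close> over the monic irreducible \<open>P\<close> of degree at most \<open>K\<close>. The term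
  \<open>\<Lambda> / 2\<close> comes from the squares of primes.

  The moments of order \<open>j\<close> of such a prime sum over all monic \<open>D\<close> of degree
  \<open>n\<close> are dominated by those of random signs as long as \<open>j\<close> times the largest degree
  is at most \<open>n\<close>, and the variance up to degree \<open>K\<close> is at most \<open>1 + ln
  K\<close>. With \<open>K\<close> about \<open>n / (\<delta> * \<Lambda>)\<close>, the primes of degree above
  \<open>K\<^sub>0\<close>, about \<open>n / (G * \<Lambda>)\<close>, contribute a bounded variance, so that
  part exceeds \<open>\<delta> * \<Lambda>\<close> only on a negligible set; values of the
  \<open>L\<close>-function beyond a fixed power of \<open>n\<close> are too rare to matter by the same moment
  bounds. The exponential moment of the part below \<open>K\<^sub>0\<close> is at most a constant times \<open>n
  powr (k\<^sup>2 / 2)\<close>. Together with the factor \<open>n powr (k / 2)\<close> from the squares of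
  primes this gives the exponent \<open>k * (k + 1) / 2\<close> for the \<open>k\<close>-th moment, uniformly on
  the circle.

  Derivatives cost a factor \<open>n ^ k\<close> each: interpolation with a Fejer kernel at the \<open>2 *
  n\<close>-th roots of unity writes \<open>u * p' u\<close>, for \<open>p\<close> of degree at most
  \<open>n\<close>, as \<open>n\<close> times an average of rotated values of \<open>p\<close> on the circle
  through \<open>u\<close>, so a moment bound that is uniform on the circle passes from \<open>p\<close> to
  \<open>p'\<close>.
\<close>

section \<open>Finite fields inside the algebraic closure\<close>

text \<open>Orthogonality is exact, but only for products of primes of total degree at most
  \<open>n\<close>, and an exponential of a prime sum is no polynomial in the symbols. It is
  therefore replaced by an even Taylor truncation of cosh. Such a truncation is nonnegative, so it
  can be summed over all monic \<open>D\<close> of degree \<open>n\<close> in place of the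
  square-free ones; this costs a constant factor, since at least half of them are square-free. A
  truncation of order N represents exp (k X) only while X is at most about N / k, and primes of
  degree up to K permit N = n / K. This is why one length does not do: keeping the error n / K below
  \<delta> \<Lambda> leaves only moments of order about \<delta> \<Lambda>, too few for the
  exponential moment of a sum of variance about \<Lambda>. The Riemann hypothesis enters only
  through the fact that each inverse root times \<open>u\<close> lies in the closed unit disc, where
  the truncated logarithm is a one-sided bound.\<close>

definition ev :: "'a::field poly \<Rightarrow> 'a alg_closure \<Rightarrow> 'a alg_closure" where
  "ev f x = poly (map_poly to_ac f) x"

lemma ev_0 [simp]: "ev 0 x = 0"
  and ev_1 [simp]: "ev 1 x = 1"
  and ev_pCons [simp]: "ev (pCons a f) x = to_ac a + x * ev f x"
  by (simp_all add: ev_def map_poly_pCons)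

lemma ev_add [simp]: "ev (f + g) x = ev f x + ev g x"
proof (induction f arbitrary: g)
  case (pCons a f)
  show ?case
    by (cases g) (simp add: pCons.IH distrib_left add.assoc add.left_commute)
qed simp

lemma ev_smult [simp]: "ev (smult c f) x = to_ac c * ev f x"
  by (induction f) (auto simp: algebra_simps)

lemma ev_mult [simp]: "ev (f * g) x = ev f x * ev g x"
  by (induction f) (auto simp: algebra_simps)

lemma ev_uminus [simp]: "ev (- f) x = - ev f x"
  using ev_smult[of "-1" f x] by simp

lemma ev_diff [simp]: "ev (f - g) x = ev f x - ev g x"
  using ev_add[of f "-g" x] by simp

lemma ev_power [simp]: "ev (f ^ k) x = ev f x ^ k"
  by (induction k) auto

lemma ev_monom [simp]: "ev (monom c k) x = to_ac c * x ^ k"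
  by (induction k) (auto simp: monom_0 monom_Suc algebra_simps)

lemma ev_sum [simp]: "ev (\<Sum>i\<in>A. f i) x = (\<Sum>i\<in>A. ev (f i) x)"
  by (induction A rule: infinite_finite_induct) auto

lemma ev_prod [simp]: "ev (\<Prod>i\<in>A. f i) x = (\<Prod>i\<in>A. ev (f i) x)"
  by (induction A rule: infinite_finite_induct) auto

lemma degree_map_poly_to_ac [simp]: "degree (map_poly to_ac f) = degree f"
  by (rule degree_map_poly) auto

lemma map_poly_to_ac_eq_0_iff [simp]: "map_poly to_ac f = 0 \<longleftrightarrow> f = 0"
  by (intro map_poly_eq_0_iff) auto

lemma finite_ev_roots: "f \<noteq> 0 \<Longrightarrow> finite {x. ev f x = 0}"
  unfolding ev_def by (intro poly_roots_finite) auto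

lemma card_ev_roots: "f \<noteq> 0 \<Longrightarrow> card {x. ev f x = 0} \<le> degree f"
  using card_poly_roots_bound[of "map_poly to_ac f"] by (simp add: ev_def)

lemma ev_has_root: "degree f > 0 \<Longrightarrow> \<exists>x. ev f x = 0"
  using alg_closed_imp_poly_has_root[of "map_poly to_ac f"] by (simp add: ev_def)

lemma prime_CHAR: "prime CHAR('a::{field,finite})"
  by (intro prime_CHAR_semidom finite_imp_CHAR_pos) auto

text \<open>Multiplication by \<open>y\<close> permutes \<open>E\<close>, so the product over
  \<open>E\<close> stays fixed and at the same time gains the factor \<open>y ^ card E\<close>.
  Stability under this one multiplication is what the proof uses, so the fact serves the base field
  and the images of evaluation maps alike.\<close>

lemma power_card_eq_1:
  fixes y :: "'b::field"
  assumes E: "finite E" "0 \<notin> E" "(*) y ` E \<subseteq> E" and y: "y \<noteq> 0"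
  shows "y ^ card E = 1"
proof -
  have inj: "inj_on ((*) y) E" using y by (auto simp: inj_on_def)
  have "\<Prod>E = \<Prod>((*) y ` E)" using endo_inj_surj[OF E(1,3) inj] by simp
  also have "\<dots> = (\<Prod>z\<in>E. y * z)" by (subst prod.reindex[OF inj]) simp
  also have "\<dots> = y ^ card E * \<Prod>E" by (simp add: prod.distrib)
  finally show ?thesis using E by simp
qed

lemma power_card_eq_same: "(x :: 'a::{field,finite}) ^ CARD('a) = x"
proof -
  have pos: "0 < CARD('a)" by simp
  show ?thesis
  proof (cases "x = 0")
    case True
    then show ?thesis using pos by (simp only: zero_power)
  next
    case False
    then have "x ^ card (UNIV - {0 :: 'a}) = 1" by (intro power_card_eq_1) auto
    then have "x ^ (CARD('a) - 1) = 1" by (simp only: card_Diff_singleton[OF UNIV_I])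
    then show ?thesis using power_minus_mult[OF pos, of x] by (simp only: mult_1)
  qed
qed

text \<open>\<open>H'\<close> is the additive group generated by \<open>H\<close> and
  \<open>x\<close>. The representation h + i x is unique because a nonzero residue i modulo the
  prime characteristic is invertible, so i x in \<open>H\<close> would put \<open>x\<close> into
  \<open>H\<close>.\<close>

lemma card_additive_extension:
  fixes H :: "'a::{field,finite} set"
  assumes add: "\<And>x y. x \<in> H \<Longrightarrow> y \<in> H \<Longrightarrow> x - y \<in> H" and "0 \<in> H" and x: "x \<notin> H"
  defines "H' \<equiv> (\<lambda>(h, i). h + of_nat i * x) ` (H \<times> {..<CHAR('a)})"
  shows "card H' = card H * CHAR('a)" and "\<And>y z. y \<in> H' \<Longrightarrow> z \<in> H' \<Longrightarrow> y - z \<in> H'" and "H \<subset> H'"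
proof -
  let ?p = "CHAR('a)"
  have p: "prime ?p" by (rule prime_CHAR)
  have p0: "?p > 0" using p by (simp add: prime_gt_0_nat)
  have add': "u + v \<in> H" if "u \<in> H" "v \<in> H" for u v
    using add[OF that(1) add[OF \<open>0 \<in> H\<close> that(2)]] by simp
  have mul: "of_nat k * u \<in> H" if "u \<in> H" for k u
    by (induction k) (auto simp: \<open>0 \<in> H\<close> algebra_simps intro!: add' that)
  have noH: "of_nat k * x \<notin> H" if k: "0 < k" "k < ?p" for k
  proof
    assume "of_nat k * x \<in> H"
    have "\<not> ?p dvd k" using k by (rule nat_dvd_not_less)
    with p have "coprime ?p k" by (rule prime_imp_coprime_nat)
    then have "coprime k ?p" by (rule coprime_imp_coprime) auto
    from cong_solve_coprime_nat[OF this] obtain a where a: "[k * a = Suc 0] (mod ?p)"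
      by (elim exE)
    have "of_nat (k * a) = (of_nat (Suc 0) :: 'a)"
      unfolding of_nat_eq_iff_cong_CHAR by (rule a)
    then have ka: "of_nat a * of_nat k = (1 :: 'a)"
      unfolding of_nat_mult by (simp add: mult.commute)
    have "of_nat a * (of_nat k * x) = x"
      unfolding mult.assoc[symmetric] ka by simp
    with mul[OF \<open>of_nat k * x \<in> H\<close>, of a] x show False by simp
  qed
  have inj: "inj_on (\<lambda>(h, i). h + of_nat i * x) (H \<times> {..<?p})"
  proof (rule inj_onI)
    fix y z
    assume yz: "y \<in> H \<times> {..<?p}" "z \<in> H \<times> {..<?p}"
      and "(case y of (h, i) \<Rightarrow> h + of_nat i * x) = (case z of (h, i) \<Rightarrow> h + of_nat i * x)"
    moreover obtain h i h' j where hi: "y = (h, i)" "z = (h', j)" by (metis surj_pair)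
    ultimately have H: "h \<in> H" "h' \<in> H" and ij: "i \<in> {..<?p}" "j \<in> {..<?p}"
      and eq: "h + of_nat i * x = h' + of_nat j * x" by simp_all
    have *: "i = j" if "i \<le> j" "h + of_nat i * x = h' + of_nat j * x" "h \<in> H" "h' \<in> H" "j < ?p" for i j h h'
    proof (rule ccontr)
      assume "i \<noteq> j"
      have eq: "of_nat (j - i) * x = h - h'"
        using that(1,2) by (simp add: of_nat_diff algebra_simps)
      have "0 < j - i" "j - i < ?p" using that(1,5) \<open>i \<noteq> j\<close> by linarith+
      from noH[OF this] add[OF that(3,4)] show False unfolding eq by (rule notE)
    qed
    have "i = j"
    proof (cases "i \<le> j")
      case True
      from *[OF this eq H(1,2)] ij(2) show ?thesis by simp
    next
      case False
      then have "j \<le> i" by simp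
      from *[OF this eq[symmetric] H(2,1)] ij(1) show ?thesis by simp
    qed
    then show "y = z" using eq hi by simp
  qed
  show "card H' = card H * ?p"
    unfolding H'_def by (subst card_image[OF inj]) (simp add: card_cartesian_product)
  have mem: "h + of_nat k * x \<in> H'" if "h \<in> H" for h k
  proof -
    have "of_nat k = (of_nat (k mod ?p) :: 'a)"
      unfolding of_nat_eq_iff_cong_CHAR by (simp add: cong_def)
    then show ?thesis
      unfolding H'_def using that p0 by (intro image_eqI[of _ _ "(h, k mod ?p)"]) auto
  qed
  show "y - z \<in> H'" if yz: "y \<in> H'" "z \<in> H'" for y z
  proof -
    obtain h i h' j where "y = h + of_nat i * x" "z = h' + of_nat j * x" "h \<in> H" "h' \<in> H" "j < ?p"
      using yz unfolding H'_def by auto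
    then have eq: "y - z = (h - h') + of_nat (i + (?p - j)) * x"
      by (simp add: of_nat_diff algebra_simps)
    show ?thesis
      unfolding eq by (rule mem[OF add[OF \<open>h \<in> H\<close> \<open>h' \<in> H\<close>]])
  qed
  have "x \<in> H'" using mem[OF \<open>0 \<in> H\<close>, of 1] by simp
  moreover have "H \<subseteq> H'" using mem[of _ 0] by auto
  ultimately show "H \<subset> H'" using x by auto
qed

text \<open>A maximal additive subgroup of order a power of the characteristic p is everything, as a
  further element would enlarge it by the factor p. The purpose: powers with exponent
  \<open>CARD('a) ^ r\<close> are iterates of the p-th power map and hence additive.\<close>

lemma card_prime_power: "\<exists>e. CARD('a::{field,finite}) = CHAR('a) ^ e"
proof -
  define \<S> where "\<S> = {H :: 'a set. 0 \<in> H \<and> (\<forall>x\<in>H. \<forall>y\<in>H. x - y \<in> H) \<and> (\<exists>e. card H = CHAR('a) ^ e)}"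
  have "{0} \<in> \<S>" by (auto simp: \<S>_def intro!: exI[of _ 0])
  then obtain H where H: "H \<in> \<S>" "\<And>H'. H' \<in> \<S> \<Longrightarrow> H \<subseteq> H' \<Longrightarrow> H' = H"
    using finite_has_maximal[of \<S>] finite[of \<S>] by (metis empty_iff)
  have "H = UNIV"
  proof (rule ccontr)
    assume "H \<noteq> UNIV"
    then obtain x where x: "x \<notin> H" by blast
    let ?H' = "(\<lambda>(h, i). h + of_nat i * x) ` (H \<times> {..<CHAR('a)})"
    have H0: "\<And>x y. x \<in> H \<Longrightarrow> y \<in> H \<Longrightarrow> x - y \<in> H" "0 \<in> H"
      using H(1) unfolding \<S>_def by auto
    note ext = card_additive_extension[of H x, OF H0 x]
    have sub: "H \<subset> ?H'" and cd: "card ?H' = card H * CHAR('a)" and cl: "\<forall>y\<in>?H'. \<forall>z\<in>?H'. y - z \<in> ?H'"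
      using ext(3) ext(1) by simp_all (use ext(2) in blast)
    have "\<exists>e. card ?H' = CHAR('a) ^ e"
      unfolding cd using H(1) unfolding \<S>_def by (auto intro: exI[of _ "Suc _"])
    moreover have "0 \<in> ?H'" using sub H0(2) by blast
    ultimately have "?H' \<in> \<S>"
      unfolding \<S>_def using cl by (intro CollectI conjI)
    with H(2) sub show False by blast
  qed
  with H(1) show ?thesis unfolding \<S>_def by auto
qed

lemma frobenius_add:
  fixes x y :: "'a::{field,finite} alg_closure"
  shows "(x + y) ^ (CARD('a) ^ r) = x ^ (CARD('a) ^ r) + y ^ (CARD('a) ^ r)"
proof -
  obtain e where e: "CARD('a) = CHAR('a) ^ e" using card_prime_power by blast
  show ?thesis
  proof (rule freshmans_dream')
    show "prime CHAR('a alg_closure)" unfolding CHAR_alg_closure by (rule prime_CHAR)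
    show "CARD('a) ^ r = CHAR('a alg_closure) ^ (e * r)"
      unfolding CHAR_alg_closure e power_mult ..
  qed
qed

lemma frobenius_poly_add:
  fixes f g :: "'a::{field,finite} poly"
  shows "(f + g) ^ (CARD('a) ^ r) = f ^ (CARD('a) ^ r) + g ^ (CARD('a) ^ r)"
proof -
  obtain e where e: "CARD('a) = CHAR('a) ^ e" using card_prime_power by blast
  show ?thesis
  proof (rule freshmans_dream')
    have *: "CHAR('a poly) = CHAR('a)"
      by (rule CHAR_eqI) (simp_all add: of_nat_poly of_nat_eq_0_iff_char_dvd)
    show "prime CHAR('a poly)" unfolding * by (rule prime_CHAR)
    show "CARD('a) ^ r = CHAR('a poly) ^ (e * r)"
      unfolding * e power_mult ..
  qed
qed

lemma card_gt_1: "CARD('a::{field,finite}) > 1"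
proof -
  have "card {0, 1 :: 'a} \<le> CARD('a)" by (intro card_mono) auto
  then show ?thesis by simp
qed

lemma power_card_power_eq_same: "(x :: 'a::{field,finite}) ^ (CARD('a) ^ r) = x"
  by (induction r) (auto simp: power_mult power_card_eq_same mult.commute[of "CARD('a)"])

lemma ev_frobenius:
  fixes f :: "'a::{field,finite} poly"
  shows "ev f (x ^ (CARD('a) ^ r)) = ev f x ^ (CARD('a) ^ r)"
proof (induction f)
  case 0
  then show ?case using card_gt_1[where 'a='a] by simp
next
  case (pCons a f)
  then show ?case
    by (simp add: frobenius_add power_mult_distrib power_card_power_eq_same flip: to_ac_power)
qed

lemma of_nat_card_eq_0: "of_nat (CARD('a::{field,finite})) = (0 :: 'a alg_closure)"
proof -
  obtain e where e: "CARD('a) = CHAR('a) ^ e" using card_prime_power by blast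
  with card_gt_1[where 'a='a] have "e > 0" by (cases e) auto
  then have "CHAR('a) dvd CARD('a)" by (simp add: e)
  then show ?thesis by (simp add: of_nat_eq_0_iff_char_dvd)
qed

lemma proots_prod_linear: "proots (\<Prod>x\<in>#A. [:-x, 1:]) = (A :: 'b::idom multiset)"
proof (induction A)
  case (add x A)
  have "(\<Prod>x\<in>#A. [:-x, 1:]) \<noteq> 0"
    by (auto simp: prod_mset_zero_iff)
  with add show ?case
    by (simp add: proots_mult del: mult_pCons_left)
qed simp

text \<open>A root of order two would also be a root of the derivative. So all roots are simple, and
  over an algebraically closed field they exhaust the degree.\<close>

lemma separable_card_roots:
  fixes p :: "'b::alg_closed_field poly"
  assumes p: "p \<noteq> 0" and sep: "\<And>x. poly p x = 0 \<Longrightarrow> poly (pderiv p) x \<noteq> 0"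
  shows "card {x. poly p x = 0} = degree p" and "proots p = mset_set {x. poly p x = 0}"
proof -
  obtain A where A: "size A = degree p" "p = smult (lead_coeff p) (\<Prod>x\<in>#A. [:-x, 1:])"
    using alg_closed_imp_factorization[OF p] by blast
  have pr: "proots p = A"
  proof -
    have "proots p = proots (\<Prod>x\<in>#A. [:-x, 1:])"
      by (subst A(2)) (use p in simp)
    also have "\<dots> = A"
      by (rule proots_prod_linear)
    finally show ?thesis .
  qed
  have fin: "finite {x. poly p x = 0}" using p by (rule poly_roots_finite)
  show *: "proots p = mset_set {x. poly p x = 0}"
  proof (rule multiset_eqI)
    fix x
    show "count (proots p) x = count (mset_set {x. poly p x = 0}) x"
    proof (cases "poly p x = 0")
      case True
      have "order x p < 2"
      proof (rule ccontr)
        assume "\<not> order x p < 2"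
        then have "[:-x, 1:] ^ 2 dvd p"
          by (intro power_le_dvd[OF order_1]) auto
        then obtain g where g: "p = [:-x, 1:] ^ 2 * g" by (rule dvdE)
        have "p = [:-x, 1:] * ([:-x, 1:] * g)"
          unfolding g power2_eq_square by (rule mult.assoc)
        then have "poly (pderiv p) x = 0"
          by (simp add: pderiv_mult del: mult_pCons_left)
        with sep[OF True] show False by simp
      qed
      moreover have "order x p > 0" using True p by (simp add: order_gt_0_iff)
      ultimately show ?thesis using p True fin by simp
    next
      case False
      then show ?thesis using p fin by (simp add: order_0I)
    qed
  qed
  show "card {x. poly p x = 0} = degree p"
    using * pr A(1) by (metis size_mset_set)
qed

text \<open>For \<open>r > 0\<close> this is the subfield with \<open>CARD('a) ^ r\<close> elements,
  as the fixed points of the r-th iterate of Frobenius. For \<open>r = 0\<close> it degenerates to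
  the whole closure, which is why \<open>r > 0\<close> is assumed below.\<close>

definition ffield :: "nat \<Rightarrow> 'a::{field,finite} alg_closure set" where
  "ffield r = {x. x ^ (CARD('a) ^ r) = x}"

lemma ffield_poly:
  fixes r :: nat and \<phi> :: "'a::{field,finite} alg_closure poly"
  assumes "r > 0"
  defines "\<phi> \<equiv> monom 1 (CARD('a) ^ r) - monom 1 1"
  shows "\<phi> \<noteq> 0" "degree \<phi> = CARD('a) ^ r" "\<And>x. poly (pderiv \<phi>) x = -1" "{x. poly \<phi> x = 0} = ffield r"
proof -
  have gt: "CARD('a) ^ r > 1" using one_less_power[OF card_gt_1[where 'a='a] assms(1)] .
  have "degree (- monom (1::'a alg_closure) 1) < degree (monom (1::'a alg_closure) (CARD('a) ^ r))"
    using gt by (simp add: degree_monom_eq del: monom_Suc)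
  then show deg: "degree \<phi> = CARD('a) ^ r"
    unfolding \<phi>_def by (metis degree_add_eq_left degree_monom_eq diff_conv_add_uminus zero_neq_one)
  then show "\<phi> \<noteq> 0" using gt by auto
  have "of_nat (CARD('a) ^ r) = (0 :: 'a alg_closure)"
    using assms(1) of_nat_card_eq_0[where 'a='a] by (simp add: power_0_left)
  then show "poly (pderiv \<phi>) x = -1" for x
    unfolding \<phi>_def by (simp add: pderiv_diff pderiv_monom del: of_nat_power)
  show "{x. poly \<phi> x = 0} = ffield r"
    unfolding \<phi>_def ffield_def by (auto simp: poly_monom)
qed

lemma card_ffield:
  assumes "r > 0"
  shows "card (ffield r :: 'a::{field,finite} alg_closure set) = CARD('a) ^ r"
    and "finite (ffield r :: 'a::{field,finite} alg_closure set)"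
proof -
  let ?p = "monom 1 (CARD('a) ^ r) - monom 1 1 :: 'a alg_closure poly"
  note p = ffield_poly[where 'a='a, OF assms]
  have "card {x. poly ?p x = 0} = degree ?p"
    by (rule separable_card_roots(1)) (use p in auto)
  then show "card (ffield r :: 'a::{field,finite} alg_closure set) = CARD('a) ^ r"
    unfolding p(2,4) .
  show "finite (ffield r :: 'a::{field,finite} alg_closure set)"
    unfolding p(4)[symmetric] using p(1) by (rule poly_roots_finite)
qed

section \<open>Irreducible polynomials and their roots\<close>

text \<open>The condition is put on coefficients so that the zero polynomial belongs to the set even
  for \<open>d = 0\<close>. The set is then a vector space with \<open>CARD('a) ^ d\<close> elements
  for every \<open>d\<close>.\<close>

definition polys_lt :: "nat \<Rightarrow> 'a::field poly set" where
  "polys_lt d = {f. \<forall>i\<ge>d. coeff f i = 0}"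

lemma polys_lt_iff: "f \<in> polys_lt d \<longleftrightarrow> f = 0 \<or> degree f < d"
proof
  assume f: "f \<in> polys_lt d"
  show "f = 0 \<or> degree f < d"
  proof (rule ccontr)
    assume "\<not> ?thesis"
    then have "coeff f (degree f) = 0" and "f \<noteq> 0" using f by (auto simp: polys_lt_def)
    then show False by simp
  qed
qed (auto simp: polys_lt_def coeff_eq_0)

lemma polys_lt_Suc: "polys_lt (Suc d) = (\<lambda>(a, f). pCons a f) ` (UNIV \<times> polys_lt d)"
proof (intro equalityI subsetI)
  fix f :: "'a poly"
  assume f: "f \<in> polys_lt (Suc d)"
  obtain a g where g: "f = pCons a g" by (cases f)
  have "g \<in> polys_lt d"
    unfolding polys_lt_def
  proof (intro CollectI allI impI)
    fix i assume "d \<le> i"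
    then have "coeff f (Suc i) = 0" using f unfolding polys_lt_def by simp
    then show "coeff g i = 0" unfolding g by simp
  qed
  then show "f \<in> (\<lambda>(a, f). pCons a f) ` (UNIV \<times> polys_lt d)" unfolding g by auto
qed (auto simp: polys_lt_def coeff_pCons split: nat.split)

lemma card_polys_lt: "card (polys_lt d :: 'a::{field,finite} poly set) = CARD('a) ^ d"
  and finite_polys_lt [simp]: "finite (polys_lt d :: 'a::{field,finite} poly set)"
proof (induction d)
  case 0
  have "(polys_lt 0 :: 'a poly set) = {0}" by (auto simp: polys_lt_iff)
  then show "card (polys_lt 0 :: 'a::{field,finite} poly set) = CARD('a) ^ 0"
    "finite (polys_lt 0 :: 'a::{field,finite} poly set)" by auto
next
  case (Suc d)
  have "inj_on (\<lambda>(a, f). pCons a f) (UNIV \<times> (polys_lt d :: 'a poly set))"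
    by (auto simp: inj_on_def)
  then show "card (polys_lt (Suc d) :: 'a poly set) = CARD('a) ^ Suc d"
    unfolding polys_lt_Suc by (subst card_image) (auto simp: card_cartesian_product Suc)
  show "finite (polys_lt (Suc d) :: 'a poly set)"
    unfolding polys_lt_Suc using Suc by auto
qed

lemma mod_in_polys_lt: "P \<noteq> 0 \<Longrightarrow> degree P = d \<Longrightarrow> f mod P \<in> polys_lt d"
  using degree_mod_less[of P f] by (auto simp: polys_lt_iff)

lemma polys_lt_diff: "f \<in> polys_lt d \<Longrightarrow> g \<in> polys_lt d \<Longrightarrow> f - g \<in> polys_lt d"
  by (auto simp: polys_lt_def)

lemma polys_lt_dvd_eq_0: "f \<in> polys_lt (degree P) \<Longrightarrow> P dvd f \<Longrightarrow> f = 0"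
  unfolding polys_lt_iff using dvd_imp_degree_le[of P f] by linarith

definition monic_deg :: "nat \<Rightarrow> 'a::field poly set" where
  "monic_deg n = {f \<in> monic_polys. degree f = n}"

lemma monic_deg_eq: "monic_deg n = (\<lambda>g. monom 1 n + g) ` polys_lt n"
proof (intro equalityI subsetI)
  fix f :: "'a poly" assume f: "f \<in> monic_deg n"
  have "f - monom 1 n \<in> polys_lt n"
    using f unfolding polys_lt_def monic_deg_def monic_polys_def
    by (auto simp: coeff_eq_0)
  then show "f \<in> (\<lambda>g. monom 1 n + g) ` polys_lt n"
    by (intro image_eqI[of _ _ "f - monom 1 n"]) auto
next
  fix f :: "'a poly" assume "f \<in> (\<lambda>g. monom 1 n + g) ` polys_lt n"
  then obtain g where g: "f = monom 1 n + g" "g \<in> polys_lt n" by blast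
  have "degree f = n"
  proof (rule antisym)
    show "degree f \<le> n" using g by (intro degree_le) (auto simp: polys_lt_def)
    show "n \<le> degree f" using g by (intro le_degree) (auto simp: polys_lt_def)
  qed
  with g show "f \<in> monic_deg n" by (auto simp: monic_deg_def monic_polys_def polys_lt_def)
qed

lemma finite_monic_deg [simp]: "finite (monic_deg n :: 'a::{field,finite} poly set)"
  unfolding monic_deg_eq by simp

lemma card_monic_deg: "card (monic_deg n :: 'a::{field,finite} poly set) = CARD('a) ^ n"
  unfolding monic_deg_eq by (subst card_image) (auto simp: card_polys_lt inj_on_def)

lemma monic_deg_nonzero: "f \<in> monic_deg n \<Longrightarrow> f \<noteq> 0"
  by (auto simp: monic_deg_def monic_polys_def)

lemma monic_deg_add: "f \<in> monic_deg n \<Longrightarrow> g \<in> polys_lt n \<Longrightarrow> f + g \<in> monic_deg n"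
  unfolding monic_deg_eq by (auto simp: polys_lt_def add.assoc intro!: image_eqI[of _ _ "_ + g"])

lemma irreducible_degree_pos: "irreducible (P :: 'a::field poly) \<Longrightarrow> degree P > 0"
  using is_unit_iff_degree[of P] unfolding irreducible_def by auto

lemma ev_minimal_dvd:
  fixes m :: "'a::field poly"
  assumes m: "ev m x = 0" "m \<noteq> 0" "\<And>g. g \<noteq> 0 \<Longrightarrow> ev g x = 0 \<Longrightarrow> degree m \<le> degree g"
    and f: "ev f x = 0"
  shows "m dvd f"
proof -
  have "ev (f mod m) x = 0"
    using f m(1) by (simp add: minus_div_mult_eq_mod[symmetric])
  with m(2,3) degree_mod_less[of m f] show ?thesis
    unfolding dvd_eq_mod_eq_0 by (metis linorder_not_le)
qed

lemma ev_minimal_exists: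
  fixes f :: "'a::field poly"
  assumes "f \<noteq> 0" "ev f x = 0"
  obtains m where "ev m x = 0" "m \<noteq> 0" "\<And>g. g \<noteq> 0 \<Longrightarrow> ev g x = 0 \<Longrightarrow> degree m \<le> degree g"
  using ex_has_least_nat[of "\<lambda>m. m \<noteq> 0 \<and> ev m x = 0" f degree] assms by blast

text \<open>The polynomial of least degree vanishing at \<open>x\<close> divides \<open>P\<close>
  and is therefore associated to it. Divisibility by \<open>P\<close> thus becomes vanishing at a
  point of a field, and that irreducible polynomials are prime is read off from the absence of zero
  divisors.\<close>

lemma irreducible_dvd_iff_ev:
  fixes P :: "'a::field poly"
  assumes P: "irreducible P" and x: "ev P x = 0"
  shows "P dvd f \<longleftrightarrow> ev f x = 0"
proof
  assume f: "ev f x = 0"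
  have "P \<noteq> 0" using P by auto
  then obtain m where m: "ev m x = 0" "m \<noteq> 0" "\<And>g. g \<noteq> 0 \<Longrightarrow> ev g x = 0 \<Longrightarrow> degree m \<le> degree g"
    using ev_minimal_exists x by blast
  have "m dvd P" by (rule ev_minimal_dvd[OF m x])
  then obtain k where k: "P = m * k" by (rule dvdE)
  have "\<not> m dvd 1"
  proof
    assume "m dvd 1"
    then obtain c where "m = [:c:]" "c dvd 1" unfolding is_unit_poly_iff by blast
    with m(1) m(2) show False by simp
  qed
  with irreducibleD[OF P k] have "k dvd 1" by blast
  then have "P dvd m" unfolding k by (simp add: mult_unit_dvd_iff)
  also have "m dvd f" by (rule ev_minimal_dvd[OF m f])
  finally show "P dvd f" .
next
  assume "P dvd f"
  with x show "ev f x = 0" by (auto elim!: dvdE)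
qed

lemma irreducible_obtain_root:
  fixes P :: "'a::field poly"
  assumes "irreducible P"
  obtains x where "ev P x = 0"
  using ev_has_root[OF irreducible_degree_pos[OF assms]] by blast

lemma irreducible_dvd_mult_iff:
  fixes P :: "'a::field poly"
  assumes P: "irreducible P"
  shows "P dvd f * g \<longleftrightarrow> P dvd f \<or> P dvd g"
proof -
  obtain x where "ev P x = 0" using P by (rule irreducible_obtain_root)
  note irreducible_dvd_iff_ev[OF P this]
  then show ?thesis by simp
qed

lemma irreducible_dvd_power_iff:
  fixes P :: "'a::field poly"
  assumes P: "irreducible P"
  shows "P dvd f ^ k \<longleftrightarrow> P dvd f \<and> k > 0"
proof -
  obtain x where "ev P x = 0" using P by (rule irreducible_obtain_root)
  note irreducible_dvd_iff_ev[OF P this]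
  then show ?thesis by auto
qed

lemma irreducible_dvd_prod_iff:
  fixes P :: "'a::field poly"
  assumes P: "irreducible P" and "finite A"
  shows "P dvd (\<Prod>i\<in>A. f i) \<longleftrightarrow> (\<exists>i\<in>A. P dvd f i)"
proof -
  obtain x where "ev P x = 0" using P by (rule irreducible_obtain_root)
  note irreducible_dvd_iff_ev[OF P this]
  then show ?thesis using assms(2) by simp
qed

definition monic_irred :: "'a::field poly set" where
  "monic_irred = {P \<in> monic_polys. irreducible P}"

lemma monic_irred_irreducible: "P \<in> monic_irred \<Longrightarrow> irreducible P"
  and monic_irred_monic: "P \<in> monic_irred \<Longrightarrow> lead_coeff P = 1"
  by (auto simp: monic_irred_def monic_polys_def)

lemma monic_irred_dvd_eq:
  assumes "P \<in> monic_irred" "Q \<in> monic_irred" "P dvd (Q :: 'a::field poly)"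
  shows "P = Q"
proof -
  obtain k where k: "Q = P * k" using assms(3) by (rule dvdE)
  with irreducibleD[OF monic_irred_irreducible[OF assms(2)] k]
  have "k dvd 1" using assms(1) unfolding monic_irred_def irreducible_def by blast
  then obtain c where c: "k = [:c:]" unfolding is_unit_poly_iff by blast
  have "lead_coeff Q = lead_coeff P * c" unfolding k c by (simp add: lead_coeff_smult)
  then have "c = 1" using monic_irred_monic[OF assms(1)] monic_irred_monic[OF assms(2)] by simp
  then show ?thesis unfolding k c by simp
qed

lemma monic_irred_common_root:
  assumes "P \<in> monic_irred" "Q \<in> monic_irred" "ev P x = 0" "ev Q x = 0"
  shows "P = Q"
  using irreducible_dvd_iff_ev[OF monic_irred_irreducible[OF assms(1)] assms(3)] assms
  by (intro monic_irred_dvd_eq) auto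

text \<open>A polynomial of least degree vanishing at \<open>x\<close>, made monic. In any
  factorization one factor vanishes at \<open>x\<close>, so it already has the full degree and the
  other factor is constant.\<close>

lemma minimal_polynomial_exists:
  fixes x :: "'a::field alg_closure"
  obtains P where "P \<in> monic_irred" "ev P x = 0"
proof -
  obtain p :: "'a poly" where "p \<noteq> 0" "ev p x = 0"
    using alg_closure_algebraic[of x] unfolding ev_def by blast
  then obtain m where m: "ev m x = 0" "m \<noteq> 0" "\<And>g. g \<noteq> 0 \<Longrightarrow> ev g x = 0 \<Longrightarrow> degree m \<le> degree g"
    using ev_minimal_exists by blast
  define P where "P = smult (inverse (lead_coeff m)) m"
  have deg: "degree P = degree m" and evP: "ev P x = 0" and lc: "lead_coeff P = 1" and "P \<noteq> 0"
    using m by (auto simp: P_def)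
  have *: "b dvd 1" if "P = a * b" "ev a x = 0" for a b
  proof -
    have "a \<noteq> 0" "b \<noteq> 0" using that \<open>P \<noteq> 0\<close> by auto
    then have "degree P = degree a + degree b" using that by (simp add: degree_mult_eq)
    with m(3)[OF \<open>a \<noteq> 0\<close> that(2)] deg have "degree b = 0" by simp
    with \<open>b \<noteq> 0\<close> show ?thesis by (simp add: is_unit_iff_degree)
  qed
  have "irreducible P"
  proof (rule irreducibleI)
    show "\<not> P dvd 1"
    proof
      assume "P dvd 1"
      then obtain c where "P = [:c:]" unfolding is_unit_poly_iff by blast
      with evP \<open>P \<noteq> 0\<close> show False by simp
    qed
    fix a b assume ab: "P = a * b"
    then have "ev a x = 0 \<or> ev b x = 0" using evP by simp
    then show "a dvd 1 \<or> b dvd 1"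
      using *[of a b] *[of b a] ab by (auto simp: mult.commute)
  qed fact
  with lc evP that show ?thesis by (auto simp: monic_irred_def monic_polys_def)
qed

section \<open>The residue field of an irreducible polynomial, its roots and their
  conjugates\<close>

context
  fixes P :: "'a::{field,finite} poly" and x :: "'a alg_closure" and d :: nat
  assumes P: "irreducible P" and x: "ev P x = 0" and d: "degree P = d"
begin

lemma d_pos: "d > 0"
  using irreducible_degree_pos[OF P] d by simp

lemma ev_inj_on_polys_lt: "inj_on (\<lambda>f. ev f x) (polys_lt d)"
proof (rule inj_onI)
  fix f g assume fg: "f \<in> polys_lt d" "g \<in> polys_lt d" "ev f x = ev g x"
  then have "P dvd f - g" using irreducible_dvd_iff_ev[OF P x] by simp
  with polys_lt_dvd_eq_0[of "f - g" P] polys_lt_diff[OF fg(1,2)] d show "f = g" by simp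
qed

lemma ev_in_image: "ev f x \<in> (\<lambda>f. ev f x) ` polys_lt d"
proof
  have "P \<noteq> 0" using P by auto
  then show "f mod P \<in> polys_lt d" using d by (rule mod_in_polys_lt)
  show "ev f x = ev (f mod P) x"
    using x by (simp add: minus_div_mult_eq_mod[symmetric])
qed

text \<open>There are q^d values at \<open>x\<close> by injectivity, and the nonzero ones are stable
  under multiplication by each of them, so \<open>power_card_eq_1\<close> places them in
  \<open>ffield d\<close>. Equal cardinalities give equality. The residue field modulo
  \<open>P\<close> is thereby realised inside the closure.\<close>

lemma ev_image_polys_lt: "(\<lambda>f. ev f x) ` polys_lt d = ffield d"
proof (rule card_seteq)
  let ?E = "(\<lambda>f. ev f x) ` polys_lt d"
  show "finite (ffield d :: 'a alg_closure set)" by (rule card_ffield(2)[OF d_pos])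
  have card: "card ?E = CARD('a) ^ d"
    by (subst card_image[OF ev_inj_on_polys_lt]) (rule card_polys_lt)
  show "card (ffield d :: 'a alg_closure set) \<le> card ?E"
    unfolding card card_ffield(1)[OF d_pos] ..
  show "?E \<subseteq> ffield d"
  proof
    fix y assume "y \<in> ?E"
    then obtain f where f: "y = ev f x" by blast
    show "y \<in> ffield d"
    proof (cases "y = 0")
      case True
      then show ?thesis using card_gt_1[where 'a='a] by (simp add: ffield_def)
    next
      case False
      let ?E' = "?E - {0}"
      have "0 \<in> ?E" using ev_in_image[of 0] by simp
      then have card': "card ?E' = CARD('a) ^ d - 1" by (simp add: card)
      have "y ^ card ?E' = 1"
      proof (rule power_card_eq_1)
        show "(*) y ` ?E' \<subseteq> ?E'"
        proof
          fix z assume "z \<in> (*) y ` ?E'"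
          then obtain g where "z = ev (f * g) x" "z \<noteq> 0" using False f by auto
          with ev_in_image[of "f * g"] show "z \<in> ?E'" by simp
        qed
      qed (use False in simp_all)
      then have "y ^ (CARD('a) ^ d - 1) = 1" unfolding card' .
      moreover have "CARD('a) ^ d > 0" using card_gt_1[where 'a='a] by simp
      ultimately have "y ^ (CARD('a) ^ d) = y"
        using power_minus_mult[of "CARD('a) ^ d" y] by simp
      then show ?thesis
        unfolding ffield_def by (rule CollectI)
    qed
  qed
qed

lemma ev_in_ffield: "ev f x \<in> ffield d"
  using ev_in_image[of f] unfolding ev_image_polys_lt .

lemma root_in_ffield: "x \<in> ffield d"
  using ev_in_ffield[of "[:0, 1:]"] by simp

lemma root_power_mult: "x ^ (CARD('a) ^ (d * k)) = x"
proof (induction k)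
  case (Suc k)
  have "x ^ (CARD('a) ^ (d * Suc k)) = (x ^ (CARD('a) ^ d)) ^ (CARD('a) ^ (d * k))"
    by (simp add: power_add flip: power_mult)
  with Suc root_in_ffield show ?case by (simp add: ffield_def)
qed simp

text \<open>If s = r mod d were positive, \<open>x\<close> and with it every polynomial value at
  \<open>x\<close> would be fixed by the s-th iterate of Frobenius, so that a field of q^d elements
  would fit into one of q^s elements.\<close>

lemma root_in_ffield_iff: "x \<in> ffield r \<longleftrightarrow> d dvd r"
proof
  assume "d dvd r"
  then show "x \<in> ffield r" using root_power_mult by (auto simp: ffield_def elim!: dvdE)
next
  assume r: "x \<in> ffield r"
  define s where "s = r mod d"
  have s: "s < d" using d_pos by (simp add: s_def)
  have "x = x ^ (CARD('a) ^ (d * (r div d) + s))" using r unfolding ffield_def s_def by simp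
  also have "\<dots> = x ^ (CARD('a) ^ s)"
    unfolding power_add power_mult[of x] root_power_mult ..
  finally have xs: "x ^ (CARD('a) ^ s) = x" ..
  have "s = 0"
  proof (rule ccontr)
    assume "s \<noteq> 0"
    then have s0: "s > 0" by simp
    have "(\<lambda>f. ev f x) ` polys_lt d \<subseteq> ffield s"
      unfolding ffield_def using ev_frobenius[of _ x s] xs by auto
    then have "card (ffield d :: 'a alg_closure set) \<le> card (ffield s :: 'a alg_closure set)"
      unfolding ev_image_polys_lt by (intro card_mono card_ffield(2) s0)
    then have "CARD('a) ^ d \<le> CARD('a) ^ s"
      unfolding card_ffield(1)[OF s0] card_ffield(1)[OF d_pos] .
    with s card_gt_1[where 'a='a] show False by simp
  qed
  then show "d dvd r" by (simp add: s_def dvd_eq_mod_eq_0)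
qed

lemma conjugates_inj: "inj_on (\<lambda>i. x ^ (CARD('a) ^ i)) {..<d}"
proof -
  have *: False if "i < j" "j < d" "x ^ (CARD('a) ^ i) = x ^ (CARD('a) ^ j)" for i j
  proof -
    have "x = x ^ (CARD('a) ^ (i + (d - i)))"
      using that root_in_ffield by (simp add: ffield_def)
    also have "\<dots> = (x ^ (CARD('a) ^ j)) ^ (CARD('a) ^ (d - i))"
      unfolding power_add power_mult[of x] that(3) ..
    also have "\<dots> = x ^ (CARD('a) ^ (j + (d - i)))"
      by (simp flip: power_mult power_add)
    also have "j + (d - i) = d + (j - i)" using that by simp
    finally have "x \<in> ffield (d + (j - i))" unfolding ffield_def by simp
    then have "d dvd d + (j - i)" unfolding root_in_ffield_iff .
    then have "d dvd j - i" by (simp add: dvd_add_right_iff)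
    then have "d \<le> j - i" using that(1) by (intro dvd_imp_le) auto
    with that show False by simp
  qed
  show ?thesis
  proof (rule inj_onI)
    fix i j assume "i \<in> {..<d}" "j \<in> {..<d}" "x ^ (CARD('a) ^ i) = x ^ (CARD('a) ^ j)"
    with *[of i j] *[of j i] show "i = j" by (cases i j rule: linorder_cases) auto
  qed
qed

text \<open>Frobenius commutes with evaluation and so maps roots to roots. The d conjugates are
  distinct and the degree leaves room for no others. In particular irreducible polynomials over a
  finite field are separable.\<close>

lemma roots_eq_conjugates: "{y. ev P y = 0} = (\<lambda>i. x ^ (CARD('a) ^ i)) ` {..<d}"
proof (rule sym, rule card_seteq)
  have "P \<noteq> 0" using P by auto
  then show "finite {y. ev P y = 0}" by (rule finite_ev_roots)
  show "(\<lambda>i. x ^ (CARD('a) ^ i)) ` {..<d} \<subseteq> {y. ev P y = 0}"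
    using x card_gt_1[where 'a='a] by (auto simp: ev_frobenius)
  show "card {y. ev P y = 0} \<le> card ((\<lambda>i. x ^ (CARD('a) ^ i)) ` {..<d})"
    by (subst card_image[OF conjugates_inj]) (use card_ev_roots[OF \<open>P \<noteq> 0\<close>] d in simp)
qed

lemma card_roots_irreducible: "card {y. ev P y = 0} = d"
  unfolding roots_eq_conjugates by (subst card_image[OF conjugates_inj]) simp

end

section \<open>The Legendre symbol\<close>

lemma two_neq_0_alg_closure:
  assumes "odd CARD('a::{field,finite})"
  shows "(2 :: 'a alg_closure) \<noteq> 0"
proof
  assume "(2 :: 'a alg_closure) = 0"
  then have "of_nat 2 = (0 :: 'a alg_closure)" by simp
  then have "CHAR('a) dvd 2" unfolding of_nat_eq_0_iff_char_dvd CHAR_alg_closure .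
  then have char2: "CHAR('a) = 2"
    using prime_CHAR[where 'a='a] two_is_prime_nat primes_dvd_imp_eq by blast
  obtain e where e: "CARD('a) = CHAR('a) ^ e" using card_prime_power by blast
  with card_gt_1[where 'a='a] have "e \<noteq> 0" by (intro notI) simp
  then have "even CARD('a)" unfolding e char2 by simp
  with assms show False by simp
qed

text \<open>The symbols are integers, while Euler's criterion and the resultant formula live in the
  algebraic closure. Odd characteristic keeps -1, 0 and 1 distinct there, so identities proved in
  the closure can be pulled back.\<close>

lemma of_int_sign_inj:
  assumes odd: "odd CARD('a::{field,finite})"
    and ab: "a \<in> {-1, 0, 1::int}" "b \<in> {-1, 0, 1}" "of_int a = (of_int b :: 'a alg_closure)"
  shows "a = b"
proof -
  have "(1 :: 'a alg_closure) \<noteq> - 1" "(-1 :: 'a alg_closure) \<noteq> 1"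
    using two_neq_0_alg_closure[OF odd]
    by (metis add.right_inverse one_add_one)+
  with ab show ?thesis by auto
qed

lemma poly_legendre_values: "poly_legendre f P \<in> {-1, 0, 1}"
  by (simp add: poly_legendre_def)

lemma half_exponent:
  assumes "odd (q :: nat)" "q > 1" "d > 0"
  shows "2 * ((q ^ d - 1) div 2) = q ^ d - 1" "(q ^ d - 1) div 2 > 0"
proof -
  have "odd (q ^ d)" using assms(1) by simp
  then show "2 * ((q ^ d - 1) div 2) = q ^ d - 1" by simp
  have "q ^ 1 \<le> q ^ d" using assms by (intro power_increasing) auto
  moreover have "q \<ge> 3" using assms(1,2) by presburger
  ultimately show "(q ^ d - 1) div 2 > 0" by simp
qed

lemma power_half_exponent_cases:
  fixes y :: "'b::idom"
  assumes "y ^ (2 * e) = 1"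
  shows "y ^ e = 1 \<or> y ^ e = -1"
proof -
  have "(y ^ e)^2 = 1" using assms by (simp add: mult.commute flip: power_mult)
  then show ?thesis by (simp add: power2_eq_1_iff)
qed

lemma ffield_nonzero_power:
  fixes y :: "'a::{field,finite} alg_closure"
  assumes "y \<in> ffield d" "y \<noteq> 0"
  shows "y ^ (CARD('a) ^ d - 1) = 1"
proof -
  have "CARD('a) ^ d > 0" using card_gt_1[where 'a='a] by simp
  then have "y ^ (CARD('a) ^ d - 1) * y = 1 * y"
    using power_minus_mult[of "CARD('a) ^ d" y] assms(1) unfolding ffield_def by simp
  with assms(2) show ?thesis unfolding mult_cancel_right by simp
qed

text \<open>Euler's criterion in the residue field, realised as \<open>ffield d\<close> by
  evaluation at the root \<open>x\<close>. For the harder direction take a square root w of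
  \<open>ev D x\<close> in the closure: if the half power of \<open>ev D x\<close> is 1, then w is
  fixed by the d-th iterate of Frobenius, hence is a polynomial value at \<open>x\<close>, and the
  polynomial is a square root of \<open>D\<close> modulo \<open>P\<close>.\<close>

lemma poly_legendre_euler:
  fixes D P :: "'a::{field,finite} poly"
  assumes odd: "odd CARD('a)" and P: "irreducible P" and x: "ev P x = 0"
  shows "of_int (poly_legendre D P) = ev D x ^ ((CARD('a) ^ degree P - 1) div 2)"
proof -
  define d where "d = degree P"
  define e where "e = (CARD('a) ^ d - 1) div 2"
  have d: "degree P = d" "d > 0" using irreducible_degree_pos[OF P] by (simp_all add: d_def)
  have e: "2 * e = CARD('a) ^ d - 1" "e > 0"
    unfolding e_def using half_exponent[OF odd card_gt_1 d(2)] by auto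
  have "of_int (poly_legendre D P) = ev D x ^ e"
  proof (cases "P dvd D")
    case True
    then have "ev D x = 0" using irreducible_dvd_iff_ev[OF P x] by simp
    with True e(2) show ?thesis by (simp add: poly_legendre_def)
  next
    case False
    then have nz: "ev D x \<noteq> 0" using irreducible_dvd_iff_ev[OF P x] by simp
    have one: "ev D x ^ (2 * e) = 1"
      unfolding e(1) by (rule ffield_nonzero_power[OF ev_in_ffield[OF P x d(1)] nz])
    have iff: "(\<exists>h. [h ^ 2 = D] (mod P)) \<longleftrightarrow> ev D x ^ e = 1"
    proof
      assume "\<exists>h. [h ^ 2 = D] (mod P)"
      then obtain h where "[h ^ 2 = D] (mod P)" by blast
      then have "P dvd h ^ 2 - D" by (simp add: cong_def mod_eq_dvd_iff)
      then have h: "ev D x = ev h x ^ 2" using irreducible_dvd_iff_ev[OF P x] by simp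
      with nz have "ev h x \<noteq> 0" by auto
      with ffield_nonzero_power[OF ev_in_ffield[OF P x d(1), of h]]
      have "ev h x ^ (2 * e) = 1" unfolding e(1) by blast
      then show "ev D x ^ e = 1" unfolding h by (simp add: power_mult)
    next
      assume 1: "ev D x ^ e = 1"
      obtain w where w: "w ^ 2 = ev D x" using nth_root_exists[of 2 "ev D x"] by auto
      have "w ^ (2 * e) = 1" using 1 by (simp add: power_mult w)
      moreover have "CARD('a) ^ d > 0" using card_gt_1[where 'a='a] by simp
      ultimately have "w \<in> ffield d"
        using power_minus_mult[of "CARD('a) ^ d" w] unfolding e(1) ffield_def by simp
      then obtain h where h: "w = ev h x"
        unfolding ev_image_polys_lt[OF P x d(1), symmetric] by blast
      have "ev (h ^ 2 - D) x = 0" using w h by simp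
      then have "P dvd h ^ 2 - D" using irreducible_dvd_iff_ev[OF P x] by simp
      then have "[h ^ 2 = D] (mod P)" by (simp add: cong_def mod_eq_dvd_iff)
      then show "\<exists>h. [h ^ 2 = D] (mod P)" ..
    qed
    show ?thesis
      using power_half_exponent_cases[OF one] False iff by (auto simp: poly_legendre_def)
  qed
  then show ?thesis by (simp add: e_def d_def)
qed

lemma poly_legendre_eqI:
  fixes P :: "'a::{field,finite} poly"
  assumes "odd CARD('a)" "of_int (poly_legendre D P) = (of_int b :: 'a alg_closure)" "b \<in> {-1, 0, 1}"
  shows "poly_legendre D P = b"
  using of_int_sign_inj[OF assms(1) poly_legendre_values assms(3,2)] .

lemma sign_mult: "a \<in> {-1, 0, 1::int} \<Longrightarrow> b \<in> {-1, 0, 1} \<Longrightarrow> a * b \<in> {-1, 0, 1}"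
  by auto

lemma sign_power: "a \<in> {-1, 0, 1::int} \<Longrightarrow> a ^ k \<in> {-1, 0, 1}"
  by (induction k) (auto simp: sign_mult)

lemma sign_prod: "(\<And>i. i \<in> A \<Longrightarrow> f i \<in> {-1, 0, 1::int}) \<Longrightarrow> (\<Prod>i\<in>A. f i) \<in> {-1, 0, 1}"
proof (induction A rule: infinite_finite_induct)
  case (insert i A)
  have "f i * (\<Prod>i\<in>A. f i) \<in> {-1, 0, 1}" using insert by (intro sign_mult) auto
  then show ?case using insert by simp
qed auto

lemma sign_odd_power: "a \<in> {-1, 0, 1::int} \<Longrightarrow> odd k \<Longrightarrow> a ^ k = a"
  by (cases "k = 0") auto

lemma poly_legendre_mult:
  fixes P :: "'a::{field,finite} poly"
  assumes odd: "odd CARD('a)" and P: "irreducible P"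
  shows "poly_legendre (f * g) P = poly_legendre f P * poly_legendre g P"
proof (rule poly_legendre_eqI[OF odd _ sign_mult[OF poly_legendre_values poly_legendre_values]])
  obtain x where x: "ev P x = 0" using P by (rule irreducible_obtain_root)
  show "of_int (poly_legendre (f * g) P) = (of_int (poly_legendre f P * poly_legendre g P) :: 'a alg_closure)"
    unfolding of_int_mult poly_legendre_euler[OF odd P x] by (simp add: power_mult_distrib)
qed

lemma poly_legendre_add_multiple:
  "poly_legendre (f + P * g) P = poly_legendre f (P :: 'a::{field,finite} poly)"
  unfolding poly_legendre_def cong_def by (simp add: dvd_add_left_iff)

lemma poly_legendre_mod: "poly_legendre (f mod P) P = poly_legendre f (P :: 'a::{field,finite} poly)"
  unfolding poly_legendre_def cong_def by (simp add: dvd_mod_iff)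

text \<open>With e half of q^d - 1, the equation y^e = 1 has at most e solutions. Together with 0
  these do not fill a field of q^d elements.\<close>

lemma exists_nonresidue:
  fixes P :: "'a::{field,finite} poly"
  assumes odd: "odd CARD('a)" and P: "irreducible P"
  obtains c where "poly_legendre c P = -1"
proof -
  obtain x where x: "ev P x = 0" using P by (rule irreducible_obtain_root)
  define d where "d = degree P"
  define e where "e = (CARD('a) ^ d - 1) div 2"
  have d: "degree P = d" "d > 0" using irreducible_degree_pos[OF P] by (simp_all add: d_def)
  have e: "2 * e = CARD('a) ^ d - 1" "e > 0"
    unfolding e_def using half_exponent[OF odd card_gt_1 d(2)] by auto
  let ?p = "monom 1 e - 1 :: 'a alg_closure poly"
  have "coeff ?p 0 = -1" using e(2) by simp
  then have p0: "?p \<noteq> 0" by (metis coeff_0 neg_equal_0_iff_equal one_neq_zero)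
  have "degree ?p \<le> e" by (intro degree_diff_le) (auto simp: degree_monom_le)
  with card_poly_roots_bound[OF p0] have "card {y. poly ?p y = 0} \<le> e" by simp
  moreover have "card (insert 0 {y. poly ?p y = 0}) \<le> Suc (card {y. poly ?p y = 0})"
    by (rule card_insert_le_m1) auto
  ultimately have "card (insert 0 {y. poly ?p y = 0}) < CARD('a) ^ d" using e by linarith
  then have "\<not> ffield d \<subseteq> insert 0 {y. poly ?p y = 0}"
    using card_mono[of "insert 0 {y. poly ?p y = 0}" "ffield d"] card_ffield(1)[OF d(2), where 'a='a]
      poly_roots_finite[OF p0] by auto
  then obtain y where "y \<in> ffield d" "y \<notin> insert 0 {y. poly ?p y = 0}"
    by blast
  then have y: "y \<in> ffield d" "y \<noteq> 0" "y ^ e \<noteq> 1"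
    by (simp_all add: poly_monom)
  then obtain c where c: "y = ev c x"
    unfolding ev_image_polys_lt[OF P x d(1), symmetric] by blast
  have "\<not> P dvd c" using y(2) c irreducible_dvd_iff_ev[OF P x] by simp
  then have "poly_legendre c P \<noteq> 0" by (simp add: poly_legendre_def)
  moreover have "poly_legendre c P \<noteq> 1"
  proof
    assume "poly_legendre c P = 1"
    with poly_legendre_euler[OF odd P x, of c] have "ev c x ^ e = 1" by (simp add: e_def d_def)
    with y c show False by simp
  qed
  ultimately have "poly_legendre c P = -1" using poly_legendre_values[of c P] by auto
  with that show ?thesis .
qed

lemma sum_polys_lt_reindex:
  fixes F :: "'a::{field,finite} poly \<Rightarrow> 'b::comm_monoid_add"
  assumes P: "irreducible P" and c: "\<not> P dvd c"
    and F: "\<And>f. F (f mod P) = F f"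
  shows "(\<Sum>h\<in>polys_lt (degree P). F (D + c * h)) = (\<Sum>h\<in>polys_lt (degree P). F h)"
proof -
  let ?T = "\<lambda>h. (D + c * h) mod P"
  have "P \<noteq> 0" using P by auto
  have inj: "inj_on ?T (polys_lt (degree P))"
  proof (rule inj_onI)
    fix f g assume fg: "f \<in> polys_lt (degree P)" "g \<in> polys_lt (degree P)" "?T f = ?T g"
    then have "P dvd c * (f - g)" by (simp add: mod_eq_dvd_iff algebra_simps)
    with c have "P dvd f - g" using irreducible_dvd_mult_iff[OF P] by blast
    with polys_lt_dvd_eq_0[OF polys_lt_diff[OF fg(1,2)]] show "f = g" by simp
  qed
  have "?T ` polys_lt (degree P) = polys_lt (degree P)"
    by (rule endo_inj_surj[OF _ _ inj]) (use mod_in_polys_lt[OF \<open>P \<noteq> 0\<close> refl] in auto)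
  then have "(\<Sum>h\<in>polys_lt (degree P). F h) = (\<Sum>h\<in>?T ` polys_lt (degree P). F h)" by simp
  also have "\<dots> = (\<Sum>h\<in>polys_lt (degree P). F (?T h))"
    by (subst sum.reindex[OF inj]) simp
  finally show ?thesis by (simp add: F)
qed

text \<open>Multiplication by a nonresidue permutes the residues and reverses the sign of the
  sum.\<close>

lemma sum_poly_legendre_residues:
  fixes P :: "'a::{field,finite} poly"
  assumes odd: "odd CARD('a)" and P: "irreducible P"
  shows "(\<Sum>h\<in>polys_lt (degree P). poly_legendre h P) = 0"
proof -
  obtain c where c: "poly_legendre c P = -1" using odd P by (rule exists_nonresidue)
  then have "\<not> P dvd c" by (auto simp: poly_legendre_def)
  have "(\<Sum>h\<in>polys_lt (degree P). poly_legendre h P) = (\<Sum>h\<in>polys_lt (degree P). poly_legendre (0 + c * h) P)"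
    by (rule sum_polys_lt_reindex[where F = "\<lambda>f. poly_legendre f P", OF P \<open>\<not> P dvd c\<close> poly_legendre_mod, symmetric])
  also have "\<dots> = - (\<Sum>h\<in>polys_lt (degree P). poly_legendre h P)"
    by (simp add: poly_legendre_mult[OF odd P] c sum_negf)
  finally show ?thesis by simp
qed

text \<open>Shift \<open>D\<close> by R h, where R is the product of the primes of \<open>S\<close>
  other than \<open>Q\<close> and h has degree below that of \<open>Q\<close>. By the degree
  hypothesis the shift permutes \<open>monic_deg n\<close>; it leaves the symbols at the other
  primes unchanged and runs through all residues modulo \<open>Q\<close>. The symbol at
  \<open>Q\<close> occurs to an odd power, so averaging over h gives zero. This exact orthogonality
  is used both for the length of the L-polynomial and for all moments.\<close>

lemma sum_monic_deg_legendre_eq_0: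
  fixes S :: "'a::{field,finite} poly set"
  assumes odd: "odd CARD('a)" and S: "finite S" "S \<subseteq> monic_irred" and Q: "Q \<in> S" "odd (e Q)"
    and deg: "(\<Sum>P\<in>S. degree P) \<le> n"
  shows "(\<Sum>D\<in>monic_deg n. \<Prod>P\<in>S. poly_legendre D P ^ e P) = 0"
proof -
  let ?R = "\<Prod>P\<in>S-{Q}. P" and ?H = "polys_lt (degree Q) :: 'a poly set"
  let ?F = "\<lambda>D. \<Prod>P\<in>S. poly_legendre D P ^ e P"
  have irr: "irreducible P" if "P \<in> S" for P using S(2) that by (auto simp: monic_irred_irreducible)
  have "\<not> Q dvd ?R"
  proof
    assume "Q dvd ?R"
    then obtain P where "P \<in> S - {Q}" "Q dvd P"
      using irreducible_dvd_prod_iff[OF irr[OF Q(1)], of "S - {Q}" "\<lambda>P. P"] S(1) by auto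
    with monic_irred_dvd_eq[of Q P] Q S(2) show False by auto
  qed
  have "\<forall>P\<in>S. P \<noteq> 0" using irr not_irreducible_zero by blast
  then have "degree ?R = (\<Sum>P\<in>S-{Q}. degree P)" by (subst degree_prod_eq_sum_degree) auto
  moreover have "(\<Sum>P\<in>S. degree P) = degree Q + (\<Sum>P\<in>S-{Q}. degree P)"
    using S(1) Q(1) by (simp add: sum.remove)
  ultimately have degR: "degree ?R + degree Q \<le> n" using deg by simp
  have shift: "(\<Sum>D\<in>monic_deg n. ?F (D + ?R * h)) = (\<Sum>D\<in>monic_deg n. ?F D)" if h: "h \<in> ?H" for h
  proof -
    have Rh: "?R * h \<in> polys_lt n"
      using h degR degree_mult_le[of ?R h] unfolding polys_lt_iff by (cases "h = 0") auto
    then have Rh': "- (?R * h) \<in> polys_lt n" unfolding polys_lt_def by simp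
    show ?thesis
      by (rule sum.reindex_bij_witness[of _ "\<lambda>D. D + - (?R * h)" "\<lambda>D. D + ?R * h"])
         (use monic_deg_add[OF _ Rh] monic_deg_add[OF _ Rh'] in \<open>auto simp del: add_uminus_conv_diff\<close>)
  qed
  have inner: "(\<Sum>h\<in>?H. ?F (D + ?R * h)) = 0" for D
  proof -
    have "?F (D + ?R * h) = (\<Prod>P\<in>S-{Q}. poly_legendre D P ^ e P) * poly_legendre (D + ?R * h) Q" for h
    proof -
      have "?F (D + ?R * h) = poly_legendre (D + ?R * h) Q ^ e Q * (\<Prod>P\<in>S-{Q}. poly_legendre (D + ?R * h) P ^ e P)"
        using S(1) Q(1) by (simp add: prod.remove)
      also have "poly_legendre (D + ?R * h) Q ^ e Q = poly_legendre (D + ?R * h) Q"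
        by (rule sign_odd_power[OF poly_legendre_values Q(2)])
      also have "(\<Prod>P\<in>S-{Q}. poly_legendre (D + ?R * h) P ^ e P) = (\<Prod>P\<in>S-{Q}. poly_legendre D P ^ e P)"
      proof (rule prod.cong[OF refl])
        fix P assume "P \<in> S - {Q}"
        then have "P dvd ?R" using S(1) by (intro dvd_prodI) auto
        then obtain k where "?R = P * k" by (rule dvdE)
        then show "poly_legendre (D + ?R * h) P ^ e P = poly_legendre D P ^ e P"
          using poly_legendre_add_multiple[of D P "k * h"] by (simp add: mult.assoc)
      qed
      finally show ?thesis by (simp add: mult.commute)
    qed
    then have "(\<Sum>h\<in>?H. ?F (D + ?R * h)) =
      (\<Prod>P\<in>S-{Q}. poly_legendre D P ^ e P) * (\<Sum>h\<in>?H. poly_legendre (D + ?R * h) Q)"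
      by (simp add: sum_distrib_left)
    also have "(\<Sum>h\<in>?H. poly_legendre (D + ?R * h) Q) = (\<Sum>h\<in>?H. poly_legendre h Q)"
      by (rule sum_polys_lt_reindex[where F = "\<lambda>f. poly_legendre f Q", OF irr[OF Q(1)] \<open>\<not> Q dvd ?R\<close> poly_legendre_mod])
    also have "\<dots> = 0" by (rule sum_poly_legendre_residues[OF odd irr[OF Q(1)]])
    finally show ?thesis by simp
  qed
  have "int (card ?H) * (\<Sum>D\<in>monic_deg n. ?F D) = (\<Sum>h\<in>?H. \<Sum>D\<in>monic_deg n. ?F (D + ?R * h))"
    by (simp add: shift)
  also have "\<dots> = (\<Sum>D\<in>monic_deg n. \<Sum>h\<in>?H. ?F (D + ?R * h))" by (rule sum.swap)
  also have "\<dots> = 0" by (simp add: inner)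
  finally have "int (card ?H) * (\<Sum>D\<in>monic_deg n. ?F D) = 0" .
  moreover have "card ?H \<noteq> 0" using card_gt_1[where 'a='a] unfolding card_polys_lt by simp
  ultimately show ?thesis unfolding mult_eq_0_iff of_nat_eq_0_iff by blast
qed

section \<open>The quadratic character\<close>

lemma finite_degree_le: "finite {f :: 'a::{field,finite} poly. degree f \<le> n}"
  by (rule finite_subset[OF _ finite_polys_lt[of "Suc n"]]) (auto simp: polys_lt_iff)

lemma monic_mult: "f \<in> monic_polys \<Longrightarrow> g \<in> monic_polys \<Longrightarrow> f * g \<in> monic_polys"
  by (simp add: monic_polys_def lead_coeff_mult)

lemma monic_power: "f \<in> monic_polys \<Longrightarrow> f ^ k \<in> monic_polys"
  by (simp add: monic_polys_def lead_coeff_power)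

lemma monic_cancel: "f \<in> monic_polys \<Longrightarrow> f * g \<in> monic_polys \<Longrightarrow> g \<in> monic_polys"
  by (simp add: monic_polys_def lead_coeff_mult)

lemma monic_nonzero: "f \<in> monic_polys \<Longrightarrow> f \<noteq> 0"
  by (auto simp: monic_polys_def)

lemma one_monic [simp]: "1 \<in> monic_polys"
  by (simp add: monic_polys_def)

lemma monic_irred_in_monic: "P \<in> monic_irred \<Longrightarrow> P \<in> monic_polys"
  by (simp add: monic_irred_def)

lemma monic_degree_0: "f \<in> monic_polys \<Longrightarrow> degree f = 0 \<Longrightarrow> f = 1"
  by (auto simp: monic_polys_def elim!: degree_eq_zeroE)

lemma monic_irred_divisor_exists:
  fixes f :: "'a::field poly"
  assumes "degree f > 0"
  obtains P where "P \<in> monic_irred" "P dvd f"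
proof -
  obtain x where x: "ev f x = 0" using ev_has_root[OF assms] by blast
  obtain P where P: "P \<in> monic_irred" "ev P x = 0" by (rule minimal_polynomial_exists)
  with x irreducible_dvd_iff_ev[OF monic_irred_irreducible[OF P(1)] P(2)] that show ?thesis by blast
qed

text \<open>Plays the role of factorization into primes: multiplicative identities are checked one
  prime factor at a time.\<close>

lemma monic_induct [consumes 1, case_names one mult]:
  fixes f :: "'a::field poly"
  assumes "f \<in> monic_polys" and one: "Q 1"
    and mult: "\<And>P g. P \<in> monic_irred \<Longrightarrow> g \<in> monic_polys \<Longrightarrow> Q g \<Longrightarrow> Q (P * g)"
  shows "Q f"
  using assms(1)
proof (induction "degree f" arbitrary: f rule: less_induct)
  case (less f)
  show ?case
  proof (cases "degree f = 0")
    case True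
    with less.prems one show ?thesis by (auto dest: monic_degree_0)
  next
    case False
    then obtain P where P: "P \<in> monic_irred" "P dvd f" using monic_irred_divisor_exists by blast
    then obtain g where g: "f = P * g" by (elim dvdE)
    have "g \<in> monic_polys"
      using monic_cancel[OF monic_irred_in_monic[OF P(1)]] less.prems g by blast
    moreover have "degree f = degree P + degree g"
      unfolding g using monic_nonzero[OF \<open>g \<in> monic_polys\<close>] monic_nonzero[OF monic_irred_in_monic[OF P(1)]]
      by (rule degree_mult_eq[rotated])
    ultimately have "Q g"
      using irreducible_degree_pos[OF monic_irred_irreducible[OF P(1)]] by (intro less.hyps) auto
    with mult[OF P(1) \<open>g \<in> monic_polys\<close>] g show ?thesis by blast
  qed
qed

text \<open>Comparing degrees bounds the exponents m, so the maximum defining the multiplicity is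
  attained.\<close>

lemma power_dvd_iff_le_multiplicity:
  fixes P :: "'a::field poly"
  assumes P: "irreducible P" and f: "f \<noteq> 0"
  shows "P ^ m dvd f \<longleftrightarrow> m \<le> poly_multiplicity P f"
proof -
  have P0: "P \<noteq> 0" using P by auto
  have *: "m \<le> degree f" if "P ^ m dvd f" for m
  proof -
    have 1: "m * degree P \<le> degree f"
      using dvd_imp_degree_le[OF that f] unfolding degree_power_eq[OF P0] .
    have "1 \<le> degree P" using irreducible_degree_pos[OF P] by simp
    then have "m * 1 \<le> m * degree P" by (rule mult_le_mono2)
    from order_trans[OF this 1] show ?thesis unfolding mult_1_right .
  qed
  then have "{m. P ^ m dvd f} \<subseteq> {..degree f}" unfolding atMost_def by blast
  then have fin: "finite {m. P ^ m dvd f}" by (rule finite_subset) simp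
  have "P ^ 0 dvd f" by simp
  then have ne: "{m. P ^ m dvd f} \<noteq> {}" by blast
  have max: "P ^ poly_multiplicity P f dvd f"
    using Max_in[OF fin ne] unfolding poly_multiplicity_def by simp
  show ?thesis
  proof
    assume "P ^ m dvd f"
    then show "m \<le> poly_multiplicity P f"
      unfolding poly_multiplicity_def by (intro Max_ge fin CollectI)
  next
    assume "m \<le> poly_multiplicity P f"
    with max show "P ^ m dvd f" by (rule power_le_dvd)
  qed
qed

lemma poly_multiplicity_eqI:
  fixes P :: "'a::field poly"
  assumes P: "irreducible P" and f: "f \<noteq> 0" and "\<And>m. P ^ m dvd f \<longleftrightarrow> m \<le> k"
  shows "poly_multiplicity P f = k"
proof (rule antisym)
  show "poly_multiplicity P f \<le> k"
    unfolding assms(3)[symmetric] power_dvd_iff_le_multiplicity[OF P f] ..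
  show "k \<le> poly_multiplicity P f"
    unfolding power_dvd_iff_le_multiplicity[OF P f, symmetric] assms(3) ..
qed

lemma irreducible_power_dvd_mult:
  fixes P :: "'a::field poly"
  assumes P: "irreducible P" and "\<not> P dvd a"
  shows "P ^ m dvd a * b \<longleftrightarrow> P ^ m dvd b"
proof
  assume "P ^ m dvd a * b"
  then show "P ^ m dvd b"
  proof (induction m)
    case (Suc m)
    then have "P ^ m dvd b" using power_le_dvd[OF Suc.prems, of m] by simp
    then obtain c where c: "b = P ^ m * c" by (rule dvdE)
    obtain k where "a * b = P ^ Suc m * k" using Suc.prems by (rule dvdE)
    then have "P ^ m * (a * c) = P ^ m * (P * k)" unfolding c by (simp add: algebra_simps)
    then have "P dvd a * c" using P by auto
    with assms have "P dvd c" using irreducible_dvd_mult_iff by blast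
    then have "P * P ^ m dvd c * P ^ m" by (rule mult_dvd_mono) simp
    then show ?case unfolding c power_Suc mult.commute[of c] .
  qed simp
qed simp

lemma poly_multiplicity_mult_same:
  fixes P :: "'a::field poly"
  assumes P: "irreducible P" and g: "g \<noteq> 0"
  shows "poly_multiplicity P (P * g) = Suc (poly_multiplicity P g)"
proof (rule poly_multiplicity_eqI[OF P])
  show "P * g \<noteq> 0" using P g by auto
  fix m show "P ^ m dvd P * g \<longleftrightarrow> m \<le> Suc (poly_multiplicity P g)"
  proof (cases m)
    case (Suc k)
    have "P ^ m dvd P * g \<longleftrightarrow> P = 0 \<or> P ^ k dvd g"
      unfolding Suc power_Suc by (rule dvd_mult_cancel_left)
    also have "\<dots> \<longleftrightarrow> k \<le> poly_multiplicity P g"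
      unfolding power_dvd_iff_le_multiplicity[OF P g] using P by auto
    finally show ?thesis unfolding Suc by simp
  qed simp
qed

lemma poly_multiplicity_mult_other:
  fixes P :: "'a::field poly"
  assumes P: "irreducible P" and g: "g \<noteq> 0" "a \<noteq> 0" and "\<not> P dvd a"
  shows "poly_multiplicity P (a * g) = poly_multiplicity P g"
  by (rule poly_multiplicity_eqI[OF P])
     (use g irreducible_power_dvd_mult[OF P assms(4)] power_dvd_iff_le_multiplicity[OF P g(1)] in auto)

lemma poly_multiplicity_eq_0:
  fixes P :: "'a::field poly"
  assumes P: "irreducible P" and f: "f \<noteq> 0" and "\<not> P dvd f"
  shows "poly_multiplicity P f = 0"
  using power_dvd_iff_le_multiplicity[OF P f, of 1] assms(3) by simp

definition prime_divisors :: "'a::field poly \<Rightarrow> 'a poly set" where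
  "prime_divisors f = {P \<in> monic_irred. P dvd f}"

lemma prime_divisors_degree: "f \<noteq> 0 \<Longrightarrow> P \<in> prime_divisors f \<Longrightarrow> degree P \<le> degree f"
  by (auto simp: prime_divisors_def dvd_imp_degree_le)

lemma finite_prime_divisors: "f \<noteq> 0 \<Longrightarrow> finite (prime_divisors (f :: 'a::{field,finite} poly))"
  by (rule finite_subset[OF _ finite_degree_le[of "degree f"]]) (auto intro: prime_divisors_degree)

lemma quad_char_prime_divisors:
  "quad_char D f = (\<Prod>P\<in>prime_divisors f. poly_legendre D P ^ poly_multiplicity P f)"
  unfolding quad_char_def prime_divisors_def monic_irred_def
  by (intro prod.cong) auto

lemma quad_char_superset:
  fixes f :: "'a::{field,finite} poly"
  assumes f: "f \<noteq> 0" and S: "finite S" "prime_divisors f \<subseteq> S" "S \<subseteq> monic_irred"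
  shows "quad_char D f = (\<Prod>P\<in>S. poly_legendre D P ^ poly_multiplicity P f)"
  unfolding quad_char_prime_divisors
proof (rule prod.mono_neutral_left[OF S(1,2)], intro ballI)
  fix P assume "P \<in> S - prime_divisors f"
  then have "irreducible P" "\<not> P dvd f"
    using S(3) by (auto simp: prime_divisors_def intro: monic_irred_irreducible)
  then have "poly_multiplicity P f = 0" by (rule poly_multiplicity_eq_0[OF _ f])
  then show "poly_legendre D P ^ poly_multiplicity P f = 1" by simp
qed

lemma quad_char_1 [simp]: "quad_char D (1 :: 'a::field poly) = 1"
proof -
  have "prime_divisors (1 :: 'a poly) = {}"
    using irreducible_not_unit by (auto simp: prime_divisors_def dest: monic_irred_irreducible)
  then show ?thesis unfolding quad_char_prime_divisors by simp
qed

lemma quad_char_prime_mult: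
  fixes P :: "'a::{field,finite} poly"
  assumes P: "P \<in> monic_irred" and g: "g \<noteq> 0"
  shows "quad_char D (P * g) = poly_legendre D P * quad_char D g"
proof -
  have irr: "irreducible P" using P by (rule monic_irred_irreducible)
  then have "P \<noteq> 0" by auto
  with g have nz: "P * g \<noteq> 0" by simp
  let ?S = "prime_divisors (P * g)"
  have S: "finite ?S" "?S \<subseteq> monic_irred" "P \<in> ?S" "prime_divisors g \<subseteq> ?S"
    using finite_prime_divisors[OF nz] P by (auto simp: prime_divisors_def)
  have *: "poly_legendre D R ^ poly_multiplicity R (P * g) = poly_legendre D R ^ poly_multiplicity R g"
    if "R \<in> ?S - {P}" for R
  proof -
    have R: "R \<in> monic_irred" "R \<noteq> P" using that S by auto
    then have "\<not> R dvd P" using monic_irred_dvd_eq P by blast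
    with poly_multiplicity_mult_other[OF monic_irred_irreducible[OF R(1)] g \<open>P \<noteq> 0\<close>] show ?thesis by simp
  qed
  have "quad_char D (P * g) = poly_legendre D P ^ poly_multiplicity P (P * g) *
      (\<Prod>R\<in>?S-{P}. poly_legendre D R ^ poly_multiplicity R (P * g))"
    unfolding quad_char_superset[OF nz S(1) order_refl S(2)] using S by (intro prod.remove)
  also have "\<dots> = poly_legendre D P * (poly_legendre D P ^ poly_multiplicity P g *
      (\<Prod>R\<in>?S-{P}. poly_legendre D R ^ poly_multiplicity R g))"
    unfolding poly_multiplicity_mult_same[OF irr g] using * by (simp add: mult.assoc)
  also have "poly_legendre D P ^ poly_multiplicity P g * (\<Prod>R\<in>?S-{P}. poly_legendre D R ^ poly_multiplicity R g)
      = quad_char D g"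
    unfolding quad_char_superset[OF g S(1,4,2)] using S by (intro prod.remove[symmetric])
  finally show ?thesis .
qed

lemma quad_char_mult:
  fixes f :: "'a::{field,finite} poly"
  assumes f: "f \<in> monic_polys" and g: "g \<noteq> 0"
  shows "quad_char D (f * g) = quad_char D f * quad_char D g"
  using f
proof (induction f rule: monic_induct)
  case (mult P h)
  then have "h \<noteq> 0" "h * g \<noteq> 0" using g by (auto dest: monic_nonzero)
  then show ?case using mult quad_char_prime_mult[OF mult(1)] by (simp add: mult.assoc)
qed simp

lemma quad_char_prime_power:
  "P \<in> monic_irred \<Longrightarrow> quad_char D (P ^ k) = poly_legendre D (P :: 'a::{field,finite} poly) ^ k"
proof (induction k)
  case (Suc k)
  then have "P ^ k \<noteq> 0" by (auto dest: monic_irred_irreducible)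
  with Suc show ?case by (simp add: quad_char_prime_mult)
qed simp

lemma quad_char_values: "quad_char D f \<in> {-1, 0, 1}"
  unfolding quad_char_prime_divisors by (intro sign_prod sign_power poly_legendre_values)

section \<open>Quadratic reciprocity through resultants\<close>

lemma sum_geometric_half:
  assumes "odd (q :: nat)" "q > 1"
  shows "(\<Sum>i<d. q ^ i) * ((q - 1) div 2) = (q ^ d - 1) div 2"
proof -
  have "2 * ((q - 1) div 2) = q - 1" using assms by simp
  then have "2 * ((\<Sum>i<d. q ^ i) * ((q - 1) div 2)) = (\<Sum>i<d. q ^ i) * (q - 1)"
    by (metis mult.assoc mult.commute)
  also have "\<dots> = q ^ d - 1"
  proof -
    have "int ((\<Sum>i<d. q ^ i) * (q - 1)) = int (q ^ d) - 1"
      using power_diff_1_eq[of "int q" d] assms by (simp add: of_nat_diff mult.commute)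
    moreover have "q ^ d \<ge> 1" using assms by simp
    ultimately show ?thesis by linarith
  qed
  finally show ?thesis by (metis nonzero_mult_div_cancel_left zero_neq_numeral)
qed

lemma map_poly_to_ac_mult: "map_poly to_ac (f * g) = map_poly to_ac f * map_poly to_ac g"
  by (rule poly_eqI) (simp add: coeff_map_poly coeff_mult to_ac_sum)

lemma mset_eq_mset_setI:
  assumes "size A \<le> card (set_mset A)"
  shows "A = mset_set (set_mset A)"
proof (rule multiset_eqI)
  fix x
  show "count A x = count (mset_set (set_mset A)) x"
  proof (cases "x \<in># A")
    case True
    have "count A x = 1"
    proof (rule ccontr)
      assume "count A x \<noteq> 1"
      with True have "count A x > 1" using count_greater_zero_iff[of A x] by linarith
      with True have "(\<Sum>y\<in>set_mset A. 1) < (\<Sum>y\<in>set_mset A. count A y)"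
        by (intro sum_strict_mono_ex1) (auto simp: Suc_le_eq)
      with assms show False unfolding size_multiset_overloaded_eq by simp
    qed
    with True show ?thesis by simp
  qed (simp add: not_in_iff)
qed

definition ac_roots :: "'a::field poly \<Rightarrow> 'a alg_closure multiset" where
  "ac_roots f = proots (map_poly to_ac f)"

lemma ac_roots_mult: "f \<noteq> 0 \<Longrightarrow> g \<noteq> 0 \<Longrightarrow> ac_roots (f * g) = ac_roots f + ac_roots g"
  by (simp add: ac_roots_def map_poly_to_ac_mult proots_mult)

lemma ac_roots_1 [simp]: "ac_roots 1 = {#}"
  by (simp add: ac_roots_def)

lemma prod_mset_linear_eval: "poly (\<Prod>x\<in>#A. [:-x, 1:]) y = (\<Prod>x\<in>#A. y - x :: 'b::comm_ring_1)"
  by (induction A) (auto simp: left_diff_distrib)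

lemma monic_ac_roots:
  fixes f :: "'a::field poly"
  assumes "f \<in> monic_polys"
  shows "size (ac_roots f) = degree f" and "ev f y = (\<Prod>x\<in>#ac_roots f. y - x)"
proof -
  have nz: "map_poly to_ac f \<noteq> 0" using monic_nonzero[OF assms] by simp
  have lc: "lead_coeff (map_poly to_ac f) = 1"
    using assms by (simp add: coeff_map_poly monic_polys_def)
  obtain A where A: "size A = degree f" "map_poly to_ac f = (\<Prod>x\<in>#A. [:-x, 1:])"
    using alg_closed_imp_factorization[OF nz] unfolding lc by auto
  then have "ac_roots f = A" unfolding ac_roots_def by (simp add: proots_prod_linear)
  with A show "size (ac_roots f) = degree f" "ev f y = (\<Prod>x\<in>#ac_roots f. y - x)"
    by (simp_all add: ev_def prod_mset_linear_eval)
qed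

lemma ac_roots_irreducible:
  fixes P :: "'a::{field,finite} poly"
  assumes P: "irreducible P"
  shows "ac_roots P = mset_set {y. ev P y = 0}"
proof -
  obtain x where x: "ev P x = 0" using P by (rule irreducible_obtain_root)
  have "P \<noteq> 0" using P by auto
  then have nz: "map_poly to_ac P \<noteq> 0" by simp
  have set: "set_mset (ac_roots P) = {y. ev P y = 0}" using nz by (simp add: ev_def ac_roots_def)
  have "size (ac_roots P) \<le> degree P"
    unfolding ac_roots_def using size_proots_le[of "map_poly to_ac P"] by simp
  also have "\<dots> = card (set_mset (ac_roots P))"
    unfolding set using card_roots_irreducible[OF P x refl] by simp
  finally have "ac_roots P = mset_set (set_mset (ac_roots P))" by (rule mset_eq_mset_setI)
  then show ?thesis unfolding set .
qed

text \<open>The roots of \<open>P\<close> are the conjugates of one root x, so the product of the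
  values of \<open>D\<close> over them is D(x) to the power 1 + q + ... + q^(d-1). Times (q - 1) / 2
  this is Euler's exponent. The product is the resultant of \<open>P\<close> and
  \<open>D\<close>.\<close>

lemma poly_legendre_resultant:
  fixes D P :: "'a::{field,finite} poly"
  assumes odd: "odd CARD('a)" and P: "irreducible P"
  shows "of_int (poly_legendre D P) = (\<Prod>a\<in>#ac_roots P. ev D a) ^ ((CARD('a) - 1) div 2)"
proof -
  obtain x where x: "ev P x = 0" using P by (rule irreducible_obtain_root)
  have "(\<Prod>a\<in>#ac_roots P. ev D a) = (\<Prod>a\<in>{y. ev P y = 0}. ev D a)"
    unfolding ac_roots_irreducible[OF P] by (simp add: prod_unfold_prod_mset)
  also have "\<dots> = (\<Prod>i<degree P. ev D (x ^ (CARD('a) ^ i)))"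
    unfolding roots_eq_conjugates[OF P x refl] by (subst prod.reindex[OF conjugates_inj[OF P x refl]]) simp
  also have "\<dots> = ev D x ^ (\<Sum>i<degree P. CARD('a) ^ i)"
    by (simp add: ev_frobenius power_sum)
  finally have e: "(\<Prod>a\<in>#ac_roots P. ev D a) = ev D x ^ (\<Sum>i<degree P. CARD('a) ^ i)" .
  show ?thesis
    unfolding poly_legendre_euler[OF odd P x] e power_mult[symmetric] sum_geometric_half[OF odd card_gt_1] ..
qed

lemma quad_char_resultant:
  fixes D f :: "'a::{field,finite} poly"
  assumes odd: "odd CARD('a)" and f: "f \<in> monic_polys"
  shows "of_int (quad_char D f) = (\<Prod>a\<in>#ac_roots f. ev D a) ^ ((CARD('a) - 1) div 2)"
  using f
proof (induction f rule: monic_induct)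
  case (mult P g)
  have irr: "irreducible P" using mult(1) by (rule monic_irred_irreducible)
  have nz: "P \<noteq> 0" "g \<noteq> 0" using irr monic_nonzero[OF mult(2)] by auto
  show ?case
    unfolding quad_char_prime_mult[OF mult(1) nz(2)] ac_roots_mult[OF nz] of_int_mult mult(3)
      poly_legendre_resultant[OF odd irr]
    by (simp add: power_mult_distrib)
qed simp

lemma prod_mset_swap_diff:
  fixes A B :: "'b::comm_ring_1 multiset"
  shows "(\<Prod>a\<in>#A. \<Prod>b\<in>#B. a - b) = (-1) ^ (size A * size B) * (\<Prod>b\<in>#B. \<Prod>a\<in>#A. b - a)"
proof -
  have neg: "(\<Prod>b\<in>#B. a - b) = (-1) ^ size B * (\<Prod>b\<in>#B. b - a)" for a
    by (induction B) (auto simp: algebra_simps)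
  have split: "(\<Prod>b\<in>#B. (b - a) * F b) = (\<Prod>b\<in>#B. b - a) * (\<Prod>b\<in>#B. F b)" for a and F :: "'b \<Rightarrow> 'b"
    by (rule prod_mset.distrib)
  show ?thesis
  proof (induction A)
    case (add x A)
    have "(\<Prod>a\<in>#add_mset x A. \<Prod>b\<in>#B. a - b) = (\<Prod>b\<in>#B. x - b) * (\<Prod>a\<in>#A. \<Prod>b\<in>#B. a - b)"
      by simp
    also have "\<dots> = ((-1) ^ size B * (-1) ^ (size A * size B)) *
        ((\<Prod>b\<in>#B. b - x) * (\<Prod>b\<in>#B. \<Prod>a\<in>#A. b - a))"
      unfolding add neg[of x] by (simp only: mult_ac)
    also have "(-1) ^ size B * (-1) ^ (size A * size B) = ((-1) ^ (size (add_mset x A) * size B) :: 'b)"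
      by (simp add: power_add)
    also have "(\<Prod>b\<in>#B. b - x) * (\<Prod>b\<in>#B. \<Prod>a\<in>#A. b - a) = (\<Prod>b\<in>#B. (b - x) * (\<Prod>a\<in>#A. b - a))"
      by (rule split[symmetric])
    also have "\<dots> = (\<Prod>b\<in>#B. \<Prod>a\<in>#add_mset x A. b - a)" by simp
    finally show ?case .
  qed simp
qed

text \<open>For monic polynomials the resultant is the product of all differences of roots, so
  exchanging \<open>f\<close> and \<open>D\<close> only changes the sign of each of the
  \<open>degree f * degree D\<close> factors. If the polynomials share a root, both symbols vanish
  and the formula still holds.\<close>

lemma quad_char_reciprocity:
  fixes D f :: "'a::{field,finite} poly"
  assumes odd: "odd CARD('a)" and f: "f \<in> monic_polys" and D: "D \<in> monic_polys"
  shows "quad_char D f = (-1) ^ (degree f * degree D * ((CARD('a) - 1) div 2)) * quad_char f D"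
proof (rule of_int_sign_inj[OF odd quad_char_values])
  show "(-1) ^ (degree f * degree D * ((CARD('a) - 1) div 2)) * quad_char f D \<in> {-1, 0, 1}"
    by (intro sign_mult sign_power quad_char_values) simp
  show "(of_int (quad_char D f) :: 'a alg_closure) =
      of_int ((-1) ^ (degree f * degree D * ((CARD('a) - 1) div 2)) * quad_char f D)"
    unfolding of_int_mult of_int_power quad_char_resultant[OF odd f] quad_char_resultant[OF odd D]
      monic_ac_roots(2)[OF f] monic_ac_roots(2)[OF D]
    by (subst prod_mset_swap_diff)
       (simp add: monic_ac_roots(1)[OF f] monic_ac_roots(1)[OF D] power_mult_distrib power_mult)
qed

lemma prod_primes_dvd:
  fixes f :: "'a::field poly"
  assumes "finite S" "S \<subseteq> monic_irred" "\<And>P. P \<in> S \<Longrightarrow> P dvd f"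
  shows "\<Prod>S dvd f"
  using assms
proof (induction S)
  case (insert P S)
  then have "\<Prod>S dvd f" by simp
  then obtain g where g: "f = \<Prod>S * g" by (rule dvdE)
  have irr: "irreducible P" using insert.prems by (auto intro: monic_irred_irreducible)
  have "\<not> P dvd \<Prod>S"
    using irreducible_dvd_prod_iff[OF irr insert.hyps(1), of "\<lambda>P. P"] monic_irred_dvd_eq[of P]
      insert.prems insert.hyps by auto
  then have "P dvd g" using insert.prems(2)[of P] irreducible_dvd_mult_iff[OF irr] unfolding g by simp
  then have "\<Prod>S * P dvd f" unfolding g by (intro mult_dvd_mono) auto
  then show ?case using insert.hyps by (simp add: mult.commute)
qed simp

text \<open>Reciprocity turns the sum into one of \<open>quad_char f D\<close> over
  \<open>f\<close>, a product of symbols of \<open>f\<close> at the primes of \<open>D\<close>. Any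
  prime of a square-free \<open>D\<close> has multiplicity one, which is odd, and the degrees of
  these primes add up to at most \<open>n\<close>, so the orthogonality applies as soon as
  \<open>m \<ge> n\<close>.\<close>

lemma sum_quad_char_monic_deg:
  fixes D :: "'a::{field,finite} poly"
  assumes odd: "odd CARD('a)" and D: "D \<in> monic_squarefree n" and n: "n > 0" and m: "m \<ge> n"
  shows "(\<Sum>f\<in>monic_deg m. quad_char D f) = 0"
proof -
  have D': "D \<in> monic_polys" "squarefree D" "degree D = n"
    using D by (auto simp: monic_squarefree_def)
  have D0: "D \<noteq> 0" by (rule monic_nonzero[OF D'(1)])
  let ?S = "prime_divisors D"
  have S: "finite ?S" "?S \<subseteq> monic_irred"
    using finite_prime_divisors[OF D0] by (auto simp: prime_divisors_def)
  obtain Q where Q: "Q \<in> monic_irred" "Q dvd D" using monic_irred_divisor_exists n D'(3) by blast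
  have irr: "irreducible Q" using Q(1) by (rule monic_irred_irreducible)
  have "\<not> Q ^ 2 dvd D"
  proof
    assume "Q ^ 2 dvd D"
    with D'(2) have "Q dvd 1" by (rule squarefreeD)
    with irr show False using irreducible_not_unit by blast
  qed
  moreover have "Q ^ 1 dvd D" using Q(2) by simp
  ultimately have "poly_multiplicity Q D = 1"
    unfolding power_dvd_iff_le_multiplicity[OF irr D0] by simp
  then have Q': "Q \<in> ?S" "odd (poly_multiplicity Q D)" using Q by (auto simp: prime_divisors_def)
  have "\<Prod>?S dvd D" by (rule prod_primes_dvd[OF S]) (auto simp: prime_divisors_def)
  then have "degree (\<Prod>?S) \<le> n" using dvd_imp_degree_le[OF _ D0] D'(3) by simp
  moreover have "0 \<notin> ?S" using S(2) monic_irred_irreducible not_irreducible_zero by blast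
  then have "degree (\<Prod>?S) = (\<Sum>P\<in>?S. degree P)" by (subst degree_prod_eq_sum_degree) auto
  ultimately have "(\<Sum>P\<in>?S. degree P) \<le> m" using m by simp
  then have 0: "(\<Sum>f\<in>monic_deg m. quad_char f D) = 0"
    unfolding quad_char_prime_divisors by (rule sum_monic_deg_legendre_eq_0[where e = "\<lambda>P. poly_multiplicity P D", OF odd S Q'])
  have "(\<Sum>f\<in>monic_deg m. quad_char D f) =
      (\<Sum>f\<in>monic_deg m. (-1) ^ (m * n * ((CARD('a) - 1) div 2)) * quad_char f D)"
    by (rule sum.cong[OF refl]) (use quad_char_reciprocity[OF odd _ D'(1)] D'(3) in \<open>auto simp: monic_deg_def\<close>)
  also have "\<dots> = 0" unfolding sum_distrib_left[symmetric] 0 by simp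
  finally show ?thesis .
qed

section \<open>The \<open>L\<close>-polynomial\<close>

definition csum :: "'a::{field,finite} poly \<Rightarrow> nat \<Rightarrow> int" where
  "csum D m = (\<Sum>f\<in>monic_deg m. quad_char D f)"

text \<open>The coefficients of \<open>u * L' / L\<close>.\<close>

definition psum :: "'a::{field,finite} poly \<Rightarrow> nat \<Rightarrow> int" where
  "psum D r = (\<Sum>P | P \<in> monic_irred \<and> degree P dvd r. int (degree P) * poly_legendre D P ^ (r div degree P))"

definition irred_le :: "nat \<Rightarrow> 'a::field poly set" where
  "irred_le m = {P \<in> monic_irred. degree P \<le> m}"

lemma finite_irred_le [simp]: "finite (irred_le m :: 'a::{field,finite} poly set)"
  unfolding irred_le_def by (rule finite_subset[OF _ finite_degree_le[of m]]) auto

lemma irred_le_monic_irred: "irred_le m \<subseteq> monic_irred"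
  by (auto simp: irred_le_def)

lemma monic_irred_degree_pos: "P \<in> monic_irred \<Longrightarrow> degree P > 0"
  by (rule irreducible_degree_pos[OF monic_irred_irreducible])

lemma monic_irred_nonzero: "P \<in> monic_irred \<Longrightarrow> P \<noteq> 0"
  by (rule monic_nonzero[OF monic_irred_in_monic])

lemma degree_eq_sum_multiplicity:
  fixes f :: "'a::{field,finite} poly"
  assumes f: "f \<in> monic_polys" and S: "finite S" "S \<subseteq> monic_irred" and sub: "prime_divisors f \<subseteq> S"
  shows "degree f = (\<Sum>P\<in>S. degree P * poly_multiplicity P f)"
  using f sub
proof (induction f rule: monic_induct)
  case one
  have "poly_multiplicity P 1 = 0" if "P \<in> S" for P
  proof (rule poly_multiplicity_eq_0)
    show "irreducible P" using that S(2) by (auto intro: monic_irred_irreducible)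
    then show "\<not> P dvd 1" by (rule irreducible_not_unit)
  qed simp
  then show ?case by simp
next
  case (mult P g)
  have g: "g \<noteq> 0" by (rule monic_nonzero[OF mult(2)])
  have P0: "P \<noteq> 0" by (rule monic_irred_nonzero[OF mult(1)])
  have sub: "prime_divisors g \<subseteq> S" using mult(4) by (auto simp: prime_divisors_def)
  have PS: "P \<in> S" using mult(1,4) by (auto simp: prime_divisors_def)
  have other: "poly_multiplicity R (P * g) = poly_multiplicity R g" if "R \<in> S - {P}" for R
  proof (rule poly_multiplicity_mult_other[OF _ g P0])
    have R: "R \<in> monic_irred" using that S(2) by blast
    then show "irreducible R" by (rule monic_irred_irreducible)
    show "\<not> R dvd P" using monic_irred_dvd_eq[OF R mult(1)] that by blast
  qed
  have "(\<Sum>R\<in>S. degree R * poly_multiplicity R (P * g)) =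
      degree P * poly_multiplicity P (P * g) + (\<Sum>R\<in>S-{P}. degree R * poly_multiplicity R (P * g))"
    by (rule sum.remove[OF S(1) PS])
  also have "\<dots> = degree P + (degree P * poly_multiplicity P g + (\<Sum>R\<in>S-{P}. degree R * poly_multiplicity R g))"
    unfolding poly_multiplicity_mult_same[OF monic_irred_irreducible[OF mult(1)] g] using other by simp
  also have "degree P * poly_multiplicity P g + (\<Sum>R\<in>S-{P}. degree R * poly_multiplicity R g) =
      (\<Sum>R\<in>S. degree R * poly_multiplicity R g)"
    by (rule sum.remove[OF S(1) PS, symmetric])
  finally show ?case using mult(3)[OF sub] degree_mult_eq[OF P0 g] by simp
qed

lemma poly_multiplicity_le_degree:
  fixes f :: "'a::field poly"
  assumes P: "irreducible P" and f: "f \<noteq> 0"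
  shows "poly_multiplicity P f \<le> degree f"
proof -
  have P0: "P \<noteq> 0" using P by auto
  have "P ^ poly_multiplicity P f dvd f" unfolding power_dvd_iff_le_multiplicity[OF P f] ..
  then have "degree (P ^ poly_multiplicity P f) \<le> degree f" using f by (rule dvd_imp_degree_le)
  then have 1: "poly_multiplicity P f * degree P \<le> degree f" unfolding degree_power_eq[OF P0] .
  have "1 \<le> degree P" using irreducible_degree_pos[OF P] by simp
  then have "poly_multiplicity P f * 1 \<le> poly_multiplicity P f * degree P" by (rule mult_le_mono2)
  from order_trans[OF this 1] show ?thesis unfolding mult_1_right .
qed

lemma poly_multiplicity_eq_sum:
  fixes f :: "'a::field poly"
  assumes P: "irreducible P" and f: "f \<noteq> 0" "degree f \<le> m"
  shows "poly_multiplicity P f = (\<Sum>i=1..m. if P ^ i dvd f then 1 else 0)"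
proof -
  have le: "poly_multiplicity P f \<le> m" using poly_multiplicity_le_degree[OF P f(1)] f(2) by simp
  have "(\<Sum>i=1..m. if P ^ i dvd f then 1 else 0) = (\<Sum>i=1..poly_multiplicity P f. 1 :: nat)"
    unfolding power_dvd_iff_le_multiplicity[OF P f(1)]
    by (rule sum.mono_neutral_cong_right) (use le in auto)
  then show ?thesis by simp
qed

lemma sum_quad_char_multiples:
  fixes P :: "'a::{field,finite} poly"
  assumes P: "P \<in> monic_irred"
  shows "(\<Sum>f | f \<in> monic_deg m \<and> P ^ i dvd f. quad_char D f) =
    (if i * degree P \<le> m then poly_legendre D P ^ i * csum D (m - i * degree P) else 0)"
proof -
  have P0: "P \<noteq> 0" by (rule monic_irred_nonzero[OF P])
  have degPi: "degree (P ^ i) = i * degree P" by (rule degree_power_eq[OF P0])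
  have Pi: "P ^ i \<in> monic_polys" by (rule monic_power[OF monic_irred_in_monic[OF P]])
  show ?thesis
  proof (cases "i * degree P \<le> m")
    case True
    have inj: "inj_on ((*) (P ^ i)) (monic_deg (m - i * degree P))"
      using P0 by (auto simp: inj_on_def)
    have eq: "{f. f \<in> monic_deg m \<and> P ^ i dvd f} = (*) (P ^ i) ` monic_deg (m - i * degree P)"
    proof (intro equalityI subsetI)
      fix f assume "f \<in> {f. f \<in> monic_deg m \<and> P ^ i dvd f}"
      then have f: "f \<in> monic_polys" "degree f = m" "P ^ i dvd f" by (auto simp: monic_deg_def)
      from f(3) obtain g where g: "f = P ^ i * g" by (rule dvdE)
      have gm: "g \<in> monic_polys" using monic_cancel[OF Pi] f(1) g by blast
      then have "degree f = i * degree P + degree g"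
        unfolding g using degree_mult_eq[OF _ monic_nonzero[OF gm], of "P ^ i"] P0 degPi by simp
      with f(2) gm have "g \<in> monic_deg (m - i * degree P)" by (simp add: monic_deg_def)
      with g show "f \<in> (*) (P ^ i) ` monic_deg (m - i * degree P)" by blast
    next
      fix f assume "f \<in> (*) (P ^ i) ` monic_deg (m - i * degree P)"
      then obtain g where g: "f = P ^ i * g" "g \<in> monic_polys" "degree g = m - i * degree P"
        by (auto simp: monic_deg_def)
      have "degree f = i * degree P + degree g"
        unfolding g(1) using degree_mult_eq[OF _ monic_nonzero[OF g(2)], of "P ^ i"] P0 degPi by simp
      with g True monic_mult[OF Pi g(2)] show "f \<in> {f. f \<in> monic_deg m \<and> P ^ i dvd f}"
        by (simp add: monic_deg_def)
    qed
    have "(\<Sum>f | f \<in> monic_deg m \<and> P ^ i dvd f. quad_char D f) =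
        (\<Sum>g\<in>monic_deg (m - i * degree P). quad_char D (P ^ i * g))"
      unfolding eq by (subst sum.reindex[OF inj]) simp
    also have "\<dots> = (\<Sum>g\<in>monic_deg (m - i * degree P). poly_legendre D P ^ i * quad_char D g)"
      by (rule sum.cong[OF refl]) (simp add: quad_char_mult[OF Pi monic_deg_nonzero] quad_char_prime_power[OF P])
    finally show ?thesis using True by (simp add: csum_def sum_distrib_left)
  next
    case False
    have empty: "{f. f \<in> monic_deg m \<and> P ^ i dvd f} = {}"
    proof -
      have "i * degree P \<le> m" if "f \<in> monic_deg m" "P ^ i dvd f" for f
        using dvd_imp_degree_le[OF that(2) monic_deg_nonzero[OF that(1)]] that(1) degPi
        by (simp add: monic_deg_def)
      with False show ?thesis by blast
    qed
    show ?thesis unfolding empty using False by simp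
  qed
qed

text \<open>The coefficientwise form of u L' = (u L' / L) L, without any convergence. The degree of
  \<open>f\<close> is the sum of \<open>degree P\<close> over all prime powers \<open>P ^ i\<close>
  dividing \<open>f\<close>; write each such \<open>f\<close> as \<open>P ^ i\<close> times a
  cofactor and collect the terms with \<open>r = i * degree P\<close>.\<close>

lemma csum_newton:
  fixes D :: "'a::{field,finite} poly"
  shows "int m * csum D m = (\<Sum>r=1..m. psum D r * csum D (m - r))"
proof -
  let ?S = "irred_le m :: 'a poly set"
  have deg: "int (degree f) = (\<Sum>P\<in>?S. \<Sum>i=1..m. if P ^ i dvd f then int (degree P) else 0)"
    if "f \<in> monic_deg m" for f
  proof -
    have f: "f \<in> monic_polys" "degree f = m" "f \<noteq> 0"
      using that monic_deg_nonzero by (auto simp: monic_deg_def)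
    have "degree f = (\<Sum>P\<in>?S. degree P * poly_multiplicity P f)"
      by (rule degree_eq_sum_multiplicity[OF f(1) finite_irred_le irred_le_monic_irred])
         (use prime_divisors_degree[OF f(3)] f(2) in \<open>auto simp: irred_le_def prime_divisors_def\<close>)
    also have "\<dots> = (\<Sum>P\<in>?S. degree P * (\<Sum>i=1..m. if P ^ i dvd f then 1 else 0))"
    proof (rule sum.cong[OF refl])
      fix P assume "P \<in> ?S"
      then have "irreducible P" by (auto simp: irred_le_def intro: monic_irred_irreducible)
      then show "degree P * poly_multiplicity P f = degree P * (\<Sum>i=1..m. if P ^ i dvd f then 1 else 0)"
        using poly_multiplicity_eq_sum[OF _ f(3), of P m] f(2) by simp
    qed
    also have "\<dots> = (\<Sum>P\<in>?S. \<Sum>i=1..m. if P ^ i dvd f then degree P else 0)"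
      unfolding sum_distrib_left by (intro sum.cong refl) simp
    finally have "int (degree f) = int (\<Sum>P\<in>?S. \<Sum>i=1..m. if P ^ i dvd f then degree P else 0)" by simp
    also have "\<dots> = (\<Sum>P\<in>?S. \<Sum>i=1..m. if P ^ i dvd f then int (degree P) else 0)"
      unfolding of_nat_sum by (intro sum.cong refl) simp
    finally show ?thesis .
  qed
  have "int m * csum D m = (\<Sum>f\<in>monic_deg m. quad_char D f * int (degree f))"
    unfolding csum_def sum_distrib_left by (intro sum.cong refl) (simp add: monic_deg_def)
  also have "\<dots> = (\<Sum>f\<in>monic_deg m. quad_char D f * (\<Sum>P\<in>?S. \<Sum>i=1..m. if P ^ i dvd f then int (degree P) else 0))"
    by (intro sum.cong refl) (simp only: deg)
  also have "\<dots> = (\<Sum>f\<in>monic_deg m. \<Sum>P\<in>?S. \<Sum>i=1..m. if P ^ i dvd f then int (degree P) * quad_char D f else 0)"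
    unfolding sum_distrib_left by (intro sum.cong refl) simp
  also have "\<dots> = (\<Sum>P\<in>?S. \<Sum>f\<in>monic_deg m. \<Sum>i=1..m. if P ^ i dvd f then int (degree P) * quad_char D f else 0)"
    by (rule sum.swap)
  also have "\<dots> = (\<Sum>P\<in>?S. \<Sum>i=1..m. \<Sum>f\<in>monic_deg m. if P ^ i dvd f then int (degree P) * quad_char D f else 0)"
    by (intro sum.cong refl sum.swap)
  also have "\<dots> = (\<Sum>P\<in>?S. \<Sum>i=1..m. int (degree P) * (\<Sum>f | f \<in> monic_deg m \<and> P ^ i dvd f. quad_char D f))"
    unfolding sum_distrib_left by (intro sum.cong refl sum.inter_filter[symmetric] finite_monic_deg)
  also have "\<dots> = (\<Sum>P\<in>?S. \<Sum>i=1..m. int (degree P) *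
      (if i * degree P \<le> m then poly_legendre D P ^ i * csum D (m - i * degree P) else 0))"
    by (intro sum.cong refl) (simp add: sum_quad_char_multiples irred_le_def)
  also have "\<dots> = (\<Sum>P\<in>?S. \<Sum>r=1..m. if degree P dvd r then
      int (degree P) * (poly_legendre D P ^ (r div degree P) * csum D (m - r)) else 0)"
  proof (rule sum.cong[OF refl])
    fix P assume P: "P \<in> ?S"
    then have d: "degree P > 0" by (auto simp: irred_le_def intro: monic_irred_degree_pos)
    have ge: "i \<le> i * degree P" for i using d by simp
    have "(\<Sum>i=1..m. int (degree P) * (if i * degree P \<le> m then poly_legendre D P ^ i * csum D (m - i * degree P) else 0))
      = (\<Sum>i | i \<in> {1..m} \<and> i * degree P \<le> m. int (degree P) * (poly_legendre D P ^ i * csum D (m - i * degree P)))"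
      by (subst sum.inter_filter) (auto intro!: sum.cong)
    also have "\<dots> = (\<Sum>r | r \<in> {1..m} \<and> degree P dvd r.
        int (degree P) * (poly_legendre D P ^ (r div degree P) * csum D (m - r)))"
    proof (rule sum.reindex_bij_witness[of _ "\<lambda>r. r div degree P" "\<lambda>i. i * degree P"])
      fix r assume "r \<in> {r. r \<in> {1..m} \<and> degree P dvd r}"
      then obtain k where k: "r = degree P * k" "r \<in> {1..m}" by auto
      then have "k > 0" by (intro gr0I) auto
      have "k \<le> m"
        using order_trans[OF ge[of k], of m] k by (simp add: mult.commute)
      then show "r div degree P \<in> {i. i \<in> {1..m} \<and> i * degree P \<le> m}"
        using k d \<open>k \<le> m\<close> \<open>k > 0\<close> by (auto simp: mult.commute Suc_le_eq)
      show "r div degree P * degree P = r" using k d by simp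
    qed (use d in auto)
    also have "\<dots> = (\<Sum>r=1..m. if degree P dvd r then
      int (degree P) * (poly_legendre D P ^ (r div degree P) * csum D (m - r)) else 0)"
      by (rule sum.inter_filter) simp
    finally show "(\<Sum>i=1..m. int (degree P) * (if i * degree P \<le> m then poly_legendre D P ^ i * csum D (m - i * degree P) else 0))
      = (\<Sum>r=1..m. if degree P dvd r then int (degree P) * (poly_legendre D P ^ (r div degree P) * csum D (m - r)) else 0)" .
  qed
  also have "\<dots> = (\<Sum>r=1..m. \<Sum>P\<in>?S. if degree P dvd r then
      int (degree P) * (poly_legendre D P ^ (r div degree P) * csum D (m - r)) else 0)"
    by (rule sum.swap)
  also have "\<dots> = (\<Sum>r=1..m. psum D r * csum D (m - r))"
  proof (rule sum.cong[OF refl])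
    fix r assume r: "r \<in> {1..m}"
    have eq: "{P \<in> ?S. degree P dvd r} = {P. P \<in> monic_irred \<and> degree P dvd r}"
      using r by (auto simp: irred_le_def intro: order_trans[OF dvd_imp_le])
    have "(\<Sum>P\<in>?S. if degree P dvd r then int (degree P) * (poly_legendre D P ^ (r div degree P) * csum D (m - r)) else 0)
      = (\<Sum>P | P \<in> ?S \<and> degree P dvd r. int (degree P) * (poly_legendre D P ^ (r div degree P) * csum D (m - r)))"
      by (rule sum.inter_filter[symmetric]) simp
    then show "(\<Sum>P\<in>?S. if degree P dvd r then int (degree P) * (poly_legendre D P ^ (r div degree P) * csum D (m - r)) else 0)
      = psum D r * csum D (m - r)"
      unfolding eq psum_def sum_distrib_right by (simp add: mult.assoc)
  qed
  finally show ?thesis .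
qed

lemma csum_eq_0:
  fixes D :: "'a::{field,finite} poly"
  assumes "odd CARD('a)" "D \<in> monic_squarefree n" "n > 0" "m \<ge> n"
  shows "csum D m = 0"
  unfolding csum_def using assms by (rule sum_quad_char_monic_deg)

lemma csum_0 [simp]: "csum D 0 = 1"
proof -
  have "monic_deg 0 = {1 :: 'a poly}"
    by (auto simp: monic_deg_def dest: monic_degree_0)
  then show ?thesis by (simp add: csum_def)
qed

text \<open>There are q^m monic polynomials of degree m, so q |u| < 1 gives absolute summability.
  This allows the terms to be grouped by degree, and only degrees below \<open>n\<close>
  survive.\<close>

lemma quad_char_series_has_sum:
  fixes D :: "'a::{field,finite} poly" and u :: complex
  assumes odd: "odd CARD('a)" and D: "D \<in> monic_squarefree n" and n: "n > 0"
    and u: "norm u < 1 / real CARD('a)"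
  shows "((\<lambda>f. of_int (quad_char D f) * u ^ degree f) has_sum
     (\<Sum>m<n. of_int (csum D m) * u ^ m)) (monic_polys :: 'a poly set)"
proof -
  let ?F = "\<lambda>f :: 'a poly. of_int (quad_char D f) * u ^ degree f"
  let ?\<Sigma> = "Sigma (UNIV :: nat set) (\<lambda>m. (monic_deg m :: 'a poly set))"
  have q: "real CARD('a) > 0" using card_gt_1[where 'a='a] by simp
  have inner: "((\<lambda>f. (?F \<circ> snd) (m, f)) has_sum of_int (csum D m) * u ^ m) (monic_deg m)" for m
  proof -
    have "(\<Sum>f\<in>monic_deg m. ?F f) = of_int (csum D m) * u ^ m"
      unfolding csum_def of_int_sum sum_distrib_right by (intro sum.cong refl) (simp add: monic_deg_def)
    with has_sum_finite[OF finite_monic_deg, of ?F m] show ?thesis by (simp add: o_def)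
  qed
  have outer: "((\<lambda>m. of_int (csum D m) * u ^ m) has_sum (\<Sum>m<n. of_int (csum D m) * u ^ m)) UNIV"
    using has_sum_finite_neutralI[of "{..<n}" UNIV "\<lambda>m. of_int (csum D m) * u ^ m"] csum_eq_0[OF odd D n]
    by auto
  have "summable (\<lambda>m. (real CARD('a) * norm u) ^ m)"
    using u q by (intro summable_geometric) (simp add: field_simps)
  then have geo: "(\<lambda>m. (real CARD('a) * norm u) ^ m) summable_on UNIV"
    by (intro norm_summable_imp_summable_on) (simp add: norm_mult norm_power)
  have bound: "((\<lambda>f. norm u ^ degree (snd (m, f))) has_sum (real CARD('a) * norm u) ^ m) (monic_deg m :: 'a poly set)" for m
  proof -
    have "(\<Sum>f\<in>(monic_deg m :: 'a poly set). norm u ^ degree f) = (\<Sum>f\<in>(monic_deg m :: 'a poly set). norm u ^ m)"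
      by (intro sum.cong refl) (simp add: monic_deg_def)
    also have "\<dots> = (real CARD('a) * norm u) ^ m"
      by (simp add: card_monic_deg power_mult_distrib)
    finally have eq: "(\<Sum>f\<in>(monic_deg m :: 'a poly set). norm u ^ degree f) = (real CARD('a) * norm u) ^ m" .
    show ?thesis
      unfolding snd_conv eq[symmetric] by (rule has_sum_finite[OF finite_monic_deg])
  qed
  have "(\<lambda>x. norm u ^ degree (snd x)) summable_on ?\<Sigma>"
    by (rule summable_on_SigmaI[OF bound geo]) simp
  then have "(\<lambda>x. norm ((?F \<circ> snd) x)) summable_on ?\<Sigma>"
  proof (rule summable_on_comparison_test)
    fix x :: "nat \<times> 'a poly"
    have "\<bar>real_of_int (quad_char D (snd x))\<bar> \<le> 1" using quad_char_values[of D "snd x"] by auto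
    then show "norm ((?F \<circ> snd) x) \<le> norm u ^ degree (snd x)"
      by (simp add: norm_mult norm_power mult_left_le_one_le)
  qed simp
  then have "(?F \<circ> snd) summable_on ?\<Sigma>"
    by (rule abs_summable_summable)
  from has_sum_SigmaI[OF inner outer this]
  have 1: "((?F \<circ> snd) has_sum (\<Sum>m<n. of_int (csum D m) * u ^ m)) ?\<Sigma>" .
  have 2: "inj_on snd ?\<Sigma>"
    by (auto simp: inj_on_def monic_deg_def)
  have 3: "snd ` ?\<Sigma> = monic_polys"
    by (force simp: monic_deg_def)
  from has_sum_reindex[OF 2, THEN iffD2, OF 1] show ?thesis unfolding 3 .
qed

lemma L_poly_eq:
  fixes D :: "'a::{field,finite} poly"
  assumes odd: "odd CARD('a)" and D: "D \<in> monic_squarefree n" and n: "n > 0"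
  shows "L_poly D = (\<Sum>m<n. monom (of_int (csum D m)) m)"
proof (rule L_poly_eqI)
  fix u :: complex assume "norm u < 1 / real CARD('a)"
  from quad_char_series_has_sum[OF odd D n this]
  show "((\<lambda>f. of_int (quad_char D f) * u ^ degree f) has_sum
     poly (\<Sum>m<n. monom (of_int (csum D m)) m) u) monic_polys"
    by (simp add: poly_sum poly_monom)
qed

lemma coeff_L_poly:
  fixes D :: "'a::{field,finite} poly"
  assumes odd: "odd CARD('a)" and D: "D \<in> monic_squarefree n" and n: "n > 0"
  shows "coeff (L_poly D) m = of_int (csum D m)"
proof (cases "m < n")
  case True
  then show ?thesis unfolding L_poly_eq[OF assms] coeff_sum by (simp add: sum.delta)
next
  case False
  then show ?thesis unfolding L_poly_eq[OF assms] coeff_sum using csum_eq_0[OF assms, of m] by simp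
qed

lemma degree_L_poly:
  fixes D :: "'a::{field,finite} poly"
  assumes odd: "odd CARD('a)" and D: "D \<in> monic_squarefree n" and n: "n > 0"
  shows "degree (L_poly D) \<le> n - 1"
  by (rule degree_le) (use coeff_L_poly[OF assms] csum_eq_0[OF assms] n in auto)

lemma complex_poly_factorization:
  fixes p :: "complex poly"
  assumes "coeff p 0 = 1"
  obtains A where "size A = degree p" "p = (\<Prod>\<alpha>\<in>#A. [:1, -\<alpha>:])"
proof -
  have p0: "p \<noteq> 0" using assms by auto
  obtain B where B: "size B = degree p" "p = smult (lead_coeff p) (\<Prod>z\<in>#B. [:-z, 1:])"
    using alg_closed_imp_factorization[OF p0] by blast
  have nz: "z \<noteq> 0" if "z \<in># B" for z
  proof
    assume "z = 0"
    then have "[:0, 1:] dvd (\<Prod>z\<in>#B. [:-z, 1:])"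
      using that by (intro dvd_prod_mset) auto
    then have "[:0, 1:] dvd p" by (subst B(2)) (rule dvd_smult)
    with assms show False by (auto elim!: dvdE)
  qed
  have *: "(\<Prod>z\<in>#B. [:-z, 1:]) = smult (\<Prod>z\<in>#B. -z) (\<Prod>z\<in>#B. [:1, -inverse z:])"
    using nz
  proof (induction B)
    case (add z B)
    have "[:-z, 1:] = smult (-z) [:1, -inverse z:]" using add.prems[of z] by simp
    with add show ?case by (simp add: mult.commute del: smult_pCons mult_pCons_left mult_pCons_right)
  qed simp
  define c where "c = lead_coeff p * (\<Prod>z\<in>#B. -z)"
  have p: "p = smult c (\<Prod>z\<in>#B. [:1, -inverse z:])"
    unfolding c_def smult_smult[symmetric] *[symmetric] by (rule B(2))
  have "poly (\<Prod>z\<in>#B. [:1, -inverse z:]) 0 = 1" by (induction B) auto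
  then have "c = 1" using assms arg_cong[OF p, of "\<lambda>p. poly p 0"] by (simp add: poly_0_coeff_0)
  with p have "p = (\<Prod>\<alpha>\<in>#image_mset inverse B. [:1, -\<alpha>:])" by (simp add: image_mset.compositionality o_def)
  with B(1) that[of "image_mset inverse B"] show ?thesis by simp
qed

text \<open>Logarithmic differentiation of the product: with \<open>G \<beta>\<close> the geometric
  series \<beta> X / (1 - \<beta> X), the formal derivative satisfies X p' = - p times the sum of
  the \<open>G \<alpha>\<close>. Comparing coefficients gives the claim.\<close>

lemma newton_identities:
  fixes A :: "'b::field multiset"
  defines "p \<equiv> (\<Prod>\<alpha>\<in>#A. [:1, -\<alpha>:])"
  shows "of_nat m * coeff p m = - (\<Sum>r=1..m. (\<Sum>\<alpha>\<in>#A. \<alpha> ^ r) * coeff p (m - r))"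
proof -
  define G :: "'b \<Rightarrow> 'b fps" where "G \<beta> = Abs_fps (\<lambda>r. if r = 0 then 0 else \<beta> ^ r)" for \<beta>
  have G: "(1 - fps_const \<beta> * fps_X) * G \<beta> = fps_const \<beta> * fps_X" for \<beta>
  proof (rule fps_ext)
    fix k
    show "((1 - fps_const \<beta> * fps_X) * G \<beta>) $ k = (fps_const \<beta> * fps_X) $ k"
      unfolding left_diff_distrib G_def by (cases k) (auto simp: mult.assoc)
  qed
  have lin: "fps_of_poly [:1, -\<beta>:] = 1 - fps_const \<beta> * fps_X" for \<beta> :: 'b
    by (simp add: fps_of_poly_pCons)
  have main: "fps_X * fps_deriv (fps_of_poly (\<Prod>\<alpha>\<in>#A. [:1, -\<alpha>:])) =
      - (fps_of_poly (\<Prod>\<alpha>\<in>#A. [:1, -\<alpha>:]) * (\<Sum>\<alpha>\<in>#A. G \<alpha>))" for A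
  proof (induction A)
    case (add \<beta> A)
    let ?P = "fps_of_poly (\<Prod>\<alpha>\<in>#A. [:1, -\<alpha>:])" and ?T = "\<Sum>\<alpha>\<in>#A. G \<alpha>" and ?l = "1 - fps_const \<beta> * fps_X"
    have "fps_X * fps_deriv (fps_of_poly (\<Prod>\<alpha>\<in>#add_mset \<beta> A. [:1, -\<alpha>:])) = fps_X * fps_deriv (?l * ?P)"
      by (simp add: fps_of_poly_mult lin del: mult_pCons_left)
    also have "\<dots> = fps_X * (?l * fps_deriv ?P + (- fps_const \<beta>) * ?P)"
      by simp
    also have "\<dots> = ?l * (fps_X * fps_deriv ?P) - (fps_const \<beta> * fps_X) * ?P"
      by (simp add: algebra_simps)
    also have "\<dots> = - (?l * ?P * ?T) - ?l * G \<beta> * ?P"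
      unfolding add G by (simp add: algebra_simps)
    also have "\<dots> = - ((?l * ?P) * (G \<beta> + ?T))" by (simp add: algebra_simps)
    also have "\<dots> = - (fps_of_poly (\<Prod>\<alpha>\<in>#add_mset \<beta> A. [:1, -\<alpha>:]) * (\<Sum>\<alpha>\<in>#add_mset \<beta> A. G \<alpha>))"
      by (simp add: fps_of_poly_mult lin del: mult_pCons_left)
    finally show ?case .
  qed simp
  have nthG: "(\<Sum>\<alpha>\<in>#A. G \<alpha>) $ r = (if r = 0 then 0 else (\<Sum>\<alpha>\<in>#A. \<alpha> ^ r))" for r
    by (induction A) (auto simp: G_def)
  have "of_nat m * coeff p m = (fps_X * fps_deriv (fps_of_poly p)) $ m"
    by (cases m) auto
  also have "\<dots> = - (((\<Sum>\<alpha>\<in>#A. G \<alpha>) * fps_of_poly p) $ m)"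
    unfolding p_def main by (simp add: mult.commute)
  also have "((\<Sum>\<alpha>\<in>#A. G \<alpha>) * fps_of_poly p) $ m = (\<Sum>r=0..m. (if r = 0 then 0 else (\<Sum>\<alpha>\<in>#A. \<alpha> ^ r)) * coeff p (m - r))"
    by (simp add: fps_mult_nth nthG)
  also have "\<dots> = (\<Sum>r=1..m. (\<Sum>\<alpha>\<in>#A. \<alpha> ^ r) * coeff p (m - r))"
    by (rule sum.mono_neutral_cong_right) auto
  finally show ?thesis .
qed

text \<open>\<open>csum_newton\<close> and \<open>newton_identities\<close> are the same recursion
  for two sequences of power sums. Since \<open>csum D 0 = 1\<close>, the recursion determines its
  top term, so the sequences agree by induction.\<close>

lemma L_poly_factorization:
  fixes D :: "'a::{field,finite} poly"
  assumes odd: "odd CARD('a)" and D: "D \<in> monic_squarefree n" and n: "n > 0"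
  obtains A where "size A \<le> n - 1" "\<And>u. L_fun D u = (\<Prod>\<alpha>\<in>#A. 1 - \<alpha> * u)"
    "\<And>r. r > 0 \<Longrightarrow> of_int (psum D r) = - (\<Sum>\<alpha>\<in>#A. \<alpha> ^ r)"
proof -
  note c = coeff_L_poly[OF assms]
  obtain A where A: "size A = degree (L_poly D)" "L_poly D = (\<Prod>\<alpha>\<in>#A. [:1, -\<alpha>:])"
    using complex_poly_factorization[of "L_poly D"] c[of 0] by auto
  have L: "L_fun D u = (\<Prod>\<alpha>\<in>#A. 1 - \<alpha> * u)" for u
    unfolding L_fun_def A(2) by (induction A) (auto simp: algebra_simps)
  have "r > 0 \<longrightarrow> of_int (psum D r) = - (\<Sum>\<alpha>\<in>#A. \<alpha> ^ r)" for r
  proof (induction r rule: less_induct)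
    case (less m)
    show ?case
    proof
      assume m: "m > 0"
      have split: "(\<Sum>r=1..m. F r) = (\<Sum>r=1..<m. F r) + F m" for F :: "nat \<Rightarrow> complex"
      proof -
        have "{1..m} = insert m {1..<m}" using m by auto
        then show ?thesis by (simp add: add.commute)
      qed
      have 1: "of_nat m * of_int (csum D m) = (\<Sum>r=1..m. of_int (psum D r) * of_int (csum D (m - r)) :: complex)"
        using arg_cong[OF csum_newton[of m D], of "of_int :: int \<Rightarrow> complex"] by simp
      have 2: "of_nat m * of_int (csum D m) = (\<Sum>r=1..m. - (\<Sum>\<alpha>\<in>#A. \<alpha> ^ r) * of_int (csum D (m - r)) :: complex)"
        using newton_identities[of m A] unfolding A(2)[symmetric] c by (simp add: sum_negf)
      have 3: "(\<Sum>r=1..<m. of_int (psum D r) * of_int (csum D (m - r))) =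
          (\<Sum>r=1..<m. - (\<Sum>\<alpha>\<in>#A. \<alpha> ^ r) * of_int (csum D (m - r)) :: complex)"
        by (rule sum.cong[OF refl]) (use less.IH in auto)
      show "of_int (psum D m) = - (\<Sum>\<alpha>\<in>#A. \<alpha> ^ m)"
        using 1 2 3 unfolding split by simp
    qed
  qed
  with that[of A] A(1) L degree_L_poly[OF assms] show ?thesis by auto
qed

section \<open>The Riemann hypothesis by Stepanov's method\<close>

lemma ffield_eq_UN_roots:
  "ffield r = (\<Union>P\<in>{P. P \<in> monic_irred \<and> degree P dvd r}. {x :: 'a::{field,finite} alg_closure. ev P x = 0})"
proof (intro equalityI subsetI)
  fix x :: "'a alg_closure" assume x: "x \<in> ffield r"
  obtain P where P: "P \<in> monic_irred" "ev P x = 0" by (rule minimal_polynomial_exists)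
  with x root_in_ffield_iff[OF monic_irred_irreducible[OF P(1)] P(2) refl, of r]
  show "x \<in> (\<Union>P\<in>{P. P \<in> monic_irred \<and> degree P dvd r}. {x. ev P x = 0})" by blast
next
  fix x :: "'a alg_closure" assume "x \<in> (\<Union>P\<in>{P. P \<in> monic_irred \<and> degree P dvd r}. {x. ev P x = 0})"
  then obtain P where P: "P \<in> monic_irred" "degree P dvd r" "ev P x = 0" by blast
  with root_in_ffield_iff[OF monic_irred_irreducible[OF P(1)] P(3) refl, of r] show "x \<in> ffield r" by blast
qed

lemma finite_irred_dvd: "r > 0 \<Longrightarrow> finite {P :: 'a::{field,finite} poly. P \<in> monic_irred \<and> degree P dvd r}"
  by (rule finite_subset[OF _ finite_irred_le[of r]]) (auto simp: irred_le_def dvd_imp_le)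

lemma sum_ffield:
  fixes F :: "'a::{field,finite} alg_closure \<Rightarrow> 'b::comm_monoid_add"
  assumes r: "r > 0"
  shows "(\<Sum>x\<in>ffield r. F x) = (\<Sum>P | P \<in> monic_irred \<and> degree P dvd r. \<Sum>x | ev P x = 0. F x)"
  unfolding ffield_eq_UN_roots
  by (rule sum.UNION_disjoint)
     (use finite_irred_dvd[OF r] finite_ev_roots monic_irred_nonzero in \<open>auto dest: monic_irred_common_root\<close>)

definition irred_deg :: "nat \<Rightarrow> 'a::field poly set" where
  "irred_deg d = {P \<in> monic_irred. degree P = d}"

lemma finite_irred_deg [simp]: "finite (irred_deg d :: 'a::{field,finite} poly set)"
  by (rule finite_subset[OF _ finite_irred_le[of d]]) (auto simp: irred_deg_def irred_le_def)

text \<open>Each prime of degree \<open>d\<close> has \<open>d\<close> distinct roots in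
  \<open>ffield d\<close>, and different primes have no root in common. This upper half of the prime
  polynomial theorem is the form used for error terms and variances.\<close>

lemma card_irred_deg: "d * card (irred_deg d :: 'a::{field,finite} poly set) \<le> CARD('a) ^ d"
proof (cases "d = 0")
  case False
  then have d: "d > 0" by simp
  have eq: "(\<Sum>x | ev P x = 0. 1) = d" if "P \<in> irred_deg d" for P :: "'a poly"
  proof -
    have P: "P \<in> monic_irred" "degree P = d" using that by (auto simp: irred_deg_def)
    have irr: "irreducible P" by (rule monic_irred_irreducible[OF P(1)])
    obtain x where x: "ev P x = 0" using irr by (rule irreducible_obtain_root)
    show ?thesis using card_roots_irreducible[OF irr x P(2)] by simp
  qed
  have "d * card (irred_deg d :: 'a poly set) = (\<Sum>P\<in>(irred_deg d :: 'a poly set). \<Sum>x | ev P x = 0. 1)"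
    using eq by simp
  also have "\<dots> \<le> (\<Sum>P | P \<in> (monic_irred :: 'a poly set) \<and> degree P dvd d. \<Sum>x | ev P x = 0. 1)"
    by (rule sum_mono2[OF finite_irred_dvd[OF d]]) (auto simp: irred_deg_def)
  also have "\<dots> = (\<Sum>x\<in>(ffield d :: 'a alg_closure set). 1)"
    by (rule sum_ffield[OF d, symmetric])
  also have "\<dots> = CARD('a) ^ d" by (simp add: card_ffield(1)[OF d])
  finally show ?thesis .
qed simp

text \<open>On \<open>ffield r\<close> with \<open>r > 0\<close> and odd q, this is the quadratic
  character of the field with q^r elements, taken with integer values.\<close>

definition ac_sign :: "nat \<Rightarrow> 'a::{field,finite} alg_closure \<Rightarrow> int" where
  "ac_sign r y = (if y = 0 then 0 else if y ^ ((CARD('a) ^ r - 1) div 2) = 1 then 1 else -1)"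

lemma ac_sign_eq:
  fixes y :: "'a::{field,finite} alg_closure"
  assumes odd: "odd CARD('a)" and r: "r > 0" and y: "y \<in> ffield r"
  shows "of_int (ac_sign r y) = y ^ ((CARD('a) ^ r - 1) div 2)"
proof (cases "y = 0")
  case True
  then show ?thesis using half_exponent(2)[OF odd card_gt_1 r] by (simp add: ac_sign_def)
next
  case False
  have "y ^ (2 * ((CARD('a) ^ r - 1) div 2)) = 1"
    unfolding half_exponent(1)[OF odd card_gt_1 r] by (rule ffield_nonzero_power[OF y False])
  from power_half_exponent_cases[OF this] False show ?thesis by (auto simp: ac_sign_def)
qed

lemma ev_in_ffield_of_root:
  fixes f :: "'a::{field,finite} poly"
  assumes "x \<in> ffield r"
  shows "ev f x \<in> ffield r"
  using ev_frobenius[of f x r] assms by (simp add: ffield_def)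

lemma odd_geometric_sum: "odd (b :: nat) \<Longrightarrow> even (\<Sum>i<k. b ^ i) \<longleftrightarrow> even k"
  by (induction k) auto

text \<open>With Q = q^d and r = d k, the exponent (Q^k - 1) / 2 is (Q - 1) / 2 times 1 + Q + ... +
  Q^(k-1). The second factor is a sum of k odd numbers and has the parity of k, so the character
  over the large field is the k-th power of the symbol at \<open>P\<close>.\<close>

lemma ac_sign_root:
  fixes P D :: "'a::{field,finite} poly"
  assumes odd: "odd CARD('a)" and r: "r > 0" and P: "P \<in> monic_irred" and dvd: "degree P dvd r"
    and x: "ev P x = 0"
  shows "ac_sign r (ev D x) = poly_legendre D P ^ (r div degree P)"
proof (rule of_int_sign_inj[OF odd])
  have irr: "irreducible P" by (rule monic_irred_irreducible[OF P])
  let ?d = "degree P" and ?y = "ev D x"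
  obtain k where k: "r = ?d * k" using dvd by (rule dvdE)
  with r have d: "?d > 0" and k0: "k > 0" by auto
  have xr: "x \<in> ffield r" using root_in_ffield_iff[OF irr x refl] dvd by blast
  let ?z = "?y ^ ((CARD('a) ^ ?d - 1) div 2)"
  have "?y ^ ((CARD('a) ^ r - 1) div 2) = ?z ^ k"
  proof (cases "?y = 0")
    case True
    have 1: "0 ^ ((CARD('a) ^ r - 1) div 2) = (0 :: 'a alg_closure)"
      using half_exponent(2)[OF odd card_gt_1 r] by (rule zero_power)
    have 2: "0 ^ ((CARD('a) ^ ?d - 1) div 2) = (0 :: 'a alg_closure)"
      using half_exponent(2)[OF odd card_gt_1 d] by (rule zero_power)
    have 3: "0 ^ k = (0 :: 'a alg_closure)" using k0 by (rule zero_power)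
    show ?thesis unfolding True 1 2 3 ..
  next
    case False
    have "?y ^ (2 * ((CARD('a) ^ ?d - 1) div 2)) = 1"
      unfolding half_exponent(1)[OF odd card_gt_1 d]
      by (rule ffield_nonzero_power[OF ev_in_ffield[OF irr x refl] False])
    then have z: "?z = 1 \<or> ?z = -1" by (rule power_half_exponent_cases)
    have "1 < CARD('a) ^ ?d" using one_less_power[OF card_gt_1 d] .
    then have G: "(\<Sum>i<k. (CARD('a) ^ ?d) ^ i) * ((CARD('a) ^ ?d - 1) div 2) = (CARD('a) ^ r - 1) div 2"
      unfolding k power_mult using odd by (intro sum_geometric_half) simp_all
    have "?y ^ ((CARD('a) ^ r - 1) div 2) = ?z ^ (\<Sum>i<k. (CARD('a) ^ ?d) ^ i)"
      unfolding G[symmetric] power_mult[symmetric] mult.commute[of "\<Sum>i<k. (CARD('a) ^ ?d) ^ i"] ..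
    also have "even (\<Sum>i<k. (CARD('a) ^ ?d) ^ i) \<longleftrightarrow> even k" using odd by (intro odd_geometric_sum) simp
    then have "?z ^ (\<Sum>i<k. (CARD('a) ^ ?d) ^ i) = ?z ^ k"
      using z by (elim disjE) (simp_all only: power_one minus_one_power_iff)
    finally show ?thesis .
  qed
  moreover have "r div ?d = k" using k d by simp
  ultimately show "of_int (ac_sign r ?y) = (of_int (poly_legendre D P ^ (r div ?d)) :: 'a alg_closure)"
    unfolding of_int_power poly_legendre_euler[OF odd irr x]
      ac_sign_eq[OF odd r ev_in_ffield_of_root[OF xr]] by simp
qed (auto simp: ac_sign_def intro!: sign_power[simplified] poly_legendre_values[simplified])

text \<open>Sorting \<open>ffield r\<close> by minimal polynomials, each \<open>P\<close> accounts
  for \<open>degree P\<close> equal terms. So \<open>psum D r\<close> is the number of affine points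
  of y^2 = D(x) over the field with q^r elements, minus q^r, and bounding it is a point
  count.\<close>

lemma psum_eq_character_sum:
  fixes D :: "'a::{field,finite} poly"
  assumes odd: "odd CARD('a)" and r: "r > 0"
  shows "psum D r = (\<Sum>x\<in>ffield r. ac_sign r (ev D x))"
  unfolding psum_def sum_ffield[OF r]
proof (rule sum.cong[OF refl])
  fix P :: "'a poly" assume "P \<in> {P. P \<in> monic_irred \<and> degree P dvd r}"
  then have P: "P \<in> monic_irred" "degree P dvd r" by auto
  have irr: "irreducible P" by (rule monic_irred_irreducible[OF P(1)])
  obtain x where x: "ev P x = 0" using irr by (rule irreducible_obtain_root)
  have "(\<Sum>x | ev P x = 0. ac_sign r (ev D x)) = (\<Sum>x | ev P x = 0. poly_legendre D P ^ (r div degree P))"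
    by (rule sum.cong[OF refl]) (use ac_sign_root[OF odd r P] in auto)
  then show "int (degree P) * poly_legendre D P ^ (r div degree P) = (\<Sum>x | ev P x = 0. ac_sign r (ev D x))"
    using card_roots_irreducible[OF irr x refl] by simp
qed

section \<open>The auxiliary polynomial of Stepanov's method\<close>

lemma monom_dvd_polys_lt: "f \<in> polys_lt m \<Longrightarrow> monom 1 m dvd f \<Longrightarrow> f = (0 :: 'a::field poly)"
  using polys_lt_dvd_eq_0[of f "monom 1 m"] by (simp add: degree_monom_eq)

lemma polys_lt_mono: "f \<in> polys_lt a \<Longrightarrow> a \<le> b \<Longrightarrow> f \<in> polys_lt b"
  by (auto simp: polys_lt_def)

lemma polys_lt_smult: "f \<in> polys_lt a \<Longrightarrow> smult c f \<in> polys_lt a"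
  by (auto simp: polys_lt_def)

lemma polys_lt_sum: "(\<And>i. i \<in> A \<Longrightarrow> f i \<in> polys_lt a) \<Longrightarrow> (\<Sum>i\<in>A. f i) \<in> polys_lt a"
  by (auto simp: polys_lt_def coeff_sum)

text \<open>A prime dividing \<open>D\<close> exactly once would occur to an odd power on the left
  and to an even power on the right. The proof is by descent on the degree of \<open>a\<close>: such
  a prime divides both \<open>a\<close> and \<open>b\<close> and can be cancelled. It expresses that
  \<open>D\<close> is no constant times the square of a rational function.\<close>

lemma squarefree_not_square_ratio:
  fixes D a b :: "'a::field poly"
  assumes D: "squarefree D" "degree D > 0" and eq: "b ^ 2 * D = smult c (a ^ 2)" and c: "c \<noteq> 0"
  shows "a = 0"
proof -
  obtain P where P: "P \<in> monic_irred" "P dvd D" using monic_irred_divisor_exists[OF D(2)] by blast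
  have irr: "irreducible P" by (rule monic_irred_irreducible[OF P(1)])
  obtain E where E: "D = P * E" using P(2) by (rule dvdE)
  have P0: "P \<noteq> 0" by (rule monic_irred_nonzero[OF P(1)])
  have PE: "\<not> P dvd E"
  proof
    assume "P dvd E"
    then have "P ^ 2 dvd D" unfolding E power2_eq_square by (intro mult_dvd_mono) auto
    with D(1) have "P dvd 1" by (rule squarefreeD)
    with irr show False using irreducible_not_unit by blast
  qed
  show "a = 0"
    using eq
  proof (induction "degree a" arbitrary: a b rule: less_induct)
    case (less a b)
    show ?case
    proof (rule ccontr)
      assume a0: "a \<noteq> 0"
      have "P dvd smult c (a ^ 2)" unfolding less.prems[symmetric] by (rule dvd_mult[OF P(2)])
      then have "P dvd a ^ 2" using c by (simp add: dvd_smult_iff)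
      then have "P dvd a" unfolding irreducible_dvd_power_iff[OF irr] by simp
      then obtain a' where a': "a = P * a'" by (rule dvdE)
      have "P * (b ^ 2 * E) = P * (smult c (P * a' ^ 2))"
        using less.prems unfolding E a' by (simp add: algebra_simps power2_eq_square)
      then have 1: "b ^ 2 * E = smult c (P * a' ^ 2)" unfolding mult_left_cancel[OF P0] .
      have "P dvd smult c (P * a' ^ 2)" by (rule dvd_smult) simp
      then have "P dvd b ^ 2 * E" unfolding 1 .
      then have "P dvd b" unfolding irreducible_dvd_mult_iff[OF irr] irreducible_dvd_power_iff[OF irr]
        using PE by simp
      then obtain b' where b': "b = P * b'" by (rule dvdE)
      have "P * (b' ^ 2 * D) = P * smult c (a' ^ 2)"
        using 1 unfolding E b' by (simp add: algebra_simps power2_eq_square)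
      then have 2: "b' ^ 2 * D = smult c (a' ^ 2)" unfolding mult_left_cancel[OF P0] .
      have a'0: "a' \<noteq> 0" using a0 a' by auto
      have "degree a = degree P + degree a'" unfolding a' by (rule degree_mult_eq[OF P0 a'0])
      then have "degree a' < degree a" using monic_irred_degree_pos[OF P(1)] by simp
      from less.hyps[OF this 2] a'0 show False by simp
    qed
  qed
qed

lemma frobenius_poly_constant_term:
  fixes D :: "'a::{field,finite} poly"
  shows "monom 1 (CARD('a) ^ r) dvd D ^ (CARD('a) ^ r) - [:coeff D 0:]"
proof -
  obtain c E where D: "D = pCons c E" by (cases D)
  let ?Q = "CARD('a) ^ r"
  have "D = [:c:] + monom 1 1 * E" unfolding D by (simp add: monom_Suc)
  then have "D ^ ?Q = [:c:] ^ ?Q + monom 1 ?Q * E ^ ?Q"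
    by (simp add: frobenius_poly_add power_mult_distrib monom_power)
  also have "[:c:] ^ ?Q = [:c:]"
    by (simp add: poly_const_pow power_card_power_eq_same)
  finally show ?thesis unfolding D by simp
qed

lemma irreducible_X: "irreducible (monom 1 1 :: 'a::field poly)"
  using irreducible_linear_field_poly[of 1 0] by (simp add: monom_Suc one_pCons)

lemma X_dvd_iff: "monom 1 1 dvd (f :: 'a::field poly) \<longleftrightarrow> coeff f 0 = 0"
  using monom_1_dvd_iff'[of 1 f] by simp

text \<open>If D(0) is nonzero, multiply by the conjugate (b - a D^e) D. Modulo X^Q the power D^Q is
  the constant D(0), so X^Q divides b^2 D - D(0) a^2, whose degree is below Q; hence it vanishes,
  against square-freeness unless a = b = 0. If D(0) = 0, then X divides \<open>D\<close> exactly
  once and D^e exactly e times; as \<open>a\<close> and \<open>b\<close> have small degree,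
  comparing the powers of X forces both to vanish.\<close>

lemma stepanov_coprime:
  fixes D a b :: "'a::{field,finite} poly"
  assumes odd: "odd CARD('a)" and D: "squarefree D" "degree D = n" "n > 0" and r: "r > 0"
    and a: "a \<in> polys_lt B" and b: "b \<in> polys_lt B" and B: "2 * B + n \<le> CARD('a) ^ r"
    and dvd: "monom 1 (CARD('a) ^ r) dvd b + a * D ^ ((CARD('a) ^ r - 1) div 2)"
  shows "a = 0 \<and> b = 0"
proof -
  let ?Q = "CARD('a) ^ r" and ?e = "(CARD('a) ^ r - 1) div 2"
  have e: "2 * ?e = ?Q - 1" by (rule half_exponent(1)[OF odd card_gt_1 r])
  have Q1: "?Q > 0" using card_gt_1[where 'a='a] by simp
  have D0: "D \<noteq> 0" using D by auto
  show ?thesis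
  proof (cases "coeff D 0 = 0")
    case False
    let ?d = "coeff D 0"
    have "monom 1 ?Q dvd (b + a * D ^ ?e) * ((b - a * D ^ ?e) * D)"
      using dvd by (rule dvd_mult2)
    also have "(b + a * D ^ ?e) * ((b - a * D ^ ?e) * D) = b ^ 2 * D - a ^ 2 * (D ^ (2 * ?e) * D)"
      by (simp add: algebra_simps power2_eq_square power_mult)
    also have "D ^ (2 * ?e) * D = D ^ ?Q" unfolding e by (rule power_minus_mult[OF Q1])
    finally have 1: "monom 1 ?Q dvd b ^ 2 * D - a ^ 2 * D ^ ?Q" .
    have "monom 1 ?Q dvd a ^ 2 * (D ^ ?Q - [:?d:])"
      by (rule dvd_mult[OF frobenius_poly_constant_term])
    from dvd_add[OF 1 this] have 2: "monom 1 ?Q dvd b ^ 2 * D - smult ?d (a ^ 2)"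
      by (simp add: algebra_simps)
    have lt: "f ^ 2 * g \<in> polys_lt ?Q" if f: "f \<in> polys_lt B" and g: "degree g \<le> n" for f g :: "'a poly"
    proof (cases "f = 0")
      case True
      then show ?thesis by (simp add: polys_lt_def)
    next
      case False
      then have "degree f < B" using f by (simp add: polys_lt_iff)
      moreover have "degree (f ^ 2 * g) \<le> degree f * 2 + degree g"
        using degree_mult_le[of "f ^ 2" g] degree_power_le[of f 2] by linarith
      ultimately show ?thesis using B g by (simp add: polys_lt_iff)
    qed
    have "smult ?d (a ^ 2) \<in> polys_lt ?Q" using polys_lt_smult[OF lt[OF a, of 1]] by simp
    from polys_lt_diff[OF lt[OF b, of D] this] have "b ^ 2 * D - smult ?d (a ^ 2) \<in> polys_lt ?Q"
      using D(2) by simp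
    from monom_dvd_polys_lt[OF this 2] have eq: "b ^ 2 * D = smult ?d (a ^ 2)" by simp
    have "a = 0" by (rule squarefree_not_square_ratio[OF D(1) _ eq False]) (use D in simp)
    with eq D0 show ?thesis by simp
  next
    case True
    let ?X = "monom 1 1 :: 'a poly"
    have "?X dvd D" using True unfolding X_dvd_iff .
    then obtain E where E: "D = ?X * E" by (rule dvdE)
    have XE: "\<not> ?X dvd E"
    proof
      assume "?X dvd E"
      then have "?X ^ 2 dvd D" unfolding E power2_eq_square by (intro mult_dvd_mono) auto
      with D(1) have "?X dvd 1" by (rule squarefreeD)
      then show False unfolding X_dvd_iff by simp
    qed
    have XEe: "\<not> ?X dvd E ^ ?e" using XE unfolding irreducible_dvd_power_iff[OF irreducible_X] by blast
    have Xpow: "?X ^ k = monom 1 k" for k by (simp add: monom_power)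
    have De: "D ^ ?e = monom 1 ?e * E ^ ?e" unfolding E power_mult_distrib Xpow ..
    have Be: "B \<le> ?e" using B D(3) e by linarith
    have "monom 1 ?e dvd (monom 1 ?Q :: 'a poly)"
      using le_imp_power_dvd[of ?e ?Q ?X] e unfolding Xpow by linarith
    from dvd_trans[OF this dvd] have "monom 1 ?e dvd b + monom 1 ?e * (a * E ^ ?e)"
      unfolding De by (simp add: algebra_simps)
    then have "monom 1 ?e dvd b" by (simp add: dvd_add_left_iff)
    then have b0: "b = 0" by (rule monom_dvd_polys_lt[OF polys_lt_mono[OF b Be]])
    have "?e + (?Q - ?e) = ?Q" using e Q1 by linarith
    then have "monom 1 ?Q = monom 1 ?e * (monom 1 (?Q - ?e) :: 'a poly)" by (simp add: mult_monom)
    then have "monom 1 ?e * monom 1 (?Q - ?e) dvd monom 1 ?e * (a * E ^ ?e)"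
      using dvd unfolding b0 De by (simp add: algebra_simps)
    then have "monom 1 (?Q - ?e) dvd a * E ^ ?e" by (simp add: dvd_mult_cancel_left)
    then have "?X ^ (?Q - ?e) dvd E ^ ?e * a" unfolding Xpow by (simp add: mult.commute)
    then have "monom 1 (?Q - ?e) dvd a"
      unfolding irreducible_power_dvd_mult[OF irreducible_X XEe] unfolding Xpow .
    moreover have "B \<le> ?Q - ?e" using Be e by linarith
    ultimately have "a = 0" using monom_dvd_polys_lt[OF polys_lt_mono[OF a]] by blast
    with b0 show ?thesis by simp
  qed
qed

text \<open>In the block of lowest index j that is not trivial, X^Q must divide b_j + a_j D^e, since
  every later block carries a further factor X^Q. By \<open>stepanov_coprime\<close> that block is
  then trivial. So a nontrivial choice of coefficients gives a nonzero auxiliary polynomial.\<close>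

lemma stepanov_nonzero:
  fixes D :: "'a::{field,finite} poly" and a b :: "nat \<Rightarrow> 'a poly"
  assumes odd: "odd CARD('a)" and D: "squarefree D" "degree D = n" "n > 0" and r: "r > 0"
    and ab: "\<And>j. j < J \<Longrightarrow> a j \<in> polys_lt B \<and> b j \<in> polys_lt B" and B: "2 * B + n \<le> CARD('a) ^ r"
    and zero: "(\<Sum>j<J. monom 1 (j * CARD('a) ^ r) * (b j + a j * D ^ ((CARD('a) ^ r - 1) div 2))) = 0"
  shows "\<forall>j<J. a j = 0 \<and> b j = 0"
proof (rule ccontr)
  let ?Q = "CARD('a) ^ r" and ?e = "(CARD('a) ^ r - 1) div 2"
  let ?t = "\<lambda>j. b j + a j * D ^ ?e"
  assume "\<not> ?thesis"
  then have ex: "\<exists>j. j < J \<and> \<not> (a j = 0 \<and> b j = 0)" by blast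
  define j where "j = (LEAST j. j < J \<and> \<not> (a j = 0 \<and> b j = 0))"
  have j: "j < J" "\<not> (a j = 0 \<and> b j = 0)" using LeastI_ex[OF ex] unfolding j_def by auto
  have less: "a i = 0 \<and> b i = 0" if "i < j" for i
    using not_less_Least[of i "\<lambda>j. j < J \<and> \<not> (a j = 0 \<and> b j = 0)"] that j(1) unfolding j_def[symmetric] by auto
  have "(\<Sum>i<J. monom 1 (i * ?Q) * ?t i) = (\<Sum>i\<in>{j..<J}. monom 1 (i * ?Q) * ?t i)"
    by (rule sum.mono_neutral_right) (use less in auto)
  also have "\<dots> = monom 1 (j * ?Q) * ?t j + (\<Sum>i\<in>{Suc j..<J}. monom 1 (i * ?Q) * ?t i)"
    using j(1) by (rule sum.atLeast_Suc_lessThan)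
  also have "(\<Sum>i\<in>{Suc j..<J}. monom 1 (i * ?Q) * ?t i) =
      monom 1 (j * ?Q) * (monom 1 ?Q * (\<Sum>i\<in>{Suc j..<J}. monom 1 ((i - Suc j) * ?Q) * ?t i))"
  proof -
    have "monom 1 (i * ?Q) = monom 1 (j * ?Q) * (monom 1 ?Q * (monom 1 ((i - Suc j) * ?Q)) :: 'a poly)"
      if "i \<in> {Suc j..<J}" for i
    proof -
      have "i = j + (1 + (i - Suc j))" using that by simp
      then have "i * ?Q = j * ?Q + (?Q + (i - Suc j) * ?Q)" by (metis add_mult_distrib mult_1)
      then show ?thesis by (simp add: mult_monom)
    qed
    then show ?thesis by (simp add: sum_distrib_left mult.assoc)
  qed
  finally have "monom 1 (j * ?Q) * (?t j + monom 1 ?Q * (\<Sum>i\<in>{Suc j..<J}. monom 1 ((i - Suc j) * ?Q) * ?t i)) = 0"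
    unfolding zero by (simp add: distrib_left)
  then have "?t j + monom 1 ?Q * (\<Sum>i\<in>{Suc j..<J}. monom 1 ((i - Suc j) * ?Q) * ?t i) = 0"
    by (simp add: monom_eq_0_iff)
  then have "?t j = monom 1 ?Q * - (\<Sum>i\<in>{Suc j..<J}. monom 1 ((i - Suc j) * ?Q) * ?t i)"
    by (simp add: eq_neg_iff_add_eq_0)
  then have "monom 1 ?Q dvd ?t j" by (rule dvdI)
  from stepanov_coprime[OF odd D r conjunct1[OF ab[OF j(1)]] conjunct2[OF ab[OF j(1)]] B this] j(2)
  show False by (rule notE[rotated])
qed

lemma frobenius_poly_diff:
  fixes f g :: "'a::{field,finite} poly"
  shows "(f - g) ^ (CARD('a) ^ r) = f ^ (CARD('a) ^ r) - g ^ (CARD('a) ^ r)"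
  using frobenius_poly_add[of "f - g" g r] by simp

lemma degree_power_polys_lt: "f \<in> polys_lt B \<Longrightarrow> degree (f ^ k) \<le> k * B"
proof -
  assume "f \<in> polys_lt B"
  then have "degree f \<le> B" by (auto simp: polys_lt_iff)
  then have "degree f * k \<le> B * k" by (rule mult_le_mono1)
  from order_trans[OF degree_power_le this] show "degree (f ^ k) \<le> k * B" unfolding mult.commute[of k B] .
qed

text \<open>Pigeonhole in place of linear algebra. With \<open>Q = CARD('a) ^ r\<close>, \<open>e = (Q - 1) / 2\<close> and
  \<open>h = (\<Sum>j<J. monom 1 (j * Q) * (b j + a j * D ^ e))\<close>, the sum in the conclusion agrees with \<open>h ^ Q * D ^ e\<close>
  at the points of \<open>ffield (2 * r)\<close> where \<open>D ^ (e * (Q + 1))\<close> takes the value \<open>\<epsilon>\<close>. So \<open>h\<close> vanishes there, and since the field is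
  a quadratic extension no multiplicities are needed to beat the trivial bound.\<close>

lemma stepanov_exists:
  fixes D :: "'a::{field,finite} poly" and \<epsilon> :: 'a
  assumes W: "J + CARD('a) ^ r * B + degree D * e < 2 * B * J"
  obtains a b where "\<And>j. j < J \<Longrightarrow> a j \<in> polys_lt B \<and> b j \<in> polys_lt B"
    "\<not> (\<forall>j<J. a j = 0 \<and> b j = 0)"
    "(\<Sum>j<J. monom 1 j * (smult \<epsilon> (a j ^ (CARD('a) ^ r)) + b j ^ (CARD('a) ^ r) * D ^ e)) = 0"
proof -
  let ?Q = "CARD('a) ^ r" and ?W = "J + CARD('a) ^ r * B + degree D * e"
  define V where "V = PiE {..<J} (\<lambda>_. (polys_lt B :: 'a poly set) \<times> (polys_lt B :: 'a poly set))"
  define \<Phi> where "\<Phi> v = (\<Sum>j<J. monom 1 j * (smult \<epsilon> (fst (v j) ^ ?Q) + snd (v j) ^ ?Q * D ^ e))"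
    for v :: "nat \<Rightarrow> 'a poly \<times> 'a poly"
  have cardV: "card V = CARD('a) ^ (2 * B * J)"
  proof -
    have "card V = (CARD('a) ^ B * CARD('a) ^ B) ^ J"
      unfolding V_def by (subst card_PiE) (simp_all add: card_cartesian_product card_polys_lt)
    also have "\<dots> = CARD('a) ^ (2 * B * J)" unfolding power_add[symmetric] power_mult mult_2 ..
    finally show ?thesis .
  qed
  have "\<Phi> ` V \<subseteq> polys_lt ?W"
  proof
    fix f assume "f \<in> \<Phi> ` V"
    then obtain v where v: "v \<in> V" "f = \<Phi> v" by blast
    have "monom 1 j * (smult \<epsilon> (fst (v j) ^ ?Q) + snd (v j) ^ ?Q * D ^ e) \<in> polys_lt ?W" if j: "j < J" for j
    proof -
      have vj: "fst (v j) \<in> polys_lt B" "snd (v j) \<in> polys_lt B"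
        using v(1) j unfolding V_def by (auto simp: PiE_iff mem_Times_iff)
      have "degree (smult \<epsilon> (fst (v j) ^ ?Q)) \<le> ?Q * B + degree D * e"
        using degree_power_polys_lt[OF vj(1), of ?Q] degree_smult_le[of \<epsilon> "fst (v j) ^ ?Q"] by linarith
      moreover have "degree (snd (v j) ^ ?Q * D ^ e) \<le> ?Q * B + degree D * e"
        using degree_power_polys_lt[OF vj(2), of ?Q] degree_mult_le[of "snd (v j) ^ ?Q" "D ^ e"]
          degree_power_le[of D e] by linarith
      ultimately have "degree (smult \<epsilon> (fst (v j) ^ ?Q) + snd (v j) ^ ?Q * D ^ e) \<le> ?Q * B + degree D * e"
        by (rule degree_add_le)
      moreover have "degree (monom 1 j :: 'a poly) = j" by (simp add: degree_monom_eq)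
      ultimately have "degree (monom 1 j * (smult \<epsilon> (fst (v j) ^ ?Q) + snd (v j) ^ ?Q * D ^ e)) < ?W"
        using j degree_mult_le[of "monom 1 j" "smult \<epsilon> (fst (v j) ^ ?Q) + snd (v j) ^ ?Q * D ^ e"] by linarith
      then show ?thesis unfolding polys_lt_iff by blast
    qed
    then show "f \<in> polys_lt ?W" unfolding v(2) \<Phi>_def by (intro polys_lt_sum) simp
  qed
  then have "card (\<Phi> ` V) \<le> CARD('a) ^ ?W"
    unfolding card_polys_lt[symmetric] by (intro card_mono finite_polys_lt)
  also have "\<dots> < card V"
    unfolding cardV by (rule power_strict_increasing[OF W card_gt_1])
  finally have "\<not> inj_on \<Phi> V" by (rule pigeonhole)
  then obtain v w where vw: "v \<in> V" "w \<in> V" "\<Phi> v = \<Phi> w" "v \<noteq> w" unfolding inj_on_def by blast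
  show ?thesis
  proof (rule that[of "\<lambda>j. fst (v j) - fst (w j)" "\<lambda>j. snd (v j) - snd (w j)"])
    fix j assume "j < J"
    with vw show "fst (v j) - fst (w j) \<in> polys_lt B \<and> snd (v j) - snd (w j) \<in> polys_lt B"
      unfolding V_def by (auto simp: PiE_iff mem_Times_iff intro!: polys_lt_diff)
  next
    show "\<not> (\<forall>j<J. fst (v j) - fst (w j) = 0 \<and> snd (v j) - snd (w j) = 0)"
    proof
      assume "\<forall>j<J. fst (v j) - fst (w j) = 0 \<and> snd (v j) - snd (w j) = 0"
      then have "v j = w j" if "j < J" for j using that by (simp add: prod_eq_iff)
      then have "v = w" using vw(1,2) unfolding V_def by (intro PiE_ext) auto
      with vw(4) show False by blast
    qed
  next
    \<comment> \<open>\<open>\<Phi>\<close> is additive because raising to the power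
      \<open>?Q\<close> is, so the difference of two colliding choices lies in its kernel.\<close>
    have "(\<Sum>j<J. monom 1 j * (smult \<epsilon> ((fst (v j) - fst (w j)) ^ ?Q) + (snd (v j) - snd (w j)) ^ ?Q * D ^ e)) = \<Phi> v - \<Phi> w"
      unfolding \<Phi>_def sum_subtractf[symmetric] frobenius_poly_diff
      by (intro sum.cong refl) (simp add: algebra_simps smult_diff_right)
    then show "(\<Sum>j<J. monom 1 j * (smult \<epsilon> ((fst (v j) - fst (w j)) ^ ?Q) + (snd (v j) - snd (w j)) ^ ?Q * D ^ e)) = 0"
      using vw(3) by simp
  qed
qed

lemma frobenius_sum:
  fixes f :: "'b \<Rightarrow> 'a::{field,finite} alg_closure"
  shows "(\<Sum>i\<in>A. f i) ^ (CARD('a) ^ r) = (\<Sum>i\<in>A. f i ^ (CARD('a) ^ r))"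
proof (induction A rule: infinite_finite_induct)
  case (insert x A)
  then show ?case by (simp add: frobenius_add)
qed (use card_gt_1[where 'a='a] in auto)

text \<open>\<open>B\<close> is the largest size allowed by 2 B + n \<le> Q. With J = e + 2 n + 5,
  twice J exceeds Q by 4 n + 9, so the 2 B J free coefficients exceed Q B by B (4 n + 9). As B is at
  least e - n / 2, this is more than the remaining J + n e conditions.\<close>

lemma stepanov_parameters:
  fixes n e B Q :: nat
  assumes "Q = 2 * e + 1" "B = (Q - n) div 2" "4 * n + 4 \<le> Q"
  shows "2 * B + n \<le> Q" "(e + 2 * n + 5) + Q * B + n * e < 2 * B * (e + 2 * n + 5)"
proof -
  show "2 * B + n \<le> Q" using assms by linarith
  have e: "2 * n + 2 \<le> e" using assms by linarith
  have B: "2 * e \<le> 2 * B + n" using assms by linarith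
  have en: "(2 * n + 2) * n \<le> e * n" using e by (rule mult_le_mono1)
  have "2 * e * (4 * n + 9) \<le> (2 * B + n) * (4 * n + 9)" using B by (rule mult_le_mono1)
  then have "2 * e + 2 + 4 * n + 8 + 2 * (n * e) < 2 * (B * (4 * n + 9))"
    using en e by (simp add: algebra_simps)
  then have "(e + 2 * n + 5) + n * e < B * (4 * n + 9)" by simp
  moreover have "2 * B * (e + 2 * n + 5) = Q * B + B * (4 * n + 9)"
    unfolding assms(1) by (simp add: algebra_simps)
  ultimately show "(e + 2 * n + 5) + Q * B + n * e < 2 * B * (e + 2 * n + 5)" by linarith
qed

text \<open>The points in question are zeros of h, whose degree is at most (J - 1) Q + B + n e.
  Since J is Q / 2 up to O(n), this is Q^2 / 2 + O(n Q): half of the field, with an error of the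
  order of the square root of its size.\<close>

lemma stepanov_count:
  fixes D :: "'a::{field,finite} poly" and \<epsilon> :: 'a
  assumes odd: "odd CARD('a)" and D: "squarefree D" "degree D = n" "n > 0" and r: "r > 0"
    and \<epsilon>: "\<epsilon> \<noteq> 0" and Q: "4 * n + 4 \<le> CARD('a) ^ r"
  shows "2 * card {x \<in> ffield (2 * r). ev D x ^ ((CARD('a) ^ (2 * r) - 1) div 2) = to_ac \<epsilon>} \<le>
    CARD('a) ^ (2 * r) + (5 * n + 8) * CARD('a) ^ r"
proof -
  define Q where "Q = CARD('a) ^ r"
  define e where "e = (Q - 1) div 2"
  define B where "B = (Q - n) div 2"
  define J where "J = e + 2 * n + 5"
  have e2: "2 * e = Q - 1" unfolding e_def Q_def by (rule half_exponent(1)[OF odd card_gt_1 r])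
  have Q1: "Q > 0" using Q unfolding Q_def by linarith
  have Qe: "Q = 2 * e + 1" using e2 Q1 by linarith
  have N: "CARD('a) ^ (2 * r) = Q * Q" unfolding Q_def by (simp add: mult_2 power_add)
  have eN: "(CARD('a) ^ (2 * r) - 1) div 2 = e * Q + e"
  proof -
    have "Q * Q - 1 = 2 * (e * Q + e)" unfolding Qe by (simp add: algebra_simps)
    then show ?thesis unfolding N by simp
  qed
  note par = stepanov_parameters[OF Qe B_def Q[folded Q_def]]
  have W: "J + CARD('a) ^ r * B + degree D * e < 2 * B * J"
    using par(2) unfolding J_def D(2) Q_def .
  obtain a b where ab: "\<And>j. j < J \<Longrightarrow> a j \<in> polys_lt B \<and> b j \<in> polys_lt B"
    and nz: "\<not> (\<forall>j<J. a j = 0 \<and> b j = 0)"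
    and rel: "(\<Sum>j<J. monom 1 j * (smult \<epsilon> (a j ^ Q) + b j ^ Q * D ^ e)) = 0"
    using stepanov_exists[OF W, of \<epsilon>] unfolding Q_def by blast
  define h where "h = (\<Sum>j<J. monom 1 (j * Q) * (b j + a j * D ^ e))"
  have h0: "h \<noteq> 0"
  proof
    assume "h = 0"
    from stepanov_nonzero[where a = a and b = b and J = J, OF odd D r ab par(1)[unfolded Q_def]
      this[unfolded h_def e_def Q_def]] nz
    show False by blast
  qed
  have degh: "degree h \<le> (J - 1) * Q + (B + n * e)"
    unfolding h_def
  proof (rule degree_sum_le)
    fix j assume "j \<in> {..<J}"
    then have j: "j < J" "j * Q \<le> (J - 1) * Q" by auto
    have ab': "degree (a j) \<le> B" "degree (b j) \<le> B" using ab[OF j(1)] by (auto simp: polys_lt_iff)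
    have "degree (b j + a j * D ^ e) \<le> B + n * e"
      using ab' degree_mult_le[of "a j" "D ^ e"] degree_power_le[of D e, unfolded D(2)]
      by (intro degree_add_le) linarith+
    moreover have "degree (monom 1 (j * Q) :: 'a poly) = j * Q" by (simp add: degree_monom_eq)
    ultimately show "degree (monom 1 (j * Q) * (b j + a j * D ^ e)) \<le> (J - 1) * Q + (B + n * e)"
      using j(2) degree_mult_le[of "monom 1 (j * Q)" "b j + a j * D ^ e"] by linarith
  qed simp
  have vanish: "ev h x = 0" if x: "x \<in> ffield (2 * r)" and y: "ev D x ^ (e * Q + e) = to_ac \<epsilon>" for x
  proof -
    let ?y = "ev D x ^ e"
    have y0: "?y \<noteq> 0"
    proof
      assume "?y = 0"
      then have "ev D x ^ (e * Q + e) = 0" unfolding power_add by simp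
      with y \<epsilon> show False by simp
    qed
    \<comment> \<open>On the quadratic extension x^(Q Q) = x, so taking the Q-th power of h lowers
      the exponent j Q to j. This is what keeps the degree of the relation to be solved
      small.\<close>
    have xQQ: "(x ^ (j * Q)) ^ Q = x ^ j" for j
    proof -
      have "(x ^ (j * Q)) ^ Q = (x ^ (Q * Q)) ^ j" by (simp add: mult_ac flip: power_mult)
      also have "x ^ (Q * Q) = x" using x unfolding ffield_def N by simp
      finally show ?thesis .
    qed
    have hQ: "ev h x ^ Q = (\<Sum>j<J. x ^ j * (ev (b j) x ^ Q + ev (a j) x ^ Q * ?y ^ Q))"
      unfolding h_def ev_sum frobenius_sum[where 'a='a and r=r, folded Q_def]
      by (intro sum.cong refl)
         (simp add: power_mult_distrib frobenius_add[where 'a='a and r=r, folded Q_def] xQQ)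
    have eps: "to_ac \<epsilon> = ?y ^ Q * ?y" unfolding y[symmetric] power_add power_mult ..
    have "ev h x ^ Q * ?y = (\<Sum>j<J. x ^ j * (to_ac \<epsilon> * ev (a j) x ^ Q + ev (b j) x ^ Q * ?y))"
      unfolding hQ sum_distrib_right eps
      by (intro sum.cong refl) (simp add: algebra_simps)
    also have "\<dots> = ev (\<Sum>j<J. monom 1 j * (smult \<epsilon> (a j ^ Q) + b j ^ Q * D ^ e)) x"
      by simp
    also have "\<dots> = 0" unfolding rel by simp
    finally have "ev h x ^ Q = 0 \<or> ?y = 0" unfolding mult_eq_0_iff .
    with y0 have "ev h x ^ Q = 0" by blast
    then show ?thesis by (rule power_eq_0_iff[THEN iffD1, THEN conjunct1])
  qed
  have "card {x \<in> ffield (2 * r). ev D x ^ ((CARD('a) ^ (2 * r) - 1) div 2) = to_ac \<epsilon>} \<le> card {x. ev h x = 0}"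
    unfolding eN by (rule card_mono[OF finite_ev_roots[OF h0]]) (use vanish in blast)
  also have "\<dots> \<le> degree h" by (rule card_ev_roots[OF h0])
  also note degh
  finally have "2 * card {x \<in> ffield (2 * r). ev D x ^ ((CARD('a) ^ (2 * r) - 1) div 2) = to_ac \<epsilon>}
      \<le> 2 * ((J - 1) * Q + (B + n * e))" by simp
  also have "2 * ((J - 1) * Q + (B + n * e)) \<le> Q * Q + (5 * n + 8) * Q"
  proof -
    have i1: "2 * ((J - 1) * Q) = 2 * e * Q + (4 * n + 8) * Q"
      unfolding J_def by (simp add: algebra_simps)
    have i2: "2 * B \<le> Q" using par(1) by linarith
    have i3: "2 * (n * e) \<le> n * Q" unfolding Qe by simp
    have i4: "Q * Q = 2 * e * Q + Q" unfolding Qe by simp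
    have i5: "(5 * n + 8) * Q = (4 * n + 8) * Q + n * Q" by (simp add: algebra_simps)
    have "2 * u = x + y \<Longrightarrow> 2 * b \<le> Q \<Longrightarrow> 2 * v \<le> z \<Longrightarrow> s = x + Q \<Longrightarrow> w = y + z \<Longrightarrow>
        2 * (u + (b + v)) \<le> s + w" for u v w x y z s b :: nat
      by simp
    from this[OF i1 i2 i3 i4 i5] show ?thesis .
  qed
  finally show ?thesis unfolding N Q_def .
qed

text \<open>The points where the character is 1 and those where it is -1 make up the whole field
  except for at most \<open>n\<close> zeros of \<open>D\<close>. Each class is at most half the
  field plus an error; so the upper bound for one class is also a lower bound for the other, and
  their difference is of the size of the error.\<close>

lemma psum_bound:
  fixes D :: "'a::{field,finite} poly"
  assumes odd: "odd CARD('a)" and D: "squarefree D" "degree D = n" "n > 0" and r: "r > 0"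
    and Q: "4 * n + 4 \<le> CARD('a) ^ r"
  shows "\<bar>psum D (2 * r)\<bar> \<le> int ((6 * n + 8) * CARD('a) ^ r)"
proof -
  define E where "E = (CARD('a) ^ (2 * r) - 1) div 2"
  let ?F = "ffield (2 * r) :: 'a alg_closure set"
  have r2: "2 * r > 0" using r by simp
  have sgn: "ac_sign (2 * r) y = (if y = 0 then 0 else if y ^ E = 1 then 1 else -1)" for y :: "'a alg_closure"
    unfolding ac_sign_def E_def ..
  define Z where "Z \<epsilon> = {x \<in> ?F. ev D x ^ E = to_ac \<epsilon>}" for \<epsilon>
  define Z0 where "Z0 = {x \<in> ?F. ev D x = 0}"
  have fin: "finite ?F" by (rule card_ffield(2)[OF r2])
  have E: "E > 0" unfolding E_def by (rule half_exponent(2)[OF odd card_gt_1 r2])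
  have D0: "D \<noteq> 0" using D by auto
  have "card Z0 \<le> card {x. ev D x = 0}"
    unfolding Z0_def by (rule card_mono[OF finite_ev_roots[OF D0]]) auto
  then have Z0: "card Z0 \<le> n" using card_ev_roots[OF D0] D(2) by simp
  have two: "(1 :: 'a alg_closure) \<noteq> -1"
    using two_neq_0_alg_closure[OF odd] by (metis add.right_inverse one_add_one)
  have cases: "x \<in> Z0 \<or> x \<in> Z 1 \<or> x \<in> Z (-1)" if "x \<in> ?F" for x
  proof (cases "ev D x = 0")
    case False
    have "ev D x ^ (2 * E) = 1"
      unfolding E_def half_exponent(1)[OF odd card_gt_1 r2]
      by (rule ffield_nonzero_power[OF ev_in_ffield_of_root[OF that] False])
    from power_half_exponent_cases[OF this] that show ?thesis by (auto simp: Z_def)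
  qed (use that in \<open>simp add: Z0_def\<close>)
  have disj: "Z0 \<inter> Z 1 = {}" "Z0 \<inter> Z (-1) = {}" "Z 1 \<inter> Z (-1) = {}"
    using two unfolding Z0_def Z_def by (auto simp: zero_power[OF E])
  have F: "?F = Z0 \<union> (Z 1 \<union> Z (-1))" using cases unfolding Z0_def Z_def by blast
  have finZ: "finite Z0" "finite (Z \<epsilon>)" for \<epsilon> using fin unfolding Z0_def Z_def by auto
  have split: "(\<Sum>x\<in>?F. f x) = (\<Sum>x\<in>Z0. f x) + ((\<Sum>x\<in>Z 1. f x) + (\<Sum>x\<in>Z (-1). f x))"
    for f :: "'a alg_closure \<Rightarrow> int"
    unfolding F using disj finZ by (subst sum.union_disjoint; auto simp: sum.union_disjoint)
  have "int (card ?F) = int (card Z0) + (int (card (Z 1)) + int (card (Z (-1))))"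
    using split[of "\<lambda>_. 1"] by simp
  then have N: "int (CARD('a) ^ (2 * r)) = int (card Z0) + (int (card (Z 1)) + int (card (Z (-1))))"
    unfolding card_ffield(1)[OF r2] .
  have "(\<Sum>x\<in>Z0. ac_sign (2 * r) (ev D x)) = (\<Sum>x\<in>Z0. 0)"
    by (rule sum.cong[OF refl]) (simp add: Z0_def ac_sign_def)
  moreover have "(\<Sum>x\<in>Z 1. ac_sign (2 * r) (ev D x)) = (\<Sum>x\<in>Z 1. 1)"
    by (rule sum.cong[OF refl]) (auto simp: Z_def sgn zero_power[OF E])
  moreover have "(\<Sum>x\<in>Z (-1). ac_sign (2 * r) (ev D x)) = (\<Sum>x\<in>Z (-1). -1)"
    by (rule sum.cong[OF refl]) (use two in \<open>auto simp: Z_def sgn zero_power[OF E]\<close>)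
  ultimately have ps: "psum D (2 * r) = int (card (Z 1)) - int (card (Z (-1)))"
    unfolding psum_eq_character_sum[OF odd r2] split by simp
  have bound: "2 * card (Z \<epsilon>) \<le> CARD('a) ^ (2 * r) + (5 * n + 8) * CARD('a) ^ r" if "\<epsilon> \<noteq> 0" for \<epsilon>
    unfolding Z_def E_def by (rule stepanov_count[OF odd D r that Q])
  have b1: "2 * int (card (Z \<epsilon>)) \<le> int (CARD('a) ^ (2 * r)) + int ((5 * n + 8) * CARD('a) ^ r)" if "\<epsilon> \<noteq> 0" for \<epsilon>
    using of_nat_mono[OF bound[OF that], where 'a=int] by simp
  have "n * 1 \<le> n * CARD('a) ^ r" using Q by (intro mult_le_mono2) linarith
  then have n: "int (card Z0) \<le> int (n * CARD('a) ^ r)" using Z0 by (simp only: of_nat_le_iff)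
  have C: "int ((6 * n + 8) * CARD('a) ^ r) = int ((5 * n + 8) * CARD('a) ^ r) + int (n * CARD('a) ^ r)"
    by (simp add: algebra_simps)
  show ?thesis
    unfolding ps abs_le_iff C using b1[of 1] b1[of "-1"] N n by simp
qed

text \<open>Cancellation between the powers cannot persist: by simultaneous Dirichlet approximation
  there are arbitrarily large exponents r for which all \<alpha>^r lie within the angle \<pi> / 3 of
  the positive axis. For these the real part of the power sum is at least half the sum of the norms,
  so one large \<open>\<beta>\<close> would break the bound. The size of \<open>C\<close> does not
  affect the conclusion.\<close>

lemma power_sum_growth_bound:
  fixes A :: "complex multiset" and \<rho> C :: real
  assumes \<rho>: "\<rho> > 0" and bound: "\<And>r. r \<ge> r0 \<Longrightarrow> norm (\<Sum>\<alpha>\<in>#A. \<alpha> ^ r) \<le> C * \<rho> ^ r"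
    and \<beta>: "\<beta> \<in># A"
  shows "norm \<beta> \<le> \<rho>"
proof (rule ccontr)
  assume "\<not> norm \<beta> \<le> \<rho>"
  then have gt: "norm \<beta> / \<rho> > 1" using \<rho> by simp
  obtain xs where xs: "mset xs = A" using ex_mset by blast
  obtain s0 where s0: "2 * C < (norm \<beta> / \<rho>) ^ s0" using real_arch_pow[OF gt] by blast
  \<comment> \<open>Approximating s times the angles instead of the angles themselves makes the
    exponent r found below a multiple of s, so it is large enough both for \<open>bound\<close> and
    for the growth of \<open>norm \<beta> / \<rho>\<close>.\<close>
  define s where "s = Suc (max s0 r0)"
  define \<theta> where "\<theta> i = real s * (Arg (xs ! i) / (2 * pi))" for i
  \<comment> \<open>Precision 1/6 in units of full turns is the angle \<pi> / 3, where the cosine is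
    1/2.\<close>
  obtain t p where t: "0 < t" and p: "\<And>i. i < length xs \<Longrightarrow> \<bar>real_of_int t * \<theta> i - real_of_int (p i)\<bar> < 1 / real 6"
    by (rule Dirichlet_approx_simult[of 6 "length xs" \<theta>]) (simp, rule that)
  define r where "r = s * nat t"
  have "1 \<le> nat t" using t by simp
  from mult_le_mono2[OF this, of s] have rs: "r \<ge> s" unfolding r_def by simp
  have Re_ge: "Re (xs ! i ^ r) \<ge> norm (xs ! i) ^ r / 2" if i: "i < length xs" for i
  proof -
    let ?z = "xs ! i"
    have "?z ^ r = complex_of_real (norm ?z ^ r) * cis (real r * Arg ?z)"
      using rcis_cmod_Arg[of ?z] DeMoivre2[of "norm ?z" "Arg ?z" r] by (simp add: rcis_def)
    then have Re: "Re (?z ^ r) = norm ?z ^ r * cos (real r * Arg ?z)" by simp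
    define \<delta> where "\<delta> = real_of_int t * \<theta> i - real_of_int (p i)"
    have "real r * Arg ?z = 2 * pi * \<delta> + real_of_int (p i) * (2 * pi)"
      using t unfolding \<delta>_def \<theta>_def r_def by (simp add: field_simps)
    then have "cos (real r * Arg ?z) = cos (2 * pi * \<delta> + 2 * pi * real_of_int (p i))"
      by (simp add: mult_ac)
    also have "\<dots> = cos (2 * pi * \<delta>)"
      using cos.plus_of_int[of "2 * pi * \<delta>" "p i"] by (simp add: mult_ac)
    also have "\<dots> = cos \<bar>2 * pi * \<delta>\<bar>" by (simp add: abs_if)
    also have "\<dots> \<ge> cos (pi / 3)"
    proof (rule cos_monotone_0_pi_le)
      have "2 * pi * \<bar>\<delta>\<bar> \<le> 2 * pi * (1 / 6)"
        using p[OF i] unfolding \<delta>_def[symmetric] by (intro mult_left_mono) auto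
      then show "\<bar>2 * pi * \<delta>\<bar> \<le> pi / 3" by (simp add: abs_mult)
    qed auto
    finally have "cos (real r * Arg ?z) \<ge> 1 / 2" by (simp add: cos_60)
    then have "norm ?z ^ r * (1 / 2) \<le> norm ?z ^ r * cos (real r * Arg ?z)"
      by (intro mult_left_mono) auto
    then show ?thesis unfolding Re by simp
  qed
  obtain j where j: "j < length xs" "xs ! j = \<beta>"
    using \<beta> unfolding xs[symmetric] by (auto simp: in_set_conv_nth)
  have "norm \<beta> ^ r / 2 \<le> (\<Sum>i<length xs. Re (xs ! i ^ r))"
  proof -
    have "norm \<beta> ^ r / 2 \<le> Re (xs ! j ^ r)" using Re_ge[OF j(1)] j(2) by simp
    also have "\<dots> \<le> (\<Sum>i<length xs. Re (xs ! i ^ r))"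
    proof (rule member_le_sum)
      fix i assume "i \<in> {..<length xs} - {j}"
      then have "norm (xs ! i) ^ r / 2 \<le> Re (xs ! i ^ r)" by (intro Re_ge) auto
      moreover have "norm (xs ! i) ^ r / 2 \<ge> 0" by simp
      ultimately show "0 \<le> Re (xs ! i ^ r)" by linarith
    qed (use j in auto)
    finally show ?thesis .
  qed
  also have "\<dots> = Re (\<Sum>\<alpha>\<in>#A. \<alpha> ^ r)"
  proof -
    have "(\<Sum>\<alpha>\<in>#A. \<alpha> ^ r) = (\<Sum>x\<leftarrow>xs. x ^ r)" unfolding xs[symmetric] by (simp flip: mset_map sum_mset_sum_list)
    also have "\<dots> = (\<Sum>i<length xs. xs ! i ^ r)" by (simp add: sum_list_sum_nth atLeast0LessThan)
    finally show ?thesis by simp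
  qed
  also have "\<dots> \<le> C * \<rho> ^ r"
    using order_trans[OF complex_Re_le_cmod bound[of r]] rs unfolding s_def by simp
  finally have "(norm \<beta> / \<rho>) ^ r \<le> 2 * C" using \<rho> by (simp add: power_divide field_simps)
  moreover have "(norm \<beta> / \<rho>) ^ s0 \<le> (norm \<beta> / \<rho>) ^ r"
    using gt rs unfolding s_def by (intro power_increasing) auto
  ultimately show False using s0 by linarith
qed

text \<open>Stepanov's bound concerns the even power sums \<open>psum D (2 * r)\<close> only. These
  are, up to sign, the r-th power sums of the squares of the inverse roots, so the growth bound is
  applied to the squares with \<rho> = q.\<close>

lemma L_poly_RH:
  fixes D :: "'a::{field,finite} poly"
  assumes odd: "odd CARD('a)" and D: "D \<in> monic_squarefree n" and n: "n > 0"
  obtains A where "size A \<le> n - 1" "\<And>u. L_fun D u = (\<Prod>\<alpha>\<in>#A. 1 - \<alpha> * u)"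
    "\<And>r. r > 0 \<Longrightarrow> of_int (psum D r) = - (\<Sum>\<alpha>\<in>#A. \<alpha> ^ r)"
    "\<And>\<alpha>. \<alpha> \<in># A \<Longrightarrow> norm \<alpha> \<le> sqrt (real CARD('a))"
proof -
  obtain A where A: "size A \<le> n - 1" "\<And>u. L_fun D u = (\<Prod>\<alpha>\<in>#A. 1 - \<alpha> * u)"
    "\<And>r. r > 0 \<Longrightarrow> of_int (psum D r) = - (\<Sum>\<alpha>\<in>#A. \<alpha> ^ r)"
    using L_poly_factorization[OF assms] by blast
  have D': "squarefree D" "degree D = n" using D by (auto simp: monic_squarefree_def)
  have q: "CARD('a) \<ge> 2" using card_gt_1[where 'a='a] by simp
  have bound: "norm (\<Sum>\<beta>\<in>#image_mset (\<lambda>\<alpha>. \<alpha> ^ 2) A. \<beta> ^ r) \<le> real (6 * n + 8) * real CARD('a) ^ r"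
    \<comment> \<open>As q^r \<ge> 2^r > r, this makes the field large enough for
      \<open>psum_bound\<close>.\<close>
    if r: "r \<ge> 4 * n + 4" for r
  proof -
    have "r < 2 ^ r" by (rule less_exp)
    also have "(2::nat) ^ r \<le> CARD('a) ^ r" using q by (rule power_mono) simp
    finally have Q: "4 * n + 4 \<le> CARD('a) ^ r" using r by simp
    have "(\<Sum>\<beta>\<in>#image_mset (\<lambda>\<alpha>. \<alpha> ^ 2) A. \<beta> ^ r) = (\<Sum>\<alpha>\<in>#A. \<alpha> ^ (2 * r))"
      by (simp add: image_mset.compositionality o_def power_mult)
    also have "\<dots> = - of_int (psum D (2 * r))" using A(3)[of "2 * r"] r by simp
    finally have "norm (\<Sum>\<beta>\<in>#image_mset (\<lambda>\<alpha>. \<alpha> ^ 2) A. \<beta> ^ r) = real_of_int \<bar>psum D (2 * r)\<bar>"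
      by simp
    also have "\<dots> \<le> real_of_int (int ((6 * n + 8) * CARD('a) ^ r))"
      unfolding of_int_le_iff using psum_bound[OF odd D' n _ Q] r by simp
    finally show ?thesis by simp
  qed
  have "norm \<alpha> \<le> sqrt (real CARD('a))" if "\<alpha> \<in># A" for \<alpha>
  proof -
    have "norm (\<alpha> ^ 2) \<le> real CARD('a)"
      by (rule power_sum_growth_bound[OF _ bound]) (use q that in auto)
    then have "norm \<alpha> ^ 2 \<le> real CARD('a)" by (simp add: norm_power)
    then show ?thesis by (rule real_le_rsqrt)
  qed
  with that A show ?thesis by blast
qed

section \<open>An upper bound on the critical circle\<close>

lemma fejer_square:
  assumes "norm (z :: complex) = 1"
  shows "Re (of_nat (Suc K) + 2 * (\<Sum>m=1..K. of_nat (Suc K - m) * z ^ m)) = (norm (\<Sum>i\<le>K. z ^ i))\<^sup>2"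
proof (induction K)
  case (Suc K)
  let ?T = "\<lambda>K. of_nat (Suc K) + 2 * (\<Sum>m=1..K. of_nat (Suc K - m) * z ^ m) :: complex"
  have "(\<Sum>m=1..Suc K. of_nat (Suc (Suc K) - m) * z ^ m) =
      (\<Sum>m=1..Suc K. of_nat (Suc K - m) * z ^ m) + (\<Sum>m=1..Suc K. z ^ m)"
    unfolding sum.distrib[symmetric]
    by (rule sum.cong[OF refl]) (auto simp: Suc_diff_le algebra_simps)
  also have "(\<Sum>m=1..Suc K. of_nat (Suc K - m) * z ^ m) = (\<Sum>m=1..K. of_nat (Suc K - m) * z ^ m)"
    by simp
  finally have T: "?T (Suc K) = ?T K + (1 + 2 * (\<Sum>m=1..Suc K. z ^ m))"
    by (simp add: algebra_simps)
  let ?s = "\<Sum>i\<le>K. z ^ i"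
  have "cnj ?s * z ^ Suc K = (\<Sum>i\<le>K. z ^ (Suc K - i))"
    unfolding cnj_sum sum_distrib_right
  proof (rule sum.cong[OF refl])
    fix i assume "i \<in> {..K}"
    then have "z ^ Suc K = z ^ i * z ^ (Suc K - i)" by (simp flip: power_add)
    moreover have "cnj (z ^ i) * z ^ i = 1"
      using assms by (metis complex_norm_square mult.commute norm_power of_real_1 one_power2 power_one)
    ultimately show "cnj (z ^ i) * z ^ Suc K = z ^ (Suc K - i)" by (metis mult.assoc mult_1)
  qed
  also have "\<dots> = (\<Sum>m=1..Suc K. z ^ m)"
    by (rule sum.reindex_bij_witness[of _ "\<lambda>m. Suc K - m" "\<lambda>i. Suc K - i"]) auto
  finally have cross: "cnj ?s * z ^ Suc K = (\<Sum>m=1..Suc K. z ^ m)" .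
  have "(norm (a + b))\<^sup>2 = (norm a)\<^sup>2 + (norm b)\<^sup>2 + 2 * Re (cnj a * b)" for a b :: complex
    unfolding cmod_power2 by (simp add: power2_eq_square algebra_simps)
  then have "(norm (?s + z ^ Suc K))\<^sup>2 = (norm ?s)\<^sup>2 + (norm (z ^ Suc K))\<^sup>2 + 2 * Re (cnj ?s * z ^ Suc K)" .
  also have "norm (z ^ Suc K) = 1" using assms by (simp only: norm_power power_one)
  finally have "(norm (\<Sum>i\<le>Suc K. z ^ i))\<^sup>2 = (norm ?s)\<^sup>2 + 1 + 2 * Re (\<Sum>m=1..Suc K. z ^ m)"
    unfolding cross by simp
  also have "\<dots> = Re (?T (Suc K))" unfolding T Suc.IH[symmetric] by simp
  finally show ?case by simp
qed simp

text \<open>On the unit circle the Fejer kernel is a square of a norm and hence nonnegative. Its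
  real part is harmonic, so nonnegativity extends to the disc; this is obtained from the maximum
  modulus principle for exp of minus the kernel.\<close>

lemma fejer_Re_ge:
  assumes "norm (z :: complex) \<le> 1"
  shows "Re (\<Sum>m=1..K. of_real (1 - real m / real (Suc K)) * z ^ m) \<ge> - 1 / 2"
proof -
  let ?T = "\<lambda>z. of_nat (Suc K) + 2 * (\<Sum>m=1..K. of_nat (Suc K - m) * z ^ m) :: complex"
  have "norm (exp (- ?T z)) \<le> 1"
  proof (rule maximum_modulus_frontier[where S = "cball 0 1" and f = "\<lambda>z. exp (- ?T z)"])
    show "(\<lambda>z. exp (- ?T z)) holomorphic_on interior (cball 0 1)"
      by (intro holomorphic_intros)
    show "continuous_on (closure (cball 0 1)) (\<lambda>z. exp (- ?T z))"
      by (intro continuous_intros)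
    show "norm (exp (- ?T w)) \<le> 1" if "w \<in> frontier (cball 0 1)" for w
    proof -
      have "norm w = 1" using that by (simp add: frontier_cball)
      from fejer_square[OF this, of K] have "Re (?T w) \<ge> 0" by simp
      then show ?thesis by simp
    qed
  qed (use assms in auto)
  then have T: "Re (?T z) \<ge> 0" by simp
  have "?T z = of_nat (Suc K) * (1 + 2 * (\<Sum>m=1..K. of_real (1 - real m / real (Suc K)) * z ^ m))"
  proof -
    have "of_nat (Suc K - m) * z ^ m = of_nat (Suc K) * (of_real (1 - real m / real (Suc K)) * z ^ m)"
      if "m \<in> {1..K}" for m
    proof -
      have "real (Suc K - m) = real (Suc K) * (1 - real m / real (Suc K))"
        using that by (simp add: of_nat_diff field_simps)
      then have "complex_of_real (real (Suc K - m)) = complex_of_real (real (Suc K) * (1 - real m / real (Suc K)))"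
        by (rule arg_cong)
      then show ?thesis unfolding of_real_mult of_real_of_nat_eq by (simp only: mult.assoc)
    qed
    then have "(\<Sum>m=1..K. of_nat (Suc K - m) * z ^ m) =
        of_nat (Suc K) * (\<Sum>m=1..K. of_real (1 - real m / real (Suc K)) * z ^ m)"
      unfolding sum_distrib_left by (rule sum.cong[OF refl])
    then show ?thesis by (simp add: algebra_simps)
  qed
  moreover have "Re (of_nat k * (1 + 2 * w)) = real k * (1 + 2 * Re w)" for k w by simp
  ultimately have "Re (?T z) = real (Suc K) * (1 + 2 * Re (\<Sum>m=1..K. of_real (1 - real m / real (Suc K)) * z ^ m))"
    by simp
  with T have "1 + 2 * Re (\<Sum>m=1..K. of_real (1 - real m / real (Suc K)) * z ^ m) \<ge> 0"
    by (simp add: zero_le_mult_iff)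
  then show ?thesis by simp
qed

text \<open>With these weights \<open>Hsum (Suc K) z - Hsum K z\<close> is a positive multiple of a Fejer sum, whose
  real part is at least \<open>- 1 / 2\<close>. Hence up to an error \<open>1 / K\<close> the real part of \<open>Hsum K z\<close> is
  below its limit, the real part of \<open>- Ln (1 - z)\<close>, in the whole disc.\<close>

definition wt :: "nat \<Rightarrow> nat \<Rightarrow> real" where
  "wt K m = (1 - real m / real K) * (1 - real m / real (Suc K))"

definition Hsum :: "nat \<Rightarrow> complex \<Rightarrow> complex" where
  "Hsum K z = (\<Sum>m=1..K. of_real (wt K m / real m) * z ^ m)"

lemma wt_bounds: "m \<le> K \<Longrightarrow> 0 \<le> wt K m" "m \<le> K \<Longrightarrow> wt K m \<le> 1"
proof -
  assume m: "m \<le> K"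
  then have 1: "0 \<le> 1 - real m / real K" "1 - real m / real K \<le> 1"
    by (cases "K = 0"; simp add: field_simps)+
  have 2: "0 \<le> 1 - real m / real (Suc K)" "1 - real m / real (Suc K) \<le> 1"
    using m by (simp_all add: field_simps)
  show "0 \<le> wt K m" "wt K m \<le> 1"
    unfolding wt_def using 1 2 by (auto intro: mult_le_one)
qed

lemma Hsum_step:
  assumes K: "K \<ge> 1"
  shows "Hsum (Suc K) z - Hsum K z = of_real (1 / real K - 1 / real (K + 2)) *
    (\<Sum>m=1..K. of_real (1 - real m / real (Suc K)) * z ^ m)"
proof -
  have "wt (Suc K) (Suc K) = 0" by (simp add: wt_def)
  then have H: "Hsum (Suc K) z = (\<Sum>m=1..K. of_real (wt (Suc K) m / real m) * z ^ m)"
    unfolding Hsum_def by simp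
  have "Hsum (Suc K) z - Hsum K z = (\<Sum>m=1..K. of_real ((wt (Suc K) m - wt K m) / real m) * z ^ m)"
    unfolding H unfolding Hsum_def sum_subtractf[symmetric] diff_divide_distrib of_real_diff left_diff_distrib ..
  also have "\<dots> = (\<Sum>m=1..K. of_real (1 / real K - 1 / real (K + 2)) * (of_real (1 - real m / real (Suc K)) * z ^ m))"
  proof (rule sum.cong[OF refl])
    fix m assume m: "m \<in> {1..K}"
    have "(wt (Suc K) m - wt K m) = real m * ((1 / real K - 1 / real (K + 2)) * (1 - real m / real (Suc K)))"
    proof -
      \<comment> \<open>Applied with x = m and a, b, c the inverses of K, K + 1, K + 2. The factor x
        on the right cancels the division by m in \<open>Hsum\<close>, which is the reason for the
        product form of \<open>wt\<close>.\<close>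
      have gen: "(1 - x * b) * (1 - x * c) - (1 - x * a) * (1 - x * b) = x * ((a - c) * (1 - x * b))" for x a b c :: real
        by (simp add: algebra_simps)
      have K2: "K + 2 = Suc (Suc K)" by simp
      show ?thesis unfolding wt_def K2 divide_inverse mult_1_left by (rule gen)
    qed
    then have "(wt (Suc K) m - wt K m) / real m = (1 / real K - 1 / real (K + 2)) * (1 - real m / real (Suc K))"
      using m by simp
    then show "of_real ((wt (Suc K) m - wt K m) / real m) * z ^ m =
        of_real (1 / real K - 1 / real (K + 2)) * (of_real (1 - real m / real (Suc K)) * z ^ m)"
      by (simp only: of_real_mult mult.assoc)
  qed
  finally show ?thesis by (simp only: sum_distrib_left)
qed

text \<open>Step M loses at most half of 1 / M - 1 / (M + 2). These losses telescope to differences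
  of the correction (1 / M + 1 / (M + 1)) / 2.\<close>

lemma Hsum_Re_incseq:
  assumes K: "K \<ge> 1" and z: "norm z \<le> 1" and M: "M \<ge> K"
  shows "Re (Hsum K z) - (1 / real K + 1 / real (K + 1)) / 2 \<le> Re (Hsum M z) - (1 / real M + 1 / real (M + 1)) / 2"
  using M
proof (induction M rule: dec_induct)
  case (step M)
  then have M1: "M \<ge> 1" using K by simp
  let ?c = "1 / real M - 1 / real (M + 2)"
  have c: "?c \<ge> 0" using M1 by (simp add: field_simps)
  have Re_mult: "Re (of_real c * w) = c * Re w" for c w by simp
  have "Re (Hsum (Suc M) z) - Re (Hsum M z) = ?c * Re (\<Sum>m=1..M. of_real (1 - real m / real (Suc M)) * z ^ m)"
    unfolding minus_complex.sel(1)[symmetric] Hsum_step[OF M1] by (rule Re_mult)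
  also have "\<dots> \<ge> ?c * (- 1 / 2)" using c fejer_Re_ge[OF z, of M] by (rule mult_left_mono[rotated])
  finally have "?c * (- 1 / 2) \<le> Re (Hsum (Suc M) z) - Re (Hsum M z)" .
  moreover have "a \<le> h' - (w + y) / 2" if "(x - y) * (- 1 / 2) \<le> h' - h" "a \<le> h - (x + w) / 2"
    for x y w h h' a :: real
    using that by (simp add: field_simps)
  ultimately have "Re (Hsum K z) - (1 / real K + 1 / real (K + 1)) / 2 \<le>
      Re (Hsum (Suc M) z) - (1 / real (M + 1) + 1 / real (M + 2)) / 2"
    using step.IH by blast
  then show ?case by simp
qed simp

text \<open>The weight of degree m differs from 1 by at most 2 m / M. The factor m cancels the 1 / m
  of the logarithmic series, so the total error is at most 2 / M times a geometric series.\<close>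

lemma Hsum_tendsto:
  assumes z: "norm z < 1"
  shows "(\<lambda>M. Hsum M z) \<longlonglongrightarrow> - Ln (1 - z)"
proof -
  have "(\<lambda>n. - (z ^ n) / of_nat n) sums Ln (1 - z)"
    using Ln_series'[of "- z"] z by simp
  from sums_minus[OF this] have "(\<lambda>n. z ^ n / of_nat n) sums - Ln (1 - z)" by simp
  then have "(\<lambda>M. \<Sum>n<M. z ^ n / of_nat n) \<longlonglongrightarrow> - Ln (1 - z)" by (simp add: sums_def)
  then have "(\<lambda>M. \<Sum>n<Suc M. z ^ n / of_nat n) \<longlonglongrightarrow> - Ln (1 - z)" by (rule LIMSEQ_Suc)
  moreover have "(\<Sum>n<Suc M. z ^ n / of_nat n) = (\<Sum>m=1..M. z ^ m / of_nat m)" for M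
    by (rule sum.mono_neutral_right) (auto simp: Suc_le_eq)
  ultimately have lim: "(\<lambda>M. \<Sum>m=1..M. z ^ m / of_nat m) \<longlonglongrightarrow> - Ln (1 - z)" by simp
  have "(\<lambda>M. Hsum M z - (\<Sum>m=1..M. z ^ m / of_nat m)) \<longlonglongrightarrow> 0"
  proof (rule Lim_null_comparison)
    have "norm (Hsum M z - (\<Sum>m=1..M. z ^ m / of_nat m)) \<le> 2 / (1 - norm z) * (1 / real M)" if M: "M \<ge> 1" for M
    proof -
      have "Hsum M z - (\<Sum>m=1..M. z ^ m / of_nat m) = (\<Sum>m=1..M. of_real ((wt M m - 1) / real m) * z ^ m)"
        unfolding Hsum_def sum_subtractf[symmetric]
        by (rule sum.cong[OF refl]) (simp add: field_simps)
      also have "norm \<dots> \<le> (\<Sum>m=1..M. 2 / real M * norm z ^ m)"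
      proof (rule order_trans[OF norm_sum], rule sum_mono)
        fix m assume m: "m \<in> {1..M}"
        have "1 - wt M m \<le> 2 * real m / real M"
        proof -
          have "wt M m \<ge> 1 - real m / real M - real m / real (Suc M)"
          proof -
            have "(1 - x) * (1 - y) \<ge> 1 - x - y" if "x \<ge> 0" "y \<ge> 0" for x y :: real
              using mult_nonneg_nonneg[OF that] by (simp add: algebra_simps)
            then show ?thesis unfolding wt_def by simp
          qed
          moreover have "real m / real (Suc M) \<le> real m / real M" using M by (simp add: frac_le)
          ultimately show ?thesis by simp
        qed
        moreover have "wt M m \<le> 1" using wt_bounds m by simp
        ultimately have "\<bar>wt M m - 1\<bar> / real m \<le> (2 * real m / real M) / real m"
          by (intro divide_right_mono) auto
        then have "\<bar>(wt M m - 1) / real m\<bar> \<le> 2 / real M" using m by (simp add: abs_divide)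
        then show "norm (of_real ((wt M m - 1) / real m) * z ^ m) \<le> 2 / real M * norm z ^ m"
          unfolding norm_mult norm_power norm_of_real by (intro mult_right_mono) auto
      qed
      also have "\<dots> = 2 / real M * (\<Sum>m=1..M. norm z ^ m)" by (simp only: sum_distrib_left)
      also have "\<dots> \<le> 2 / real M * (1 / (1 - norm z))"
      proof (rule mult_left_mono)
        have "(\<Sum>m=1..M. norm z ^ m) \<le> (\<Sum>m. norm z ^ m)"
          using z by (intro sum_le_suminf summable_geometric) auto
        also have "(\<Sum>m. norm z ^ m) = 1 / (1 - norm z)" using z by (intro suminf_geometric) simp
        finally show "(\<Sum>m=1..M. norm z ^ m) \<le> 1 / (1 - norm z)" .
      qed simp
      also have "\<dots> = 2 / (1 - norm z) * (1 / real M)" by simp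
      finally show ?thesis .
    qed
    then show "\<forall>\<^sub>F M in sequentially. norm (Hsum M z - (\<Sum>m=1..M. z ^ m / of_nat m)) \<le> 2 / (1 - norm z) * (1 / real M)"
      by (intro eventually_sequentiallyI[of 1])
    show "(\<lambda>M. 2 / (1 - norm z) * (1 / real M)) \<longlonglongrightarrow> 0"
      by (rule tendsto_mult_right_zero[OF lim_1_over_n])
  qed
  from tendsto_add[OF this lim] show ?thesis by simp
qed

lemma norm_one_minus_le_open:
  assumes K: "K \<ge> 1" and z: "norm z < 1"
  shows "norm (1 - z) \<le> exp (1 / real K - Re (Hsum K z))"
proof -
  have l2: "(\<lambda>M. 1 / real (M + 1)) \<longlonglongrightarrow> 0"
    by (rule LIMSEQ_ignore_initial_segment[OF lim_1_over_n])
  have "(\<lambda>M. Re (Hsum M z) - (1 / real M + 1 / real (M + 1)) / 2) \<longlonglongrightarrow> Re (- Ln (1 - z)) - (0 + 0) / 2"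
    by (intro tendsto_diff tendsto_Re tendsto_divide tendsto_add Hsum_tendsto[OF z] lim_1_over_n l2 tendsto_const) simp
  then have "Re (Hsum K z) - (1 / real K + 1 / real (K + 1)) / 2 \<le> Re (- Ln (1 - z)) - (0 + 0) / 2"
    by (rule LIMSEQ_le_const) (use Hsum_Re_incseq[OF K] z in \<open>auto intro!: exI[of _ K]\<close>)
  moreover have nz: "1 - z \<noteq> 0" using z by auto
  ultimately have "ln (norm (1 - z)) \<le> (1 / real K + 1 / real (K + 1)) / 2 - Re (Hsum K z)" by simp
  also have "\<dots> \<le> 1 / real K - Re (Hsum K z)"
  proof -
    have "1 / real (K + 1) \<le> 1 / real K" using K by (intro frac_le) auto
    moreover have "(a + b) / 2 - c \<le> a - c" if "b \<le> a" for a b c :: real using that by simp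
    ultimately show ?thesis by blast
  qed
  finally have *: "ln (norm (1 - z)) \<le> 1 / real K - Re (Hsum K z)" .
  have "norm (1 - z) = exp (ln (norm (1 - z)))" using nz by simp
  also have "\<dots> \<le> exp (1 / real K - Re (Hsum K z))" unfolding exp_le_cancel_iff by (rule *)
  finally show ?thesis .
qed

text \<open>Both sides are continuous, as \<open>Hsum\<close> is a polynomial in z, so the bound
  passes to the closed disc. The boundary matters: on the critical circle an inverse root times u
  may have norm exactly 1.\<close>

lemma norm_one_minus_le:
  assumes K: "K \<ge> 1" and z: "norm z \<le> 1"
  shows "norm (1 - z) \<le> exp (1 / real K - Re (Hsum K z))"
proof -
  have "closure (ball 0 1) \<subseteq> {z. norm (1 - z) \<le> exp (1 / real K - Re (Hsum K z))}"
  proof (rule closure_minimal)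
    show "ball 0 1 \<subseteq> {z. norm (1 - z) \<le> exp (1 / real K - Re (Hsum K z))}"
      using norm_one_minus_le_open[OF K] by auto
    show "closed {z. norm (1 - z) \<le> exp (1 / real K - Re (Hsum K z))}"
      unfolding Hsum_def by (intro closed_Collect_le continuous_intros)
  qed
  with z show ?thesis by auto
qed

section \<open>From inverse roots to primes\<close>

lemma sum_inverse_le_ln:
  assumes "0 < a" "a \<le> b"
  shows "(\<Sum>d\<in>{a<..b}. 1 / real d) \<le> ln (real b / real a)"
  using assms(2)
proof (induction b rule: dec_induct)
  case base
  then show ?case using assms by simp
next
  case (step b)
  have b: "b > 0" using step assms by simp
  have "1 / real (Suc b) \<le> ln (real (Suc b) / real b)"
  proof -
    have "ln (real b / real (Suc b)) \<le> real b / real (Suc b) - 1"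
      using b by (intro ln_le_minus_one) simp
    also have "\<dots> = - (1 / real (Suc b))" by (simp add: field_simps)
    finally show ?thesis using b by (simp add: ln_div)
  qed
  moreover have "{a<..Suc b} = insert (Suc b) {a<..b}" using step by auto
  then have "(\<Sum>d\<in>{a<..Suc b}. 1 / real d) = (\<Sum>d\<in>{a<..b}. 1 / real d) + 1 / real (Suc b)" by simp
  ultimately have "(\<Sum>d\<in>{a<..Suc b}. 1 / real d) \<le> ln (real b / real a) + ln (real (Suc b) / real b)"
    using step.IH by linarith
  also have "\<dots> = ln (real (Suc b) / real a)" using b assms by (simp add: ln_div)
  finally show ?case .
qed

lemma harmonic_le_ln:
  assumes "K \<ge> 1"
  shows "(\<Sum>d=1..K. 1 / real d) \<le> 1 + ln (real K)"
proof -
  have "{1..K} = insert 1 {1<..K}" using assms by auto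
  then have "(\<Sum>d=1..K. 1 / real d) = 1 + (\<Sum>d\<in>{1<..K}. 1 / real d)" by simp
  also have "(\<Sum>d\<in>{1<..K}. 1 / real d) \<le> ln (real K)" using sum_inverse_le_ln[of 1 K] assms by simp
  finally show ?thesis by simp
qed

text \<open>The squares of primes contribute in even degrees only. This halves the harmonic sum and
  produces the term \<Lambda> / 2.\<close>

lemma sum_even_inverse:
  assumes "K \<ge> 1"
  shows "(\<Sum>m=1..K. if even m then 1 / real m else 0) \<le> (1 + ln (real K)) / 2"
proof -
  have "(\<Sum>m=1..K. if even m then 1 / real m else 0) = (\<Sum>m | m \<in> {1..K} \<and> even m. 1 / real m)"
    by (rule sum.inter_filter[symmetric]) simp
  also have "\<dots> = (\<Sum>j=1..K div 2. 1 / real (2 * j))"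
    by (rule sum.reindex_bij_witness[of _ "\<lambda>j. 2 * j" "\<lambda>m. m div 2"]) (auto elim!: evenE)
  also have "\<dots> \<le> (\<Sum>j=1..K. 1 / real (2 * j))"
    by (rule sum_mono2) auto
  also have "\<dots> = (\<Sum>j=1..K. 1 / real j) / 2"
    unfolding sum_divide_distrib by (rule sum.cong[OF refl]) simp
  also have "\<dots> \<le> (1 + ln (real K)) / 2" using harmonic_le_ln[OF assms] by simp
  finally show ?thesis .
qed

lemma sum_powers_le: "(q :: nat) \<ge> 2 \<Longrightarrow> (\<Sum>d=1..j. q ^ d) \<le> 2 * q ^ j"
proof (induction j)
  case (Suc j)
  have "2 * q ^ j \<le> q * q ^ j" using Suc.prems by (intro mult_right_mono) auto
  from order_trans[OF Suc.IH[OF Suc.prems] this] show ?case by simp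
qed simp

lemma irred_le_eq_UN: "irred_le K = (\<Union>m\<in>{1..K}. irred_deg m)"
proof (intro equalityI subsetI)
  fix P :: "'a poly" assume "P \<in> irred_le K"
  then have "P \<in> monic_irred" "degree P \<le> K" by (auto simp: irred_le_def)
  with monic_irred_degree_pos[of P] show "P \<in> (\<Union>m\<in>{1..K}. irred_deg m)"
    by (auto simp: irred_deg_def)
qed (auto simp: irred_le_def irred_deg_def)

lemma irred_deg_disjoint: "d \<noteq> e \<Longrightarrow> irred_deg d \<inter> irred_deg e = {}"
  by (auto simp: irred_deg_def)

lemma sign_abs_le: "a \<in> {-1, 0, 1::int} \<Longrightarrow> \<bar>a\<bar> \<le> 1"
  by auto

lemma sum_irred_le:
  fixes F :: "'a::{field,finite} poly \<Rightarrow> 'b::comm_monoid_add"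
  shows "(\<Sum>P\<in>irred_le K. F P) = (\<Sum>m=1..K. \<Sum>P\<in>irred_deg m. F P)"
  unfolding irred_le_eq_UN by (rule sum.UNION_disjoint) (simp_all add: irred_deg_disjoint)

text \<open>A proper divisor of r is r / 2 or at most r / 3, and the primes of degree d contribute
  at most q^d. After normalization by q^(-r/2) the squares of primes remain of size 1, while the
  higher powers decay like q^(-r/6).\<close>

lemma psum_prime_part:
  fixes D :: "'a::{field,finite} poly"
  assumes r: "r > 0"
  shows "\<bar>psum D r - int r * (\<Sum>P\<in>irred_deg r. poly_legendre D P)\<bar> \<le>
    int ((if even r then CARD('a) ^ (r div 2) else 0) + 2 * CARD('a) ^ (r div 3))"
proof -
  define T where "T = {d. d dvd r \<and> d < r}"
  have finT: "finite T" unfolding T_def by (rule finite_subset[of _ "{..<r}"]) auto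
  have T0: "d > 0" if "d \<in> T" for d using that r by (auto simp: T_def intro: gr0I)
  have q: "CARD('a) \<ge> 2" using card_gt_1[where 'a='a] by simp
  let ?U = "{P. P \<in> monic_irred \<and> degree P dvd r} :: 'a poly set"
  let ?f = "\<lambda>P. int (degree P) * poly_legendre D P ^ (r div degree P)"
  have U: "?U = irred_deg r \<union> (\<Union>d\<in>T. irred_deg d)"
  proof (intro equalityI subsetI)
    fix P :: "'a poly" assume P: "P \<in> ?U"
    then have "degree P \<le> r" using r by (auto intro: dvd_imp_le)
    with P show "P \<in> irred_deg r \<union> (\<Union>d\<in>T. irred_deg d)"
      by (cases "degree P = r") (auto simp: irred_deg_def T_def)
  qed (auto simp: irred_deg_def T_def)
  have "psum D r = (\<Sum>P\<in>irred_deg r. ?f P) + (\<Sum>P\<in>(\<Union>d\<in>T. irred_deg d). ?f P)"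
    unfolding psum_def U by (rule sum.union_disjoint) (simp add: finT, simp add: finT, auto simp: irred_deg_def T_def)
  also have "(\<Sum>P\<in>irred_deg r. ?f P) = int r * (\<Sum>P\<in>irred_deg r. poly_legendre D P)"
    unfolding sum_distrib_left by (rule sum.cong[OF refl]) (use r in \<open>simp add: irred_deg_def\<close>)
  also have "(\<Sum>P\<in>(\<Union>d\<in>T. irred_deg d). ?f P) = (\<Sum>d\<in>T. \<Sum>P\<in>irred_deg d. ?f P)"
    by (rule sum.UNION_disjoint) (simp_all add: irred_deg_disjoint finT)
  finally have eq: "psum D r - int r * (\<Sum>P\<in>irred_deg r. poly_legendre D P) = (\<Sum>d\<in>T. \<Sum>P\<in>irred_deg d. ?f P)"
    by simp
  have "\<bar>\<Sum>d\<in>T. \<Sum>P\<in>irred_deg d. ?f P\<bar> \<le> (\<Sum>d\<in>T. int (CARD('a) ^ d))"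
  proof (rule order_trans[OF sum_abs], rule sum_mono)
    fix d assume d: "d \<in> T"
    have "\<bar>\<Sum>P\<in>irred_deg d. ?f P\<bar> \<le> (\<Sum>P\<in>(irred_deg d :: 'a poly set). int d)"
    proof (rule order_trans[OF sum_abs], rule sum_mono)
      fix P :: "'a poly" assume "P \<in> irred_deg d"
      then have "degree P = d" by (simp add: irred_deg_def)
      moreover have "\<bar>poly_legendre D P ^ k\<bar> \<le> 1" for k
        by (intro sign_abs_le sign_power poly_legendre_values)
      ultimately show "\<bar>?f P\<bar> \<le> int d"
        by (simp add: abs_mult mult_left_le)
    qed
    also have "\<dots> = int (d * card (irred_deg d :: 'a poly set))" by simp
    also have "\<dots> \<le> int (CARD('a) ^ d)" unfolding of_nat_le_iff by (rule card_irred_deg)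
    finally show "\<bar>\<Sum>P\<in>irred_deg d. ?f P\<bar> \<le> int (CARD('a) ^ d)" .
  qed
  also have "\<dots> = int (\<Sum>d\<in>T. CARD('a) ^ d)" by simp
  also have "\<dots> \<le> int ((if even r then CARD('a) ^ (r div 2) else 0) + 2 * CARD('a) ^ (r div 3))"
    unfolding of_nat_le_iff
  proof -
    let ?H = "if even r then {r div 2} else {}"
    have "T \<subseteq> ?H \<union> {1..r div 3}"
    proof
      fix d assume d: "d \<in> T"
      then obtain k where k: "r = d * k" by (auto simp: T_def)
      have "k \<noteq> 0" "k \<noteq> 1" using d r k by (auto simp: T_def)
      then consider "k = 2" | "k \<ge> 3" by linarith
      then show "d \<in> ?H \<union> {1..r div 3}"
      proof cases
        case 1
        then show ?thesis using k by simp
      next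
        case 2
        then have "d * 3 \<le> r" unfolding k by simp
        then have "d \<le> r div 3" by linarith
        then show ?thesis using T0[OF d] by simp
      qed
    qed
    then have "(\<Sum>d\<in>T. CARD('a) ^ d) \<le> (\<Sum>d\<in>?H \<union> {1..r div 3}. CARD('a) ^ d)"
      by (intro sum_mono2) auto
    also have "\<dots> \<le> (\<Sum>d\<in>?H. CARD('a) ^ d) + (\<Sum>d=1..r div 3. CARD('a) ^ d)"
      by (cases "even r") (simp_all add: sum.insert_if)
    also have "\<dots> \<le> (if even r then CARD('a) ^ (r div 2) else 0) + 2 * CARD('a) ^ (r div 3)"
      using sum_powers_le[OF q, of "r div 3"] by simp
    finally show "(\<Sum>d\<in>T. CARD('a) ^ d) \<le> (if even r then CARD('a) ^ (r div 2) else 0) + 2 * CARD('a) ^ (r div 3)" .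
  qed
  finally show ?thesis unfolding eq .
qed

lemma norm_prod_one_minus_le:
  assumes K: "K \<ge> 1" and A: "\<And>\<alpha>. \<alpha> \<in># A \<Longrightarrow> norm (\<alpha> * u) \<le> 1"
  shows "norm (\<Prod>\<alpha>\<in>#A. 1 - \<alpha> * u) \<le>
    exp (real (size A) / real K - Re (\<Sum>m=1..K. of_real (wt K m / real m) * ((\<Sum>\<alpha>\<in>#A. \<alpha> ^ m) * u ^ m)))"
  using A
proof (induction A)
  case (add \<alpha> A)
  have "norm (\<Prod>\<alpha>\<in>#add_mset \<alpha> A. 1 - \<alpha> * u) = norm (1 - \<alpha> * u) * norm (\<Prod>\<alpha>\<in>#A. 1 - \<alpha> * u)"
    by (simp add: norm_mult)
  also have "\<dots> \<le> exp (1 / real K - Re (Hsum K (\<alpha> * u))) *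
    exp (real (size A) / real K - Re (\<Sum>m=1..K. of_real (wt K m / real m) * ((\<Sum>\<alpha>\<in>#A. \<alpha> ^ m) * u ^ m)))"
    using add by (intro mult_mono norm_one_minus_le K) auto
  also have "\<dots> = exp (1 / real K - Re (Hsum K (\<alpha> * u)) +
    (real (size A) / real K - Re (\<Sum>m=1..K. of_real (wt K m / real m) * ((\<Sum>\<alpha>\<in>#A. \<alpha> ^ m) * u ^ m))))"
    by (rule exp_add[symmetric])
  also have "1 / real K - Re (Hsum K (\<alpha> * u)) +
    (real (size A) / real K - Re (\<Sum>m=1..K. of_real (wt K m / real m) * ((\<Sum>\<alpha>\<in>#A. \<alpha> ^ m) * u ^ m))) =
    real (size (add_mset \<alpha> A)) / real K - (Re (Hsum K (\<alpha> * u)) +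
      Re (\<Sum>m=1..K. of_real (wt K m / real m) * ((\<Sum>\<alpha>\<in>#A. \<alpha> ^ m) * u ^ m)))"
    by (simp add: add_divide_distrib)
  also have "Re (Hsum K (\<alpha> * u)) + Re (\<Sum>m=1..K. of_real (wt K m / real m) * ((\<Sum>\<alpha>\<in>#A. \<alpha> ^ m) * u ^ m)) =
    Re (\<Sum>m=1..K. of_real (wt K m / real m) * ((\<Sum>\<alpha>\<in>#add_mset \<alpha> A. \<alpha> ^ m) * u ^ m))"
    unfolding plus_complex.sel(1)[symmetric] Hsum_def sum.distrib[symmetric]
    by (rule arg_cong[of _ _ Re], rule sum.cong[OF refl]) (simp add: power_mult_distrib distrib_left distrib_right)
  finally show ?case .
qed simp

text \<open>Twice the sum of the geometric series of ratio q^(-1/6), which bounds the contribution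
  of the higher powers of primes on the critical circle.\<close>

definition tail_const :: "real \<Rightarrow> real" where
  "tail_const q = 2 / (1 - q powr (- 1 / 6))"

text \<open>Each of the fewer than \<open>n\<close> factors 1 - \<alpha> u costs 1 / K, and the
  power sums of the inverse roots are turned into sums over primes. Only an upper bound can hold, as
  the L-function may vanish on the circle.\<close>

lemma L_fun_bound:
  fixes D :: "'a::{field,finite} poly"
  assumes odd: "odd CARD('a)" and D: "D \<in> monic_squarefree n" and n: "n > 0"
    and K: "K \<ge> 1" and u: "norm u = real CARD('a) powr (- 1 / 2)"
  shows "norm (L_fun D u) \<le> exp (real n / real K + (1 + ln (real K)) / 2 + tail_const (real CARD('a)) +
    (\<Sum>P\<in>irred_le K. wt K (degree P) * Re (u ^ degree P) * real_of_int (poly_legendre D P)))"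
proof -
  let ?q = "real CARD('a)"
  define b where "b = ?q powr (- 1 / 6)"
  have q: "?q > 1" using card_gt_1[where 'a='a] by simp
  have b: "0 < b" "b < 1" unfolding b_def using q powr_less_mono[of "- 1 / 6" 0 ?q] by auto
  obtain A where A: "size A \<le> n - 1" "\<And>u. L_fun D u = (\<Prod>\<alpha>\<in>#A. 1 - \<alpha> * u)"
    "\<And>r. r > 0 \<Longrightarrow> of_int (psum D r) = - (\<Sum>\<alpha>\<in>#A. \<alpha> ^ r)"
    "\<And>\<alpha>. \<alpha> \<in># A \<Longrightarrow> norm \<alpha> \<le> sqrt ?q"
    using L_poly_RH[OF odd D n] by blast
  have au: "norm (\<alpha> * u) \<le> 1" if "\<alpha> \<in># A" for \<alpha>
  proof -
    have "norm (\<alpha> * u) \<le> sqrt ?q * ?q powr (- 1 / 2)"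
      unfolding norm_mult u by (intro mult_right_mono A(4) that) simp
    also have "\<dots> = 1" using q by (simp add: powr_half_sqrt[symmetric] flip: powr_add)
    finally show ?thesis .
  qed
  have un: "norm (u ^ m) = ?q powr (- real m / 2)" for m
    unfolding norm_power u using q by (simp add: powr_powr flip: powr_realpow)
  let ?E = "\<lambda>m. psum D m - int m * (\<Sum>P\<in>irred_deg m. poly_legendre D P)"
  have tm: "wt K m / real m * (real_of_int (psum D m) * Re (u ^ m)) \<le>
      (\<Sum>P\<in>irred_deg m. wt K (degree P) * Re (u ^ degree P) * real_of_int (poly_legendre D P)) +
      ((if even m then 1 / real m else 0) + 2 * b ^ m)" if m: "m \<in> {1..K}" for m
  proof -
    have m0: "m > 0" using m by simp
    have w: "0 \<le> wt K m" "wt K m \<le> 1" using wt_bounds m by auto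
    have main: "(\<Sum>P\<in>irred_deg m. wt K (degree P) * Re (u ^ degree P) * real_of_int (poly_legendre D P)) =
        wt K m / real m * (real m * (\<Sum>P\<in>irred_deg m. real_of_int (poly_legendre D P)) * Re (u ^ m))"
      using m0 unfolding sum_distrib_left sum_distrib_right
      by (intro sum.cong refl) (simp add: irred_deg_def)
    have "wt K m / real m * (real_of_int (psum D m) * Re (u ^ m)) -
      (\<Sum>P\<in>irred_deg m. wt K (degree P) * Re (u ^ degree P) * real_of_int (poly_legendre D P))
      = wt K m / real m * (real_of_int (?E m) * Re (u ^ m))"
      unfolding main by (simp add: algebra_simps)
    also have "\<dots> \<le> wt K m / real m * (real_of_int \<bar>?E m\<bar> * norm (u ^ m))"
    proof (rule mult_left_mono)
      have "real_of_int (?E m) * Re (u ^ m) \<le> \<bar>real_of_int (?E m) * Re (u ^ m)\<bar>" by simp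
      also have "\<dots> = real_of_int \<bar>?E m\<bar> * \<bar>Re (u ^ m)\<bar>" by (simp add: abs_mult)
      also have "\<dots> \<le> real_of_int \<bar>?E m\<bar> * norm (u ^ m)" by (intro mult_left_mono abs_Re_le_cmod) simp
      finally show "real_of_int (?E m) * Re (u ^ m) \<le> real_of_int \<bar>?E m\<bar> * norm (u ^ m)" .
    qed (use w in simp)
    also have "\<dots> \<le> 1 / real m * (real_of_int \<bar>?E m\<bar> * norm (u ^ m))"
      using w by (intro mult_right_mono divide_right_mono) auto
    also have "\<dots> \<le> 1 / real m * (real ((if even m then CARD('a) ^ (m div 2) else 0) + 2 * CARD('a) ^ (m div 3)) * norm (u ^ m))"
    proof (intro mult_left_mono mult_right_mono)
      have "real_of_int \<bar>?E m\<bar> \<le> real_of_int (int ((if even m then CARD('a) ^ (m div 2) else 0) + 2 * CARD('a) ^ (m div 3)))"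
        unfolding of_int_le_iff by (rule psum_prime_part[OF m0])
      then show "real_of_int \<bar>?E m\<bar> \<le> real ((if even m then CARD('a) ^ (m div 2) else 0) + 2 * CARD('a) ^ (m div 3))"
        by (simp only: of_int_of_nat_eq)
    qed auto
    also have "\<dots> = 1 / real m * ((if even m then ?q ^ (m div 2) else 0) * norm (u ^ m)) +
        1 / real m * (2 * (?q ^ (m div 3) * norm (u ^ m)))"
      by (simp add: algebra_simps)
    \<comment> \<open>On the circle u^m has norm q^(-m/2), so the squares of primes give at most 1 /
      m and the rest is bounded by the geometric term.\<close>
    also have "\<dots> \<le> (if even m then 1 / real m else 0) + 2 * b ^ m"
    proof (rule add_mono)
      show "1 / real m * ((if even m then ?q ^ (m div 2) else 0) * norm (u ^ m)) \<le> (if even m then 1 / real m else 0)"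
      proof (cases "even m")
        case True
        then have "?q ^ (m div 2) = ?q powr (real m / 2)"
          using q by (auto elim!: evenE simp: powr_realpow)
        then have "?q ^ (m div 2) * norm (u ^ m) = 1"
          unfolding un using q by (simp flip: powr_add)
        with True show ?thesis by simp
      qed simp
      have "?q ^ (m div 3) = ?q powr real (m div 3)" using q by (simp add: powr_realpow)
      also have "\<dots> \<le> ?q powr (real m / 3)" using q by (intro powr_mono) linarith+
      finally have "?q ^ (m div 3) * norm (u ^ m) \<le> ?q powr (real m / 3) * ?q powr (- real m / 2)"
        unfolding un by (rule mult_right_mono) simp
      also have "\<dots> = ?q powr (- 1 / 6 * real m)" by (simp flip: powr_add)
      also have "\<dots> = b ^ m" unfolding b_def using q by (simp add: powr_powr flip: powr_realpow)
      finally have *: "?q ^ (m div 3) * norm (u ^ m) \<le> b ^ m" .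
      have "1 / real m * (2 * (?q ^ (m div 3) * norm (u ^ m))) \<le> 1 * (2 * (?q ^ (m div 3) * norm (u ^ m)))"
        using m0 by (intro mult_right_mono) auto
      with * show "1 / real m * (2 * (?q ^ (m div 3) * norm (u ^ m))) \<le> 2 * b ^ m" by simp
    qed
    finally show ?thesis by simp
  qed
  have geo: "(\<Sum>m=1..K. 2 * b ^ m) \<le> tail_const ?q"
  proof -
    have "(\<Sum>m=1..K. b ^ m) \<le> (\<Sum>m. b ^ m)"
      using b by (intro sum_le_suminf summable_geometric) auto
    also have "\<dots> = 1 / (1 - b)" using b by (intro suminf_geometric) simp
    finally show ?thesis unfolding tail_const_def b_def[symmetric] sum_distrib_left[symmetric] by simp
  qed
  have "norm (L_fun D u) \<le> exp (real (size A) / real K -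
      Re (\<Sum>m=1..K. of_real (wt K m / real m) * ((\<Sum>\<alpha>\<in>#A. \<alpha> ^ m) * u ^ m)))"
    unfolding A(2) by (rule norm_prod_one_minus_le[OF K au])
  also have "- Re (\<Sum>m=1..K. of_real (wt K m / real m) * ((\<Sum>\<alpha>\<in>#A. \<alpha> ^ m) * u ^ m)) =
      (\<Sum>m=1..K. wt K m / real m * (real_of_int (psum D m) * Re (u ^ m)))"
    unfolding Re_sum sum_negf[symmetric]
  proof (rule sum.cong[OF refl])
    fix m assume "m \<in> {1..K}"
    then have "(\<Sum>\<alpha>\<in>#A. \<alpha> ^ m) = - of_int (psum D m)" using A(3)[of m] by simp
    moreover have "- Re (of_real w * (- of_int p * v)) = w * (real_of_int p * Re v)" for w p v by simp
    ultimately show "- Re (of_real (wt K m / real m) * ((\<Sum>\<alpha>\<in>#A. \<alpha> ^ m) * u ^ m)) =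
      wt K m / real m * (real_of_int (psum D m) * Re (u ^ m))" by simp
  qed
  then have "exp (real (size A) / real K - Re (\<Sum>m=1..K. of_real (wt K m / real m) * ((\<Sum>\<alpha>\<in>#A. \<alpha> ^ m) * u ^ m)))
    = exp (real (size A) / real K + (\<Sum>m=1..K. wt K m / real m * (real_of_int (psum D m) * Re (u ^ m))))"
    by (simp only: diff_conv_add_uminus)
  also have "\<dots> \<le> exp (real n / real K + (1 + ln (real K)) / 2 + tail_const ?q +
    (\<Sum>P\<in>irred_le K. wt K (degree P) * Re (u ^ degree P) * real_of_int (poly_legendre D P)))"
    unfolding exp_le_cancel_iff
  proof -
    have "(\<Sum>m=1..K. wt K m / real m * (real_of_int (psum D m) * Re (u ^ m))) \<le>
      (\<Sum>m=1..K. (\<Sum>P\<in>irred_deg m. wt K (degree P) * Re (u ^ degree P) * real_of_int (poly_legendre D P)) +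
      ((if even m then 1 / real m else 0) + 2 * b ^ m))"
      by (rule sum_mono) (rule tm)
    also have "\<dots> = (\<Sum>P\<in>irred_le K. wt K (degree P) * Re (u ^ degree P) * real_of_int (poly_legendre D P)) +
      ((\<Sum>m=1..K. if even m then 1 / real m else 0) + (\<Sum>m=1..K. 2 * b ^ m))"
      by (simp only: sum.distrib sum_irred_le)
    finally have "(\<Sum>m=1..K. wt K m / real m * (real_of_int (psum D m) * Re (u ^ m))) \<le>
      (\<Sum>P\<in>irred_le K. wt K (degree P) * Re (u ^ degree P) * real_of_int (poly_legendre D P)) +
      ((1 + ln (real K)) / 2 + tail_const ?q)"
      using geo sum_even_inverse[OF K] by linarith
    moreover have "real (size A) / real K \<le> real n / real K"
      using A(1) n by (intro divide_right_mono) auto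
    ultimately show "real (size A) / real K + (\<Sum>m=1..K. wt K m / real m * (real_of_int (psum D m) * Re (u ^ m)))
      \<le> real n / real K + (1 + ln (real K)) / 2 + tail_const ?q +
      (\<Sum>P\<in>irred_le K. wt K (degree P) * Re (u ^ degree P) * real_of_int (poly_legendre D P))"
      by linarith
  qed
  finally show ?thesis .
qed

section \<open>Moments of prime sums\<close>

lemma two_power_fact_le: "2 ^ k * fact k \<le> (fact (2 * k) :: real)"
proof (induction k)
  case (Suc k)
  have "2 ^ Suc k * fact (Suc k) = (2 * real (Suc k)) * (2 ^ k * fact k :: real)" by (simp add: algebra_simps)
  also have "\<dots> \<le> (2 * real (Suc k)) * fact (2 * k)" by (intro mult_left_mono Suc) simp
  also have "\<dots> \<le> (2 * real (Suc k)) * (real (2 * k + 1) * fact (2 * k))"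
    by (intro mult_left_mono) (auto simp: mult_le_cancel_right1)
  also have "\<dots> = fact (2 * Suc k)" by (simp add: algebra_simps)
  finally show ?case .
qed simp

lemma cosh_le_exp_half_square: "cosh (x :: real) \<le> exp (x\<^sup>2 / 2)"
proof -
  have "(\<lambda>n. if even n then x ^ n /\<^sub>R fact n else 0) sums cosh x" by (rule cosh_converges)
  then have "(\<lambda>k. (\<lambda>n. if even n then x ^ n /\<^sub>R fact n else 0) (2 * k)) sums cosh x"
    by (subst sums_mono_reindex) (auto simp: strict_mono_def elim!: evenE)
  then have c: "(\<lambda>k. x ^ (2 * k) / fact (2 * k)) sums cosh x" by (simp add: divide_inverse mult.commute)
  have e: "(\<lambda>k. (x\<^sup>2 / 2) ^ k / fact k) sums exp (x\<^sup>2 / 2)"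
  proof -
    have "(\<lambda>k. (x\<^sup>2 / 2) ^ k /\<^sub>R fact k) = (\<lambda>k. (x\<^sup>2 / 2) ^ k / fact k)"
      by (rule ext) (simp only: scaleR_conv_of_real divide_inverse of_real_eq_id id_apply mult.commute)
    with exp_converges[of "x\<^sup>2 / 2"] show ?thesis by simp
  qed
  show ?thesis
  proof (rule sums_le[OF _ c e])
    fix k
    have "x ^ (2 * k) / fact (2 * k) \<le> x ^ (2 * k) / (2 ^ k * fact k)"
      using two_power_fact_le by (intro divide_left_mono) (auto simp: power_mult)
    also have "\<dots> = (x\<^sup>2 / 2) ^ k / fact k" by (simp add: power_mult power_divide)
    finally show "x ^ (2 * k) / fact (2 * k) \<le> (x\<^sup>2 / 2) ^ k / fact k" .
  qed
qed

text \<open>A polynomial of degree at most \<open>N\<close>, so its mean involves only moments of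
  order up to \<open>N\<close>. Keeping just the even terms makes it nonnegative, so a sum of it
  over a set of \<open>D\<close> can be extended to all monic \<open>D\<close>.\<close>

definition ctrunc :: "nat \<Rightarrow> real \<Rightarrow> real" where
  "ctrunc N x = (\<Sum>m\<le>N. if even m then x ^ m / fact m else 0)"

lemma cosh_series: "(\<lambda>m. if even m then x ^ m / fact m else 0) sums cosh (x :: real)"
proof -
  have "(\<lambda>n. if even n then x ^ n /\<^sub>R fact n else 0) = (\<lambda>m. if even m then x ^ m / fact m else 0)"
    by (rule ext) (auto simp: divide_inverse)
  with cosh_converges[of x] show ?thesis by simp
qed

lemma ctrunc_nonneg: "ctrunc N x \<ge> 0"
  unfolding ctrunc_def by (intro sum_nonneg) (auto simp: zero_le_even_power)

lemma ctrunc_le_cosh: "ctrunc N x \<le> cosh x"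
  unfolding ctrunc_def sums_unique[OF cosh_series]
  by (intro sum_le_suminf sums_summable[OF cosh_series]) (auto simp: zero_le_even_power)

lemma ctrunc_ge_term: "even m \<Longrightarrow> m \<le> N \<Longrightarrow> x ^ m / fact m \<le> ctrunc N x"
proof -
  assume m: "even m" "m \<le> N"
  have "(if even m then x ^ m / fact m else 0) \<le> ctrunc N x"
    unfolding ctrunc_def by (rule member_le_sum) (use m in \<open>auto simp: zero_le_even_power\<close>)
  with m show ?thesis by simp
qed

text \<open>The tail of the series of \<^term>\<open>cosh x\<close> beyond \<^term>\<open>N\<close> is at most
  \<^term>\<open>exp (- N)\<close> times the series at \<^term>\<open>exp 1 * x\<close>.\<close>

lemma exp_le_ctrunc:
  assumes "3 * \<bar>x\<bar> \<le> real N"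
  shows "exp x \<le> 2 * ctrunc N x + 2"
proof -
  let ?e = "exp 1 :: real"
  have "(\<lambda>m. (if m \<in> {..N} then (if even m then x ^ m / fact m else 0) else 0)) sums ctrunc N x"
    unfolding ctrunc_def by (rule sums_If_finite_set) simp
  moreover have "(\<lambda>m. exp (- real N) * (if even m then (?e * x) ^ m / fact m else 0)) sums (exp (- real N) * cosh (?e * x))"
    by (rule sums_mult[OF cosh_series])
  ultimately have "(\<lambda>m. (if m \<in> {..N} then (if even m then x ^ m / fact m else 0) else 0) +
     exp (- real N) * (if even m then (?e * x) ^ m / fact m else 0)) sums (ctrunc N x + exp (- real N) * cosh (?e * x))"
    by (rule sums_add)
  with cosh_series[of x] have "cosh x \<le> ctrunc N x + exp (- real N) * cosh (?e * x)"
  proof (rule sums_le[rotated])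
    fix m
    have nn: "(if even m then y ^ m / fact m else 0) \<ge> 0" for y :: real by (auto simp: zero_le_even_power)
    show "(if even m then x ^ m / fact m else 0) \<le> (if m \<in> {..N} then (if even m then x ^ m / fact m else 0) else 0) +
      exp (- real N) * (if even m then (?e * x) ^ m / fact m else 0)"
    proof (cases "m \<le> N")
      case True
      then show ?thesis using nn[of "?e * x"] by (simp add: mult_nonneg_nonneg)
    next
      case False
      have "1 \<le> exp (real m - real N)" using False by simp
      also have "\<dots> = exp (- real N) * ?e ^ m" by (simp add: exp_diff exp_minus divide_inverse flip: exp_of_nat_mult)
      finally have "1 * (if even m then x ^ m / fact m else 0) \<le> exp (- real N) * ?e ^ m * (if even m then x ^ m / fact m else 0)"
        by (rule mult_right_mono[OF _ nn])
      then show ?thesis using False by (simp add: power_mult_distrib split: if_splits)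
    qed
  qed
  also have "exp (- real N) * cosh (?e * x) \<le> 1"
  proof -
    have "cosh (?e * x) \<le> exp \<bar>?e * x\<bar>"
    proof -
      have "cosh y \<le> exp \<bar>y\<bar>" for y :: real
      proof -
        have "exp y \<le> exp \<bar>y\<bar>" "exp (- y) \<le> exp \<bar>y\<bar>" by simp_all
        moreover have "(a + b) / 2 \<le> c" if "a \<le> c" "b \<le> c" for a b c :: real using that by simp
        ultimately show ?thesis unfolding cosh_field_def by blast
      qed
      then show ?thesis .
    qed
    also have "\<bar>?e * x\<bar> \<le> 3 * \<bar>x\<bar>" using exp_le by (simp add: abs_mult mult_right_mono)
    then have "exp \<bar>?e * x\<bar> \<le> exp (real N)" using assms by simp
    finally have "exp (- real N) * cosh (?e * x) \<le> exp (- real N) * exp (real N)" by (intro mult_left_mono) auto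
    then show ?thesis by (simp flip: exp_add)
  qed
  finally have "2 * cosh x \<le> 2 * ctrunc N x + 2" by simp
  moreover have "exp x \<le> 2 * cosh x" by (simp add: cosh_field_def)
  ultimately show ?thesis by linarith
qed

section \<open>Means over independent random signs\<close>

definition rademacher :: "'b set \<Rightarrow> (('b \<Rightarrow> real) \<Rightarrow> real) \<Rightarrow> real" where
  "rademacher S F = (\<Sum>\<epsilon>\<in>PiE S (\<lambda>_. {-1, 1}). F \<epsilon>) / 2 ^ card S"

lemma rademacher_mono:
  "(\<And>\<epsilon>. F \<epsilon> \<le> G \<epsilon>) \<Longrightarrow> rademacher S F \<le> rademacher S G"
  unfolding rademacher_def by (intro divide_right_mono sum_mono) auto

lemma rademacher_sum: "rademacher S (\<lambda>\<epsilon>. \<Sum>i\<in>I. F i \<epsilon>) = (\<Sum>i\<in>I. rademacher S (F i))"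
  unfolding rademacher_def sum_divide_distrib[symmetric] by (subst sum.swap) simp

lemma rademacher_cmult: "rademacher S (\<lambda>\<epsilon>. c * F \<epsilon>) = c * rademacher S F"
  unfolding rademacher_def by (simp add: sum_distrib_left)

lemma rademacher_prod:
  assumes "finite S"
  shows "rademacher S (\<lambda>\<epsilon>. \<Prod>P\<in>S. f P (\<epsilon> P)) = (\<Prod>P\<in>S. (f P (-1) + f P 1) / 2)"
proof -
  have "(\<Sum>\<epsilon>\<in>PiE S (\<lambda>_. {-1, 1}). \<Prod>P\<in>S. f P (\<epsilon> P)) = (\<Prod>P\<in>S. \<Sum>e\<in>{-1, 1}. f P e)"
    by (rule prod_sum_PiE[symmetric]) (use assms in auto)
  then show ?thesis unfolding rademacher_def by (simp add: prod_dividef)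
qed

lemma rademacher_exp:
  assumes "finite S"
  shows "rademacher S (\<lambda>\<epsilon>. exp (\<Sum>P\<in>S. a P * \<epsilon> P)) \<le> exp ((\<Sum>P\<in>S. (a P)\<^sup>2) / 2)"
proof -
  have "rademacher S (\<lambda>\<epsilon>. exp (\<Sum>P\<in>S. a P * \<epsilon> P)) = (\<Prod>P\<in>S. (exp (a P * (-1)) + exp (a P * 1)) / 2)"
    unfolding exp_sum[OF assms] by (rule rademacher_prod[OF assms])
  also have "\<dots> = (\<Prod>P\<in>S. cosh (a P))" by (simp add: cosh_field_def add.commute)
  also have "\<dots> \<le> (\<Prod>P\<in>S. exp ((a P)\<^sup>2 / 2))"
    by (intro prod_mono conjI cosh_le_exp_half_square) (simp add: cosh_real_nonneg)
  also have "\<dots> = exp ((\<Sum>P\<in>S. (a P)\<^sup>2) / 2)"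
    by (simp add: exp_sum[OF assms] sum_divide_distrib)
  finally show ?thesis .
qed

lemma rademacher_cosh:
  assumes "finite S"
  shows "rademacher S (\<lambda>\<epsilon>. cosh (\<Sum>P\<in>S. a P * \<epsilon> P)) \<le> exp ((\<Sum>P\<in>S. (a P)\<^sup>2) / 2)"
proof -
  have "cosh (\<Sum>P\<in>S. a P * \<epsilon> P) = (\<Sum>s\<in>{-1, 1}. (1 / 2) * exp (\<Sum>P\<in>S. (s * a P) * \<epsilon> P))" for \<epsilon> :: "'a \<Rightarrow> real"
    by (simp add: cosh_field_def sum_negf)
  then have "rademacher S (\<lambda>\<epsilon>. cosh (\<Sum>P\<in>S. a P * \<epsilon> P)) =
      (\<Sum>s\<in>{-1, 1}. (1 / 2) * rademacher S (\<lambda>\<epsilon>. exp (\<Sum>P\<in>S. (s * a P) * \<epsilon> P)))"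
    by (simp only: rademacher_sum rademacher_cmult)
  also have "\<dots> \<le> (\<Sum>s\<in>{-1, 1::real}. (1 / 2) * exp ((\<Sum>P\<in>S. (s * a P)\<^sup>2) / 2))"
    by (intro sum_mono mult_left_mono rademacher_exp assms) simp
  also have "\<dots> = exp ((\<Sum>P\<in>S. (a P)\<^sup>2) / 2)" by simp
  finally show ?thesis .
qed

section \<open>Comparison of prime sums with random signs\<close>

lemma power_sum_PiE:
  fixes f :: "'b \<Rightarrow> 'c::comm_semiring_1" and j :: nat
  assumes "finite S"
  shows "(\<Sum>P\<in>S. f P) ^ j = (\<Sum>g\<in>PiE {..<j} (\<lambda>_. S). \<Prod>i<j. f (g i))"
  using prod_sum_PiE[of "{..<j}" "\<lambda>_. S" "\<lambda>_. f"] assms by simp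

lemma prod_tuple_group:
  fixes h :: "'b \<Rightarrow> 'c::comm_monoid_mult" and j :: nat
  assumes "finite T" "g ` {..<j} \<subseteq> T"
  shows "(\<Prod>i<j. h (g i)) = (\<Prod>P\<in>T. h P ^ card {i \<in> {..<j}. g i = P})"
proof -
  have "(\<Prod>P\<in>T. \<Prod>i\<in>{i \<in> {..<j}. g i = P}. h (g i)) = (\<Prod>i<j. h (g i))"
    by (rule prod.group) (use assms in auto)
  moreover have "(\<Prod>i\<in>{i \<in> {..<j}. g i = P}. h (g i)) = h P ^ card {i \<in> {..<j}. g i = P}" for P
  proof -
    have "(\<Prod>i\<in>{i \<in> {..<j}. g i = P}. h (g i)) = (\<Prod>i\<in>{i \<in> {..<j}. g i = P}. h P)"
      by (rule prod.cong) auto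
    then show ?thesis by simp
  qed
  ultimately show ?thesis by simp
qed

text \<open>If some prime occurs an odd number of times, the sum over \<open>D\<close> vanishes: the
  distinct primes of the tuple have total degree at most j y \<le> n. Otherwise the product of the
  random signs is identically 1 and the trivial bound suffices.\<close>

lemma legendre_tuple_moment:
  fixes S :: "'a::{field,finite} poly set"
  assumes odd: "odd CARD('a)" and S: "finite S" "S \<subseteq> monic_irred" and y: "\<And>P. P \<in> S \<Longrightarrow> degree P \<le> y"
    and g: "g \<in> PiE {..<j} (\<lambda>_. S)" and j: "j * y \<le> n"
  shows "\<bar>\<Sum>D\<in>monic_deg n. \<Prod>i<j. real_of_int (poly_legendre D (g i))\<bar> \<le>
    real CARD('a) ^ n * rademacher S (\<lambda>\<epsilon>. \<Prod>i<j. \<epsilon> (g i))"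
proof -
  let ?c = "\<lambda>P. card {i \<in> {..<j}. g i = P}"
  have gS: "g ` {..<j} \<subseteq> S" using g by (auto simp: PiE_iff)
  have R: "rademacher S (\<lambda>\<epsilon>. \<Prod>i<j. \<epsilon> (g i)) = (\<Prod>P\<in>S. ((-1) ^ ?c P + 1 ^ ?c P) / 2)"
    unfolding prod_tuple_group[OF S(1) gS] by (rule rademacher_prod[OF S(1)])
  show ?thesis
  proof (cases "\<exists>Q\<in>S. odd (?c Q)")
    case True
    then obtain Q where Q: "Q \<in> S" "odd (?c Q)" by blast
    let ?T = "g ` {..<j}"
    have "{i \<in> {..<j}. g i = Q} \<noteq> {}"
    proof
      assume "{i \<in> {..<j}. g i = Q} = {}"
      with Q(2) show False by (simp only: card.empty) simp
    qed
    then have QT: "Q \<in> ?T" by blast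
    have "(\<Sum>P\<in>?T. degree P) \<le> card ?T * y"
      using sum_bounded_above[of ?T degree y] y gS by auto
    also have "\<dots> \<le> j * y" using card_image_le[of "{..<j}" g] by simp
    finally have deg: "(\<Sum>P\<in>?T. degree P) \<le> n" using j by simp
    have "(\<Sum>D\<in>monic_deg n. \<Prod>P\<in>?T. poly_legendre D P ^ ?c P) = 0"
      by (rule sum_monic_deg_legendre_eq_0[where e = ?c, OF odd _ _ QT Q(2) deg]) (use gS S in auto)
    then have "(\<Sum>D\<in>monic_deg n. \<Prod>i<j. poly_legendre D (g i)) = 0"
      by (subst prod_tuple_group[of ?T]) simp_all
    then have "real_of_int (\<Sum>D\<in>monic_deg n. \<Prod>i<j. poly_legendre D (g i)) = 0" by (simp only: of_int_0)
    then have "(\<Sum>D\<in>monic_deg n. \<Prod>i<j. real_of_int (poly_legendre D (g i))) = 0"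
      by (simp only: of_int_sum of_int_prod)
    moreover have "rademacher S (\<lambda>\<epsilon>. \<Prod>i<j. \<epsilon> (g i)) \<ge> 0"
      unfolding R by (intro prod_nonneg) (auto simp: minus_one_power_iff)
    ultimately show ?thesis by simp
  next
    case False
    then have "rademacher S (\<lambda>\<epsilon>. \<Prod>i<j. \<epsilon> (g i)) = 1" unfolding R by simp
    moreover have "\<bar>\<Sum>D\<in>monic_deg n. \<Prod>i<j. real_of_int (poly_legendre D (g i))\<bar> \<le> (\<Sum>D\<in>(monic_deg n :: 'a poly set). 1)"
    proof (rule order_trans[OF sum_abs], rule sum_mono)
      fix D :: "'a poly"
      have "\<bar>\<Prod>i<j. poly_legendre D (g i)\<bar> \<le> 1"
        by (intro sign_abs_le sign_prod poly_legendre_values)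
      then have "real_of_int \<bar>\<Prod>i<j. poly_legendre D (g i)\<bar> \<le> real_of_int 1" unfolding of_int_le_iff .
      then show "\<bar>\<Prod>i<j. real_of_int (poly_legendre D (g i))\<bar> \<le> 1" by simp
    qed
    ultimately show ?thesis by (simp add: card_monic_deg)
  qed
qed

text \<open>Both sides are expanded over j-tuples of primes. Absolute values of the coefficients
  stand on the right, since tuples with all multiplicities even are only bounded, not evaluated: a
  symbol vanishes where the prime divides \<open>D\<close>.\<close>

lemma legendre_moment:
  fixes S :: "'a::{field,finite} poly set"
  assumes odd: "odd CARD('a)" and S: "finite S" "S \<subseteq> monic_irred" and y: "\<And>P. P \<in> S \<Longrightarrow> degree P \<le> y"
    and j: "j * y \<le> n"
  shows "(\<Sum>D\<in>monic_deg n. (\<Sum>P\<in>S. b P * real_of_int (poly_legendre D P)) ^ j) \<le>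
    real CARD('a) ^ n * rademacher S (\<lambda>\<epsilon>. (\<Sum>P\<in>S. \<bar>b P\<bar> * \<epsilon> P) ^ j)"
proof -
  let ?G = "PiE {..<j} (\<lambda>_. S)"
  have "(\<Sum>D\<in>monic_deg n. (\<Sum>P\<in>S. b P * real_of_int (poly_legendre D P)) ^ j) =
      (\<Sum>g\<in>?G. (\<Prod>i<j. b (g i)) * (\<Sum>D\<in>monic_deg n. \<Prod>i<j. real_of_int (poly_legendre D (g i))))"
    unfolding power_sum_PiE[OF S(1)] prod.distrib sum_distrib_left by (rule sum.swap)
  also have "\<dots> \<le> (\<Sum>g\<in>?G. (\<Prod>i<j. \<bar>b (g i)\<bar>) * (real CARD('a) ^ n * rademacher S (\<lambda>\<epsilon>. \<Prod>i<j. \<epsilon> (g i))))"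
  proof (rule sum_mono)
    fix g assume g: "g \<in> ?G"
    let ?s = "\<Sum>D\<in>monic_deg n. \<Prod>i<j. real_of_int (poly_legendre D (g i))"
    have "(\<Prod>i<j. b (g i)) * ?s \<le> \<bar>(\<Prod>i<j. b (g i)) * ?s\<bar>" by simp
    also have "\<dots> = (\<Prod>i<j. \<bar>b (g i)\<bar>) * \<bar>?s\<bar>" by (simp add: abs_mult abs_prod)
    also have "\<dots> \<le> (\<Prod>i<j. \<bar>b (g i)\<bar>) * (real CARD('a) ^ n * rademacher S (\<lambda>\<epsilon>. \<Prod>i<j. \<epsilon> (g i)))"
      by (intro mult_left_mono legendre_tuple_moment[OF odd S y g j] prod_nonneg) auto
    finally show "(\<Prod>i<j. b (g i)) * ?s \<le> (\<Prod>i<j. \<bar>b (g i)\<bar>) * (real CARD('a) ^ n * rademacher S (\<lambda>\<epsilon>. \<Prod>i<j. \<epsilon> (g i)))" .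
  qed
  also have "\<dots> = real CARD('a) ^ n * rademacher S (\<lambda>\<epsilon>. (\<Sum>P\<in>S. \<bar>b P\<bar> * \<epsilon> P) ^ j)"
    unfolding power_sum_PiE[OF S(1)] prod.distrib rademacher_sum rademacher_cmult sum_distrib_left
    by (intro sum.cong refl) (simp only: mult.left_commute)
  finally show ?thesis .
qed

lemma legendre_ctrunc_moment:
  fixes S :: "'a::{field,finite} poly set"
  assumes odd: "odd CARD('a)" and S: "finite S" "S \<subseteq> monic_irred" and y: "\<And>P. P \<in> S \<Longrightarrow> degree P \<le> y"
    and N: "N * y \<le> n"
  shows "(\<Sum>D\<in>monic_deg n. ctrunc N (k * (\<Sum>P\<in>S. b P * real_of_int (poly_legendre D P)))) \<le>
    real CARD('a) ^ n * exp (k\<^sup>2 * (\<Sum>P\<in>S. (b P)\<^sup>2) / 2)"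
proof -
  let ?X = "\<lambda>D. \<Sum>P\<in>S. b P * real_of_int (poly_legendre D P)" and ?Y = "\<lambda>\<epsilon>. \<Sum>P\<in>S. \<bar>b P\<bar> * \<epsilon> P"
  have ct: "ctrunc N (k * x) = (\<Sum>m | m \<le> N \<and> even m. k ^ m / fact m * x ^ m)" for x
    unfolding ctrunc_def by (subst sum.inter_filter[symmetric]) (auto simp: power_mult_distrib intro!: sum.cong)
  have "(\<Sum>D\<in>monic_deg n. ctrunc N (k * ?X D)) = (\<Sum>m | m \<le> N \<and> even m. k ^ m / fact m * (\<Sum>D\<in>monic_deg n. ?X D ^ m))"
    unfolding ct by (subst sum.swap) (simp only: sum_distrib_left)
  also have "\<dots> \<le> (\<Sum>m | m \<le> N \<and> even m. k ^ m / fact m * (real CARD('a) ^ n * rademacher S (\<lambda>\<epsilon>. ?Y \<epsilon> ^ m)))"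
  proof (rule sum_mono, rule mult_left_mono)
    fix m assume m: "m \<in> {m. m \<le> N \<and> even m}"
    then have "m \<le> N" by simp
    then have my: "m * y \<le> n" by (rule order_trans[OF mult_le_mono1 N])
    show "(\<Sum>D\<in>monic_deg n. ?X D ^ m) \<le> real CARD('a) ^ n * rademacher S (\<lambda>\<epsilon>. ?Y \<epsilon> ^ m)"
      by (rule legendre_moment[OF odd S y my])
    show "0 \<le> k ^ m / fact m" using m by (simp add: zero_le_even_power)
  qed
  also have "\<dots> = real CARD('a) ^ n * rademacher S (\<lambda>\<epsilon>. ctrunc N (k * ?Y \<epsilon>))"
    unfolding ct rademacher_sum rademacher_cmult sum_distrib_left[of "real CARD('a) ^ n"]
    by (intro sum.cong refl) (simp only: mult.left_commute)
  also have "\<dots> \<le> real CARD('a) ^ n * exp (k\<^sup>2 * (\<Sum>P\<in>S. (b P)\<^sup>2) / 2)"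
  proof (rule mult_left_mono)
    have "rademacher S (\<lambda>\<epsilon>. ctrunc N (k * ?Y \<epsilon>)) \<le> rademacher S (\<lambda>\<epsilon>. cosh (\<Sum>P\<in>S. (k * \<bar>b P\<bar>) * \<epsilon> P))"
      by (rule rademacher_mono) (use ctrunc_le_cosh in \<open>simp add: sum_distrib_left mult.assoc\<close>)
    also have "\<dots> \<le> exp ((\<Sum>P\<in>S. (k * \<bar>b P\<bar>)\<^sup>2) / 2)" by (rule rademacher_cosh[OF S(1)])
    also have "(\<Sum>P\<in>S. (k * \<bar>b P\<bar>)\<^sup>2) = k\<^sup>2 * (\<Sum>P\<in>S. (b P)\<^sup>2)"
      by (simp add: power_mult_distrib sum_distrib_left)
    finally show "rademacher S (\<lambda>\<epsilon>. ctrunc N (k * ?Y \<epsilon>)) \<le> exp (k\<^sup>2 * (\<Sum>P\<in>S. (b P)\<^sup>2) / 2)" .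
  qed simp
  finally show ?thesis .
qed

text \<open>On \<open>G\<close> the exponent is small against \<open>N\<close>, so the exponential
  is dominated by the truncated cosh. Nonnegativity then permits replacing \<open>G\<close> by all
  monic polynomials of degree \<open>n\<close>.\<close>

lemma legendre_exp_moment:
  fixes S :: "'a::{field,finite} poly set"
  assumes odd: "odd CARD('a)" and S: "finite S" "S \<subseteq> monic_irred" and y: "\<And>P. P \<in> S \<Longrightarrow> degree P \<le> y"
    and N: "N * y \<le> n" and G: "G \<subseteq> monic_deg n"
    and small: "\<And>D. D \<in> G \<Longrightarrow> 3 * \<bar>k * (\<Sum>P\<in>S. b P * real_of_int (poly_legendre D P))\<bar> \<le> real N"
  shows "(\<Sum>D\<in>G. exp (k * (\<Sum>P\<in>S. b P * real_of_int (poly_legendre D P)))) \<le>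
    4 * real CARD('a) ^ n * exp (k\<^sup>2 * (\<Sum>P\<in>S. (b P)\<^sup>2) / 2)"
proof -
  let ?X = "\<lambda>D. \<Sum>P\<in>S. b P * real_of_int (poly_legendre D P)"
  let ?E = "exp (k\<^sup>2 * (\<Sum>P\<in>S. (b P)\<^sup>2) / 2)"
  have "(\<Sum>D\<in>G. exp (k * ?X D)) \<le> (\<Sum>D\<in>G. 2 * ctrunc N (k * ?X D) + 2)"
    by (intro sum_mono exp_le_ctrunc small)
  also have "\<dots> \<le> (\<Sum>D\<in>monic_deg n. 2 * ctrunc N (k * ?X D) + 2)"
    by (intro sum_mono2 G) (auto simp: ctrunc_nonneg add_nonneg_nonneg)
  also have "\<dots> = 2 * (\<Sum>D\<in>monic_deg n. ctrunc N (k * ?X D)) + 2 * real CARD('a) ^ n"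
    by (simp add: sum.distrib sum_distrib_left card_monic_deg)
  also have "\<dots> \<le> 2 * (real CARD('a) ^ n * ?E) + 2 * (real CARD('a) ^ n * ?E)"
  proof (intro add_mono mult_left_mono legendre_ctrunc_moment[OF odd S y N])
    have "0 \<le> k\<^sup>2 * (\<Sum>P\<in>S. (b P)\<^sup>2) / 2" by (simp add: sum_nonneg)
    then have "1 \<le> ?E" by simp
    then have "real CARD('a) ^ n * 1 \<le> real CARD('a) ^ n * ?E" by (rule mult_left_mono) simp
    then show "real CARD('a) ^ n \<le> real CARD('a) ^ n * ?E" by simp
  qed auto
  finally show ?thesis by simp
qed

text \<open>Chebyshev's inequality with the N-th moment, which is bounded by the whole truncated
  cosh at a free parameter \<open>k\<close>. A large \<open>k\<close> gains in the last factor and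
  pays in the exponential of the variance.\<close>

lemma legendre_tail:
  fixes S :: "'a::{field,finite} poly set"
  assumes odd: "odd CARD('a)" and S: "finite S" "S \<subseteq> monic_irred" and y: "\<And>P. P \<in> S \<Longrightarrow> degree P \<le> y"
    and N: "N * y \<le> n" "even N" and V: "V > 0" and k: "k > 0"
    and G: "G \<subseteq> monic_deg n" "\<And>D. D \<in> G \<Longrightarrow> V \<le> \<bar>\<Sum>P\<in>S. b P * real_of_int (poly_legendre D P)\<bar>"
  shows "real (card G) \<le> real CARD('a) ^ n * exp (k\<^sup>2 * (\<Sum>P\<in>S. (b P)\<^sup>2) / 2) * (real N / (k * V)) ^ N"
proof -
  let ?X = "\<lambda>D. \<Sum>P\<in>S. b P * real_of_int (poly_legendre D P)"
  let ?E = "exp (k\<^sup>2 * (\<Sum>P\<in>S. (b P)\<^sup>2) / 2)"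
  have kV: "(k * V) ^ N > 0" using k V by simp
  have "real (card G) * ((k * V) ^ N / fact N) = (\<Sum>D\<in>G. (k * V) ^ N / fact N)" by simp
  also have "\<dots> \<le> (\<Sum>D\<in>G. ctrunc N (k * ?X D))"
  proof (rule sum_mono)
    fix D assume D: "D \<in> G"
    have "(k * V) ^ N \<le> \<bar>k * ?X D\<bar> ^ N"
      using G(2)[OF D] k V by (intro power_mono) (auto simp: abs_mult)
    also have "\<dots> = (k * ?X D) ^ N" using N(2) by (rule power_even_abs)
    finally have "(k * V) ^ N / fact N \<le> (k * ?X D) ^ N / fact N" by (intro divide_right_mono) auto
    also have "\<dots> \<le> ctrunc N (k * ?X D)" by (rule ctrunc_ge_term[OF N(2) order_refl])
    finally show "(k * V) ^ N / fact N \<le> ctrunc N (k * ?X D)" .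
  qed
  also have "\<dots> \<le> (\<Sum>D\<in>monic_deg n. ctrunc N (k * ?X D))"
    by (intro sum_mono2 G(1)) (auto simp: ctrunc_nonneg)
  also have "\<dots> \<le> real CARD('a) ^ n * ?E" by (rule legendre_ctrunc_moment[OF odd S y N(1)])
  finally have "real (card G) * (k * V) ^ N \<le> real CARD('a) ^ n * ?E * fact N"
    by (simp add: divide_le_eq)
  also have "\<dots> \<le> real CARD('a) ^ n * ?E * real N ^ N"
    using fact_le_power[of N, where 'a=real] by (intro mult_left_mono) auto
  finally show ?thesis using kV by (simp add: power_divide pos_le_divide_eq)
qed

section \<open>Large values\<close>

definition irred_in :: "nat set \<Rightarrow> 'a::field poly set" where
  "irred_in I = {P \<in> monic_irred. degree P \<in> I}"

lemma irred_in_eq_UN: "irred_in I = (\<Union>d\<in>I. irred_deg d)"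
  by (auto simp: irred_in_def irred_deg_def)

lemma finite_irred_in [simp]: "finite I \<Longrightarrow> finite (irred_in I :: 'a::{field,finite} poly set)"
  unfolding irred_in_eq_UN by simp

lemma irred_in_monic_irred: "irred_in I \<subseteq> monic_irred"
  by (auto simp: irred_in_def)

lemma irred_in_degree_le: "P \<in> irred_in {a<..b} \<Longrightarrow> degree P \<le> b"
  by (simp add: irred_in_def)

lemma irred_le_eq_irred_in: "irred_le K = irred_in {0<..K}"
  using monic_irred_degree_pos by (auto simp: irred_le_def irred_in_def)

definition bw :: "nat \<Rightarrow> complex \<Rightarrow> 'a::field poly \<Rightarrow> real" where
  "bw K u P = wt K (degree P) * Re (u ^ degree P)"

definition prime_sum :: "nat \<Rightarrow> complex \<Rightarrow> nat set \<Rightarrow> 'a::{field,finite} poly \<Rightarrow> real" where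
  "prime_sum K u I D = (\<Sum>P\<in>irred_in I. bw K u P * real_of_int (poly_legendre D P))"

lemma bw_square_le:
  fixes P :: "'a::{field,finite} poly"
  assumes u: "norm u = real CARD('a) powr (- 1 / 2)" and P: "degree P \<le> K"
  shows "(bw K u P)\<^sup>2 \<le> 1 / real CARD('a) ^ degree P"
proof -
  have q: "real CARD('a) > 1" using card_gt_1[where 'a='a] by simp
  have "norm u ^ 2 = real CARD('a) powr (- 1 / 2 + - 1 / 2)"
    unfolding u power2_eq_square powr_add ..
  then have un: "norm u ^ 2 = 1 / real CARD('a)" using q by (simp add: powr_neg_one)
  have "\<bar>bw K u P\<bar> \<le> 1 * norm (u ^ degree P)"
    unfolding bw_def abs_mult using wt_bounds[OF P]
    by (intro mult_mono abs_Re_le_cmod) auto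
  then have "\<bar>bw K u P\<bar>\<^sup>2 \<le> (norm (u ^ degree P))\<^sup>2" by (intro power_mono) auto
  also have "\<dots> = (norm u ^ 2) ^ degree P" by (simp add: norm_power mult.commute flip: power_mult)
  also have "\<dots> = 1 / real CARD('a) ^ degree P" unfolding un by (simp add: power_divide)
  finally show ?thesis by simp
qed

text \<open>There are at most q^d / d primes of degree d, each contributing at most q^(-d), so a
  degree adds at most 1 / d.\<close>

lemma variance_le:
  assumes u: "norm u = real CARD('a::{field,finite}) powr (- 1 / 2)" and I: "finite I" "I \<subseteq> {0<..K}"
  shows "(\<Sum>P\<in>(irred_in I :: 'a poly set). (bw K u P)\<^sup>2) \<le> (\<Sum>d\<in>I. 1 / real d)"
proof -
  have q: "real CARD('a) > 0" using card_gt_1[where 'a='a] by simp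
  have "(\<Sum>P\<in>(irred_in I :: 'a poly set). (bw K u P)\<^sup>2) = (\<Sum>d\<in>I. \<Sum>P\<in>(irred_deg d :: 'a poly set). (bw K u P)\<^sup>2)"
    unfolding irred_in_eq_UN by (rule sum.UNION_disjoint) (simp_all add: irred_deg_disjoint I)
  also have "\<dots> \<le> (\<Sum>d\<in>I. 1 / real d)"
  proof (rule sum_mono)
    fix d assume d: "d \<in> I"
    then have d0: "d > 0" "d \<le> K" using I by auto
    have "(\<Sum>P\<in>(irred_deg d :: 'a poly set). (bw K u P)\<^sup>2) \<le> (\<Sum>P\<in>(irred_deg d :: 'a poly set). 1 / real CARD('a) ^ d)"
    proof (rule sum_mono)
      fix P :: "'a poly" assume "P \<in> irred_deg d"
      then have "degree P = d" by (simp add: irred_deg_def)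
      with bw_square_le[OF u, of P K] d0 show "(bw K u P)\<^sup>2 \<le> 1 / real CARD('a) ^ d" by simp
    qed
    also have "\<dots> = real (card (irred_deg d :: 'a poly set)) / real CARD('a) ^ d" by simp
    also have "\<dots> \<le> 1 / real d"
    proof -
      have "real (d * card (irred_deg d :: 'a poly set)) \<le> real (CARD('a) ^ d)"
        unfolding of_nat_le_iff by (rule card_irred_deg)
      then have "real (card (irred_deg d :: 'a poly set)) * real d \<le> 1 * real CARD('a) ^ d"
        by (simp add: mult.commute)
      then show ?thesis using d0 q by (simp add: field_simps)
    qed
    finally show "(\<Sum>P\<in>(irred_deg d :: 'a poly set). (bw K u P)\<^sup>2) \<le> 1 / real d" .
  qed
  finally show ?thesis .
qed

lemma variance_le_ln:
  assumes u: "norm u = real CARD('a::{field,finite}) powr (- 1 / 2)" and K: "1 \<le> L" "L \<le> K" "L \<le> n"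
  shows "(\<Sum>P\<in>(irred_in {0<..L} :: 'a poly set). (bw K u P)\<^sup>2) \<le> 1 + ln (real n)"
proof -
  have "(\<Sum>P\<in>(irred_in {0<..L} :: 'a poly set). (bw K u P)\<^sup>2) \<le> (\<Sum>d\<in>{0<..L}. 1 / real d)"
    by (rule variance_le[OF u]) (use K in auto)
  also have "\<dots> = (\<Sum>d=1..L. 1 / real d)" by (rule sum.cong) auto
  also have "\<dots> \<le> 1 + ln (real L)" by (rule harmonic_le_ln[OF K(1)])
  also have "ln (real L) \<le> ln (real n)" using K by simp
  finally show ?thesis by simp
qed

text \<open>The constant terms of \<open>L_fun_bound\<close>; the summand 1 / 2 comes from (1 + ln
  K) / 2.\<close>

definition bconst :: "real \<Rightarrow> real" where
  "bconst q = 1 / 2 + tail_const q"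

lemma bconst_nonneg: "q > 1 \<Longrightarrow> bconst q \<ge> 0"
  unfolding bconst_def tail_const_def using powr_less_mono[of "- 1 / 6" 0 q] by simp

lemma L_fun_le_exp_prime_sum:
  fixes D :: "'a::{field,finite} poly"
  assumes odd: "odd CARD('a)" and D: "D \<in> monic_squarefree n"
    and K: "1 \<le> K" "K \<le> n" and u: "norm u = real CARD('a) powr (- 1 / 2)"
  shows "norm (L_fun D u) \<le> exp (real n / real K + ln (real n) / 2 + bconst (real CARD('a)) + prime_sum K u {0<..K} D)"
proof -
  have n: "n > 0" using K by simp
  have "norm (L_fun D u) \<le> exp (real n / real K + (1 + ln (real K)) / 2 + tail_const (real CARD('a)) + prime_sum K u {0<..K} D)"
    using L_fun_bound[OF odd D n K(1) u] unfolding prime_sum_def bw_def irred_le_eq_irred_in .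
  also have "\<dots> \<le> exp (real n / real K + ln (real n) / 2 + bconst (real CARD('a)) + prime_sum K u {0<..K} D)"
    unfolding exp_le_cancel_iff bconst_def using K by simp
  finally show ?thesis .
qed

lemma monic_squarefree_subset: "monic_squarefree n \<subseteq> monic_deg n"
  by (auto simp: monic_squarefree_def monic_deg_def)

lemma finite_monic_squarefree [simp]: "finite (monic_squarefree n :: 'a::{field,finite} poly set)"
  by (rule finite_subset[OF monic_squarefree_subset finite_monic_deg])

text \<open>The tail bound is used with parameter exp B, which gains exp (- B) for each unit of the
  moment order \<open>N\<close>, whatever the fixed number \<open>B\<close>.\<close>

lemma tail_power_le:
  assumes "real N \<le> V" "V > 0"
  shows "(real N / (exp B * V)) ^ N \<le> exp (- B * real N)"
proof -
  have "real N / (exp B * V) \<le> exp (- B)"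
    using assms by (simp add: exp_minus field_simps)
  then have "(real N / (exp B * V)) ^ N \<le> exp (- B) ^ N"
    using assms by (intro power_mono) auto
  also have "\<dots> = exp (- B * real N)" by (simp add: mult.commute flip: exp_of_nat_mult)
  finally show ?thesis .
qed

text \<open>A value exp V forces a prime sum of size at least V / 4, once K is so large that n / K
  takes up no more than V / 2. The order N of the moment used is proportional to V and the gain
  exponential in N with any prescribed rate. The lower bound on \<open>V\<close> lets it absorb
  \<Lambda>, the constants and the variance term exp (2 B) (1 + \<Lambda>) / 2.\<close>

lemma large_values_count:
  fixes k n :: nat
  assumes odd: "odd CARD('a::{field,finite})" and u: "norm u = real CARD('a) powr (- 1 / 2)"
    and n: "ln (real n) \<ge> 1"
    and V: "(18 + 4 * bconst (real CARD('a)) + exp (16 * (real k + 2))) * ln (real n) \<le> V" "V \<le> 2 * real n"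
  shows "real (card {D \<in> (monic_squarefree n :: 'a poly set). exp V \<le> norm (L_fun D u)}) \<le>
    real CARD('a) ^ n * exp (- (real k + 1) * V)"
proof -
  let ?\<Lambda> = "ln (real n)" and ?c = "bconst (real CARD('a))"
  define G where "G = {D \<in> (monic_squarefree n :: 'a poly set). exp V \<le> norm (L_fun D u)}"
  \<comment> \<open>As N is at least V / 8, the gain exp (- B N) is at most exp (- (k + 2) V). One
    of these factors exp (- V) pays for the variance.\<close>
  define B where "B = 8 * (real k + 2)"
  have q: "real CARD('a) > 1" using card_gt_1[where 'a='a] by simp
  have c0: "?c \<ge> 0" using bconst_nonneg[OF q] .
  have n0: "n > 0" using n by (intro gr0I) simp
  have e0: "exp (2 * B) = exp (16 * (real k + 2))" unfolding B_def by simp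
  have V1: "18 * ?\<Lambda> + 4 * ?c * ?\<Lambda> + exp (2 * B) * ?\<Lambda> \<le> V"
    using V(1) unfolding e0 by (simp add: algebra_simps)
  have p1: "4 * ?c * 1 \<le> 4 * ?c * ?\<Lambda>" using c0 n by (intro mult_left_mono) auto
  have p2: "0 \<le> exp (2 * B) * ?\<Lambda>" using n by simp
  have p3: "exp (2 * B) * 1 \<le> exp (2 * B) * ?\<Lambda>" using n by (intro mult_left_mono) auto
  have p4: "0 \<le> 4 * ?c * ?\<Lambda>" using c0 n by simp
  have V16: "V \<ge> 16" using V1 p1 p2 n c0 by linarith
  have VX: "V / 2 - ?\<Lambda> / 2 - ?c \<ge> V / 4" using V1 p1 p2 n c0 by linarith
  have Ve: "exp (2 * B) * (1 + ?\<Lambda>) / 2 \<le> V"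
  proof -
    have "(x + y) / 2 \<le> V" if "18 * l + p + y \<le> V" "x \<le> y" "0 \<le> p" "1 \<le> l" for x y p l :: real
      using that by simp
    from this[OF V1 p3 p4 n] show ?thesis unfolding distrib_left[of "exp (2 * B)"] .
  qed
  \<comment> \<open>Balances the two requirements n / K \<le> V / 2 and, with N at most V / 4, N K
    \<le> n.\<close>
  define K where "K = nat \<lceil>2 * real n / V\<rceil>"
  have x1: "1 \<le> 2 * real n / V" using V(2) V16 by simp
  have Kreal: "real K = real_of_int \<lceil>2 * real n / V\<rceil>" unfolding K_def using x1 by simp
  have Kge: "2 * real n / V \<le> real K" unfolding Kreal by (rule le_of_int_ceiling)
  have "real K \<le> 2 * real n / V + 1" unfolding Kreal by (rule of_int_ceiling_le_add_one)
  then have Kle: "real K \<le> 4 * real n / V" using x1 by simp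
  have K1: "1 \<le> K" using Kge x1 by linarith
  have "4 * real n \<le> V * real n" using V16 by (intro mult_right_mono) auto
  then have "4 * real n / V \<le> real n" using V16 by (simp add: pos_divide_le_eq mult.commute)
  then have Kn: "K \<le> n" using Kle by linarith
  have "2 * real n \<le> real K * V" using Kge V16 by (simp add: pos_divide_le_eq)
  then have nK: "real n / real K \<le> V / 2" using K1 by (simp add: pos_divide_le_eq mult.commute)
  define N where "N = 2 * nat \<lfloor>V / 8\<rfloor>"
  have Nreal: "real N = 2 * real_of_int \<lfloor>V / 8\<rfloor>" unfolding N_def using V16 by simp
  have Nle: "real N \<le> V / 4" unfolding Nreal using of_int_floor_le[of "V / 8"] by simp
  have "V / 8 < real_of_int \<lfloor>V / 8\<rfloor> + 1" by linarith
  then have Nge: "V / 8 \<le> real N" unfolding Nreal using V16 by linarith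
  have "real N * real K \<le> (V / 4) * (4 * real n / V)" using Nle Kle V16 by (intro mult_mono) auto
  also have "\<dots> = real n" using V16 by simp
  finally have "real (N * K) \<le> real n" by simp
  then have NK: "N * K \<le> n" by (simp only: of_nat_le_iff)
  have "real (card G) \<le> real CARD('a) ^ n *
      exp ((exp B)\<^sup>2 * (\<Sum>P\<in>(irred_in {0<..K} :: 'a poly set). (bw K u P)\<^sup>2) / 2) * (real N / (exp B * (V / 4))) ^ N"
  proof (rule legendre_tail[OF odd _ irred_in_monic_irred _ NK])
    show "G \<subseteq> monic_deg n" unfolding G_def using monic_squarefree_subset by blast
    fix D assume "D \<in> G"
    then have D: "D \<in> monic_squarefree n" "exp V \<le> norm (L_fun D u)" by (auto simp: G_def)
    have "exp V \<le> exp (real n / real K + ?\<Lambda> / 2 + ?c + prime_sum K u {0<..K} D)"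
      using D(2) L_fun_le_exp_prime_sum[OF odd D(1) K1 Kn u] by linarith
    then have "V \<le> real n / real K + ?\<Lambda> / 2 + ?c + prime_sum K u {0<..K} D" unfolding exp_le_cancel_iff .
    then have "V / 4 \<le> \<bar>prime_sum K u {0<..K} D\<bar>" using nK VX by linarith
    then show "V / 4 \<le> \<bar>\<Sum>P\<in>irred_in {0<..K}. bw K u P * real_of_int (poly_legendre D P)\<bar>"
      unfolding prime_sum_def .
  qed (use V16 in \<open>auto simp: N_def irred_in_degree_le\<close>)
  also have "\<dots> \<le> real CARD('a) ^ n * exp (exp (2 * B) * (1 + ?\<Lambda>) / 2) * exp (- B * real N)"
  proof (intro mult_mono tail_power_le)
    have "(exp B)\<^sup>2 * (\<Sum>P\<in>(irred_in {0<..K} :: 'a poly set). (bw K u P)\<^sup>2) \<le> exp (2 * B) * (1 + ?\<Lambda>)"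
      unfolding exp_double[symmetric] by (intro mult_left_mono variance_le_ln[OF u K1 order_refl Kn]) auto
    then show "exp ((exp B)\<^sup>2 * (\<Sum>P\<in>(irred_in {0<..K} :: 'a poly set). (bw K u P)\<^sup>2) / 2) \<le> exp (exp (2 * B) * (1 + ?\<Lambda>) / 2)"
      by simp
  qed (use Nle V16 in auto)
  also have "\<dots> = real CARD('a) ^ n * exp (exp (2 * B) * (1 + ?\<Lambda>) / 2 - B * real N)"
  proof -
    have "c * exp x * exp (- b * y) = c * exp (x - b * y)" for c x b y :: real
      by (simp add: exp_diff exp_minus divide_inverse)
    then show ?thesis .
  qed
  also have "\<dots> \<le> real CARD('a) ^ n * exp (- (real k + 1) * V)"
  proof (intro mult_left_mono)
    have "B * (V / 8) \<le> B * real N" using Nge unfolding B_def by (intro mult_left_mono) auto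
    moreover have "B * (V / 8) = (real k + 1) * V + V" unfolding B_def by (simp add: algebra_simps)
    ultimately have "exp (2 * B) * (1 + ?\<Lambda>) / 2 - B * real N \<le> - ((real k + 1) * V)" using Ve by linarith
    then show "exp (exp (2 * B) * (1 + ?\<Lambda>) / 2 - B * real N) \<le> exp (- (real k + 1) * V)"
      unfolding exp_le_cancel_iff mult_minus_left .
  qed simp
  finally show ?thesis unfolding G_def .
qed

text \<open>For K = 1 the only weight is \<open>wt 1 1 = 0\<close>, so the prime sum disappears. The
  resulting bound caps the levels to be summed over at 2 n.\<close>

lemma L_fun_le_trivial:
  fixes D :: "'a::{field,finite} poly"
  assumes odd: "odd CARD('a)" and D: "D \<in> monic_squarefree n" and n: "n \<ge> 1"
    and u: "norm u = real CARD('a) powr (- 1 / 2)"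
    and big: "ln (real n) / 2 + bconst (real CARD('a)) < real n"
  shows "norm (L_fun D u) < exp (2 * real n)"
proof -
  have "prime_sum 1 u {0<..1} D = 0"
    unfolding prime_sum_def by (rule sum.neutral) (auto simp: irred_in_def bw_def wt_def)
  then have "norm (L_fun D u) \<le> exp (real n / real 1 + ln (real n) / 2 + bconst (real CARD('a)) + 0)"
    using L_fun_le_exp_prime_sum[OF odd D order_refl n u] by simp
  also have "\<dots> < exp (2 * real n)" using big by simp
  finally show ?thesis .
qed

lemma sum_exp_neg_le: "(\<Sum>v\<in>W. exp (- real v)) \<le> 2" if "finite W"
proof -
  have e: "(exp (- 1) :: real) \<le> 1 / 2"
    using exp_ge_add_one_self[of "1 :: real"] by (simp add: exp_minus field_simps)
  have eq: "exp (- real v) = exp (- 1) ^ v" for v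
    using exp_of_nat_mult[of v "- 1 :: real"] by (simp add: mult.commute)
  have "(\<Sum>v\<in>W. exp (- real v)) \<le> (\<Sum>v. exp (- 1 :: real) ^ v)"
    unfolding eq using e by (intro sum_le_suminf that summable_geometric) auto
  also have "\<dots> = 1 / (1 - exp (- 1))" using e by (intro suminf_geometric) simp
  also have "\<dots> \<le> 2" using e by (simp add: divide_le_eq)
  finally show ?thesis .
qed

text \<open>Split by the integer part v of ln of the norm: a layer contributes at most exp (k (v +
  1)) times q^n exp (- (k + 1) v), and the factors exp (- v) sum to at most 2. \<open>A\<close>
  exceeds the constant of \<open>large_values_count\<close> by 1 because rounding down to v may lose
  1, which is at most \<Lambda>.\<close>

lemma large_values_sum:
  fixes k n :: nat
  assumes odd: "odd CARD('a::{field,finite})" and u: "norm u = real CARD('a) powr (- 1 / 2)"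
    and n: "ln (real n) \<ge> 1" and big: "ln (real n) / 2 + bconst (real CARD('a)) < real n"
    and A: "A = 19 + 4 * bconst (real CARD('a)) + exp (16 * (real k + 2))"
  shows "(\<Sum>D | D \<in> (monic_squarefree n :: 'a poly set) \<and> exp (A * ln (real n)) \<le> norm (L_fun D u).
    norm (L_fun D u) ^ k) \<le> 2 * exp (real k) * real CARD('a) ^ n"
proof -
  let ?\<Lambda> = "ln (real n)" and ?H = "monic_squarefree n :: 'a poly set"
  have n1: "n \<ge> 1" using n by (cases n) auto
  define W where "W = {v. v \<le> 2 * n \<and> (A - 1) * ?\<Lambda> \<le> real v}"
  have finW: "finite W" unfolding W_def by simp
  let ?B = "{D \<in> ?H. exp (A * ?\<Lambda>) \<le> norm (L_fun D u)}"
  let ?f = "\<lambda>D v. if exp (real v) \<le> norm (L_fun D u) then exp (real k * (real v + 1)) else 0"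
  have "(\<Sum>D\<in>?B. norm (L_fun D u) ^ k) \<le> (\<Sum>D\<in>?B. \<Sum>v\<in>W. ?f D v)"
  proof (rule sum_mono)
    fix D assume "D \<in> ?B"
    then have D: "D \<in> ?H" "exp (A * ?\<Lambda>) \<le> norm (L_fun D u)" by auto
    define l where "l = ln (norm (L_fun D u))"
    have pos: "0 < norm (L_fun D u)" using D(2) exp_gt_zero[of "A * ?\<Lambda>"] by linarith
    have el: "norm (L_fun D u) = exp l" unfolding l_def using pos by simp
    have lA: "A * ?\<Lambda> \<le> l" using D(2) unfolding el exp_le_cancel_iff .
    have ln: "l < 2 * real n" using L_fun_le_trivial[OF odd D(1) n1 u big] unfolding el exp_less_cancel_iff .
    have "0 \<le> A" using bconst_nonneg[of "real CARD('a)"] card_gt_1[where 'a='a] unfolding A by simp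
    then have l0: "0 \<le> l" using lA n mult_nonneg_nonneg[of A ?\<Lambda>] by linarith
    define v where "v = nat \<lfloor>l\<rfloor>"
    have v: "real v \<le> l" "l < real v + 1" unfolding v_def using l0 by linarith+
    have "v \<in> W"
    proof -
      have "real v \<le> real (2 * n)" using v ln by simp
      then have "v \<le> 2 * n" by (simp only: of_nat_le_iff)
      moreover have "(A - 1) * ?\<Lambda> \<le> real v" using lA v n by (simp add: left_diff_distrib)
      ultimately show ?thesis unfolding W_def by simp
    qed
    have "norm (L_fun D u) ^ k = exp (real k * l)" unfolding el by (simp flip: exp_of_nat_mult)
    also have "\<dots> \<le> exp (real k * (real v + 1))" unfolding exp_le_cancel_iff using v by (intro mult_left_mono) auto
    also have "\<dots> = ?f D v" unfolding el exp_le_cancel_iff using v by simp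
    also have "\<dots> \<le> (\<Sum>v\<in>W. ?f D v)" using \<open>v \<in> W\<close> finW by (intro member_le_sum) auto
    finally show "norm (L_fun D u) ^ k \<le> (\<Sum>v\<in>W. ?f D v)" .
  qed
  also have "\<dots> = (\<Sum>v\<in>W. \<Sum>D\<in>?B. ?f D v)" by (rule sum.swap)
  also have "\<dots> \<le> (\<Sum>v\<in>W. exp (real k) * real CARD('a) ^ n * exp (- real v))"
  proof (rule sum_mono)
    fix v assume "v \<in> W"
    then have v: "v \<le> 2 * n" "(A - 1) * ?\<Lambda> \<le> real v" by (auto simp: W_def)
    have v2: "(18 + 4 * bconst (real CARD('a)) + exp (16 * (real k + 2))) * ?\<Lambda> \<le> real v"
      using v(2) unfolding A by (simp add: algebra_simps)
    have v1: "real v \<le> 2 * real n" using v(1) by (simp flip: of_nat_le_iff[where 'a=real])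
    have "(\<Sum>D\<in>?B. ?f D v) \<le> (\<Sum>D\<in>?H. ?f D v)" by (rule sum_mono2) auto
    also have "\<dots> = (\<Sum>D | D \<in> ?H \<and> exp (real v) \<le> norm (L_fun D u). exp (real k * (real v + 1)))"
      by (rule sum.inter_filter[symmetric]) simp
    also have "\<dots> = real (card {D \<in> ?H. exp (real v) \<le> norm (L_fun D u)}) * exp (real k * (real v + 1))" by simp
    also have "\<dots> \<le> real CARD('a) ^ n * exp (- (real k + 1) * real v) * exp (real k * (real v + 1))"
      by (intro mult_right_mono large_values_count[OF odd u n v2 v1]) simp
    also have "\<dots> = real CARD('a) ^ n * (exp (- (real k + 1) * real v) * exp (real k * (real v + 1)))"
      by (rule mult.assoc)
    also have "exp (- (real k + 1) * real v) * exp (real k * (real v + 1)) = exp (real k) * exp (- real v)"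
      unfolding exp_add[symmetric] by (simp add: algebra_simps)
    finally show "(\<Sum>D\<in>?B. ?f D v) \<le> exp (real k) * real CARD('a) ^ n * exp (- real v)"
      by (simp only: mult_ac)
  qed
  also have "\<dots> = exp (real k) * real CARD('a) ^ n * (\<Sum>v\<in>W. exp (- real v))" by (simp only: sum_distrib_left)
  also have "\<dots> \<le> exp (real k) * real CARD('a) ^ n * 2"
    by (intro mult_left_mono sum_exp_neg_le finW) simp
  finally show ?thesis by (simp only: mult_ac)
qed

section \<open>Moments on the critical circle\<close>

lemma prime_sum_split:
  assumes "K\<^sub>0 \<le> K"
  shows "prime_sum K u {0<..K} D = prime_sum K u {0<..K\<^sub>0} D + prime_sum K u {K\<^sub>0<..K} D"
proof -
  have "irred_in {0<..K} = irred_in {0<..K\<^sub>0} \<union> (irred_in {K\<^sub>0<..K} :: 'a poly set)"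
    using assms by (auto simp: irred_in_def)
  moreover have "irred_in {0<..K\<^sub>0} \<inter> (irred_in {K\<^sub>0<..K} :: 'a poly set) = {}"
    by (auto simp: irred_in_def)
  ultimately show ?thesis unfolding prime_sum_def by (simp add: sum.union_disjoint)
qed

lemma double_floor_bounds:
  fixes x :: real
  assumes "x \<ge> 0"
  shows "even (2 * nat \<lfloor>x / 2\<rfloor>)" "real (2 * nat \<lfloor>x / 2\<rfloor>) \<le> x" "x - 2 \<le> real (2 * nat \<lfloor>x / 2\<rfloor>)"
proof -
  have e: "real (2 * nat \<lfloor>x / 2\<rfloor>) = 2 * real_of_int \<lfloor>x / 2\<rfloor>" using assms by simp
  show "real (2 * nat \<lfloor>x / 2\<rfloor>) \<le> x" "x - 2 \<le> real (2 * nat \<lfloor>x / 2\<rfloor>)" unfolding e by linarith+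
qed simp

text \<open>The variance of the block is at most ln R, the logarithm of the ratio of its ends. With
  R fixed, the parameter \<open>B\<close> can be any constant, so that for W a multiple of \<Lambda>
  any power of \<open>n\<close> can be saved. \<open>W \<ge> 8\<close> ensures that the even order N
  is at least W / 4.\<close>

lemma upper_block_count:
  assumes odd: "odd CARD('a::{field,finite})" and u: "norm u = real CARD('a) powr (- 1 / 2)"
    and K: "1 \<le> K\<^sub>0" "K\<^sub>0 \<le> K" and W: "W \<ge> 8" "real K \<le> 2 * real n / W"
    and R: "real K / real K\<^sub>0 \<le> R" and B: "B \<ge> 0"
  shows "real (card {D \<in> (monic_squarefree n :: 'a poly set). W \<le> \<bar>prime_sum K u {K\<^sub>0<..K} D\<bar>}) \<le>
    real CARD('a) ^ n * exp (exp (2 * B) * ln R / 2) * exp (- B * (W / 4))"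
proof -
  define G where "G = {D \<in> (monic_squarefree n :: 'a poly set). W \<le> \<bar>prime_sum K u {K\<^sub>0<..K} D\<bar>}"
  define N where "N = 2 * nat \<lfloor>W / 2 / 2\<rfloor>"
  have N: "even N" "real N \<le> W / 2" "W / 2 - 2 \<le> real N"
    unfolding N_def using double_floor_bounds[of "W / 2"] W by auto
  have "real N * real K \<le> (W / 2) * (2 * real n / W)" using N W by (intro mult_mono) auto
  also have "\<dots> = real n" using W by simp
  finally have "real (N * K) \<le> real n" by simp
  then have NK: "N * K \<le> n" by (simp only: of_nat_le_iff)
  have "real (card G) \<le> real CARD('a) ^ n *
      exp ((exp B)\<^sup>2 * (\<Sum>P\<in>(irred_in {K\<^sub>0<..K} :: 'a poly set). (bw K u P)\<^sup>2) / 2) * (real N / (exp B * W)) ^ N"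
  proof (rule legendre_tail[OF odd _ irred_in_monic_irred _ NK N(1)])
    show "G \<subseteq> monic_deg n" unfolding G_def using monic_squarefree_subset by blast
    fix D assume "D \<in> G"
    then show "W \<le> \<bar>\<Sum>P\<in>irred_in {K\<^sub>0<..K}. bw K u P * real_of_int (poly_legendre D P)\<bar>"
      unfolding G_def prime_sum_def by blast
  qed (use W in \<open>auto simp: irred_in_degree_le\<close>)
  also have "\<dots> \<le> real CARD('a) ^ n * exp (exp (2 * B) * ln R / 2) * exp (- B * real N)"
  proof (intro mult_mono tail_power_le)
    have "(\<Sum>P\<in>(irred_in {K\<^sub>0<..K} :: 'a poly set). (bw K u P)\<^sup>2) \<le> (\<Sum>d\<in>{K\<^sub>0<..K}. 1 / real d)"
      by (rule variance_le[OF u]) auto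
    also have "\<dots> \<le> ln (real K / real K\<^sub>0)" using K by (intro sum_inverse_le_ln) auto
    also have "\<dots> \<le> ln R" using R K by (intro ln_mono) auto
    finally have "(exp B)\<^sup>2 * (\<Sum>P\<in>(irred_in {K\<^sub>0<..K} :: 'a poly set). (bw K u P)\<^sup>2) \<le> exp (2 * B) * ln R"
      unfolding exp_double[symmetric] by (intro mult_left_mono) auto
    then show "exp ((exp B)\<^sup>2 * (\<Sum>P\<in>(irred_in {K\<^sub>0<..K} :: 'a poly set). (bw K u P)\<^sup>2) / 2) \<le> exp (exp (2 * B) * ln R / 2)"
      by simp
  qed (use N W in auto)
  also have "\<dots> \<le> real CARD('a) ^ n * exp (exp (2 * B) * ln R / 2) * exp (- B * (W / 4))"
  proof (intro mult_left_mono)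
    have "W / 4 \<le> real N" using N W by linarith
    then have "B * (W / 4) \<le> B * real N" using B by (rule mult_left_mono)
    then show "exp (- B * real N) \<le> exp (- B * (W / 4))" by simp
  qed simp
  finally show ?thesis unfolding G_def .
qed

text \<open>Here the variance is of size \<Lambda>, but the short length permits moments of order
  about G \<Lambda>. The gain is then exp (- G \<Lambda>) against a variance cost that does not
  depend on \<open>G\<close>, so a large \<open>G\<close> wins.\<close>

lemma lower_block_count:
  fixes k :: nat
  assumes odd: "odd CARD('a::{field,finite})" and u: "norm u = real CARD('a) powr (- 1 / 2)"
    and K: "1 \<le> K\<^sub>0" "K\<^sub>0 \<le> K" "K \<le> n" and n: "ln (real n) \<ge> 1" and G: "G \<ge> 1"
    and K0: "real K\<^sub>0 \<le> real n / (G * ln (real n))" and k: "k > 0"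
  shows "real (card {D \<in> (monic_squarefree n :: 'a poly set). G * ln (real n) / (6 * real k) \<le> \<bar>prime_sum K u {0<..K\<^sub>0} D\<bar>}) \<le>
    real CARD('a) ^ n * exp 2 * exp (- (G - 324 * real k ^ 2) * ln (real n))"
proof -
  let ?\<Lambda> = "ln (real n)"
  define Z where "Z = G * ?\<Lambda>"
  define S where "S = {D \<in> (monic_squarefree n :: 'a poly set). Z / (6 * real k) \<le> \<bar>prime_sum K u {0<..K\<^sub>0} D\<bar>}"
  have Z: "Z > 0" unfolding Z_def using G n by simp
  define N where "N = 2 * nat \<lfloor>Z / 2\<rfloor>"
  have N: "even N" "real N \<le> Z" "Z - 2 \<le> real N"
    unfolding N_def using double_floor_bounds[of Z] Z by auto
  have "real N * real K\<^sub>0 \<le> Z * (real n / Z)" using N K0 Z unfolding Z_def[symmetric] by (intro mult_mono) auto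
  also have "\<dots> = real n" using Z by simp
  finally have "real (N * K\<^sub>0) \<le> real n" by simp
  then have NK: "N * K\<^sub>0 \<le> n" by (simp only: of_nat_le_iff)
  \<comment> \<open>Makes l times the threshold equal to exp 1 times Z, so each unit of N gains a
    factor exp (- 1). As exp 1 \<le> 3, the square of l is at most 324 k^2, which is the constant in
    the statement.\<close>
  define l where "l = 6 * real k * exp 1"
  have l: "l > 0" "l * (Z / (6 * real k)) = exp 1 * Z" unfolding l_def using k by auto
  have "real (card S) \<le> real CARD('a) ^ n *
      exp (l\<^sup>2 * (\<Sum>P\<in>(irred_in {0<..K\<^sub>0} :: 'a poly set). (bw K u P)\<^sup>2) / 2) * (real N / (l * (Z / (6 * real k)))) ^ N"
  proof (rule legendre_tail[OF odd _ irred_in_monic_irred _ NK N(1) _ l(1)])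
    show "S \<subseteq> monic_deg n" unfolding S_def using monic_squarefree_subset by blast
    fix D assume "D \<in> S"
    then show "Z / (6 * real k) \<le> \<bar>\<Sum>P\<in>irred_in {0<..K\<^sub>0}. bw K u P * real_of_int (poly_legendre D P)\<bar>"
      unfolding S_def prime_sum_def by blast
  qed (use Z k in \<open>auto simp: irred_in_degree_le\<close>)
  also have "\<dots> \<le> real CARD('a) ^ n * exp (324 * real k ^ 2 * ?\<Lambda>) * exp (- 1 * real N)"
    unfolding l(2)
  proof (intro mult_mono tail_power_le)
    have K0n: "K\<^sub>0 \<le> n" using K by simp
    have "(\<Sum>P\<in>(irred_in {0<..K\<^sub>0} :: 'a poly set). (bw K u P)\<^sup>2) \<le> 1 + ?\<Lambda>"
      by (rule variance_le_ln[OF u K(1,2) K0n])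
    then have 1: "(\<Sum>P\<in>(irred_in {0<..K\<^sub>0} :: 'a poly set). (bw K u P)\<^sup>2) \<le> 2 * ?\<Lambda>" using n by linarith
    have "l \<le> 6 * real k * 3" unfolding l_def using exp_le by (intro mult_left_mono) auto
    then have "l\<^sup>2 \<le> (6 * real k * 3)\<^sup>2" using l by (intro power_mono) auto
    then have 2: "l\<^sup>2 \<le> 324 * real k ^ 2" by (simp add: power_mult_distrib)
    have "l\<^sup>2 * (\<Sum>P\<in>(irred_in {0<..K\<^sub>0} :: 'a poly set). (bw K u P)\<^sup>2) \<le> (324 * real k ^ 2) * (2 * ?\<Lambda>)"
      by (intro mult_mono 1 2 sum_nonneg) auto
    then show "exp (l\<^sup>2 * (\<Sum>P\<in>(irred_in {0<..K\<^sub>0} :: 'a poly set). (bw K u P)\<^sup>2) / 2) \<le> exp (324 * real k ^ 2 * ?\<Lambda>)"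
      by simp
  qed (use N Z in auto)
  also have "\<dots> \<le> real CARD('a) ^ n * exp (324 * real k ^ 2 * ?\<Lambda>) * exp (2 - Z)"
    using N by (intro mult_left_mono) auto
  also have "\<dots> = real CARD('a) ^ n * exp 2 * exp (- (G - 324 * real k ^ 2) * ?\<Lambda>)"
  proof -
    have "c * exp x * exp (2 - y) = c * exp 2 * exp z" if "x - y = z" for c x y z :: real
      unfolding that[symmetric] by (simp add: exp_diff)
    moreover have "324 * real k ^ 2 * ?\<Lambda> - Z = - (G - 324 * real k ^ 2) * ?\<Lambda>"
      unfolding Z_def by (simp add: algebra_simps)
    ultimately show ?thesis by blast
  qed
  finally show ?thesis unfolding S_def Z_def .
qed

text \<open>The threshold with 6 k is chosen so that 3 k times the lower block is at most Z / 2,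
  with Z = G \<Lambda>; since Z \<ge> 4 this is at most the order N \<ge> Z - 2, as
  \<open>legendre_exp_moment\<close> demands. One of the two \<open>W\<close> bounds n / K, the
  other the block above \<open>K\<^sub>0\<close>.\<close>

lemma typical_values_sum:
  fixes k :: nat
  assumes odd: "odd CARD('a::{field,finite})" and u: "norm u = real CARD('a) powr (- 1 / 2)"
    and K: "1 \<le> K\<^sub>0" "K\<^sub>0 \<le> K" "K \<le> n" and n: "ln (real n) \<ge> 1" and G: "G * ln (real n) \<ge> 4"
    and K0: "real K\<^sub>0 \<le> real n / (G * ln (real n))" and k: "k > 0"
    and KW: "real n / real K \<le> W"
  shows "(\<Sum>D | D \<in> (monic_squarefree n :: 'a poly set) \<and> \<bar>prime_sum K u {K\<^sub>0<..K} D\<bar> < W \<and>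
      \<bar>prime_sum K u {0<..K\<^sub>0} D\<bar> < G * ln (real n) / (6 * real k). norm (L_fun D u) ^ k) \<le>
    4 * exp (real k * bconst (real CARD('a)) + real k ^ 2 / 2) * real CARD('a) ^ n *
    exp (real k * (2 * W + ln (real n) / 2) + real k ^ 2 * ln (real n) / 2)"
proof -
  let ?\<Lambda> = "ln (real n)" and ?c = "bconst (real CARD('a))"
  define Z where "Z = G * ?\<Lambda>"
  define S where "S = {D. D \<in> (monic_squarefree n :: 'a poly set) \<and> \<bar>prime_sum K u {K\<^sub>0<..K} D\<bar> < W \<and>
      \<bar>prime_sum K u {0<..K\<^sub>0} D\<bar> < Z / (6 * real k)}"
  have Z: "Z \<ge> 4" using G unfolding Z_def .
  define N where "N = 2 * nat \<lfloor>Z / 2\<rfloor>"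
  have N: "real N \<le> Z" "Z - 2 \<le> real N"
    unfolding N_def using double_floor_bounds[of Z] Z by auto
  have "real N * real K\<^sub>0 \<le> Z * (real n / Z)" using N K0 Z unfolding Z_def[symmetric] by (intro mult_mono) auto
  also have "\<dots> = real n" using Z by simp
  finally have "real (N * K\<^sub>0) \<le> real n" by simp
  then have NK: "N * K\<^sub>0 \<le> n" by (simp only: of_nat_le_iff)
  have K1: "1 \<le> K" using K by simp
  let ?e = "exp (real k * (2 * W + ?\<Lambda> / 2 + ?c))"
  have "(\<Sum>D\<in>S. norm (L_fun D u) ^ k) \<le> (\<Sum>D\<in>S. ?e * exp (real k * prime_sum K u {0<..K\<^sub>0} D))"
  proof (rule sum_mono)
    fix D assume "D \<in> S"
    then have D: "D \<in> monic_squarefree n" "\<bar>prime_sum K u {K\<^sub>0<..K} D\<bar> < W" by (auto simp: S_def)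
    let ?x = "real n / real K + ?\<Lambda> / 2 + ?c + prime_sum K u {0<..K} D"
    have "norm (L_fun D u) ^ k \<le> exp ?x ^ k"
      by (intro power_mono L_fun_le_exp_prime_sum[OF odd D(1) K1 K(3) u]) simp
    also have "\<dots> = exp (real k * ?x)" by (simp flip: exp_of_nat_mult)
    also have "\<dots> \<le> exp (real k * ((2 * W + ?\<Lambda> / 2 + ?c) + prime_sum K u {0<..K\<^sub>0} D))"
      unfolding exp_le_cancel_iff prime_sum_split[OF K(2)] using D(2) KW by (intro mult_left_mono) auto
    also have "\<dots> = ?e * exp (real k * prime_sum K u {0<..K\<^sub>0} D)"
      unfolding distrib_left[of "real k"] exp_add ..
    finally show "norm (L_fun D u) ^ k \<le> ?e * exp (real k * prime_sum K u {0<..K\<^sub>0} D)" .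
  qed
  also have "\<dots> = ?e * (\<Sum>D\<in>S. exp (real k * prime_sum K u {0<..K\<^sub>0} D))" by (simp only: sum_distrib_left)
  also have "(\<Sum>D\<in>S. exp (real k * prime_sum K u {0<..K\<^sub>0} D)) \<le>
      4 * real CARD('a) ^ n * exp ((real k)\<^sup>2 * (\<Sum>P\<in>(irred_in {0<..K\<^sub>0} :: 'a poly set). (bw K u P)\<^sup>2) / 2)"
    unfolding prime_sum_def
  proof (rule legendre_exp_moment[OF odd _ irred_in_monic_irred _ NK])
    show "S \<subseteq> monic_deg n" unfolding S_def using monic_squarefree_subset by blast
    fix D assume "D \<in> S"
    then have "\<bar>prime_sum K u {0<..K\<^sub>0} D\<bar> \<le> Z / (6 * real k)" unfolding S_def by simp
    then have "3 * real k * \<bar>prime_sum K u {0<..K\<^sub>0} D\<bar> \<le> 3 * real k * (Z / (6 * real k))"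
      by (intro mult_left_mono) auto
    also have "\<dots> = Z / 2" using k by simp
    also have "\<dots> \<le> real N" using N Z by linarith
    finally show "3 * \<bar>real k * (\<Sum>P\<in>irred_in {0<..K\<^sub>0}. bw K u P * real_of_int (poly_legendre D P))\<bar> \<le> real N"
      unfolding prime_sum_def by (simp add: abs_mult)
  qed (auto simp: irred_in_degree_le)
  also have "\<dots> \<le> 4 * real CARD('a) ^ n * exp ((real k)\<^sup>2 * (1 + ?\<Lambda>) / 2)"
  proof (intro mult_left_mono)
    have "(\<Sum>P\<in>(irred_in {0<..K\<^sub>0} :: 'a poly set). (bw K u P)\<^sup>2) \<le> 1 + ?\<Lambda>"
      by (rule variance_le_ln[OF u K(1,2)]) (use K in simp)
    then have "(real k)\<^sup>2 * (\<Sum>P\<in>(irred_in {0<..K\<^sub>0} :: 'a poly set). (bw K u P)\<^sup>2) \<le> (real k)\<^sup>2 * (1 + ?\<Lambda>)"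
      by (intro mult_left_mono) auto
    then show "exp ((real k)\<^sup>2 * (\<Sum>P\<in>(irred_in {0<..K\<^sub>0} :: 'a poly set). (bw K u P)\<^sup>2) / 2) \<le> exp ((real k)\<^sup>2 * (1 + ?\<Lambda>) / 2)"
      by simp
  qed simp
  finally have "(\<Sum>D\<in>S. norm (L_fun D u) ^ k) \<le> ?e * (4 * real CARD('a) ^ n * exp ((real k)\<^sup>2 * (1 + ?\<Lambda>) / 2))"
    by (simp add: mult_left_mono)
  also have "\<dots> = 4 * exp (real k * ?c + real k ^ 2 / 2) * real CARD('a) ^ n *
    exp (real k * (2 * W + ?\<Lambda> / 2) + real k ^ 2 * ?\<Lambda> / 2)"
  proof -
    have "exp x * (4 * y * exp z) = 4 * exp a * y * exp b" if "x + z = a + b" for x y z a b :: real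
      using arg_cong[OF that, of exp] by (simp add: exp_add mult_ac)
    moreover have "real k * (2 * W + ?\<Lambda> / 2 + ?c) + (real k)\<^sup>2 * (1 + ?\<Lambda>) / 2 =
      (real k * ?c + real k ^ 2 / 2) + (real k * (2 * W + ?\<Lambda> / 2) + real k ^ 2 * ?\<Lambda> / 2)"
      by (simp add: field_simps)
    ultimately show ?thesis by blast
  qed
  finally show ?thesis unfolding S_def Z_def .
qed

lemma bounded_values_sum:
  fixes k :: nat
  assumes S: "finite S" "\<And>D. D \<in> S \<Longrightarrow> norm (L_fun D u) \<le> exp T" and card: "real (card S) \<le> Q * exp (- (real k * T))"
  shows "(\<Sum>D\<in>S. norm (L_fun D u) ^ k) \<le> Q"
proof -
  have "(\<Sum>D\<in>S. norm (L_fun D u) ^ k) \<le> (\<Sum>D\<in>S. exp T ^ k)"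
    by (intro sum_mono power_mono S) auto
  also have "\<dots> = real (card S) * exp (real k * T)" by (simp flip: exp_of_nat_mult)
  also have "\<dots> \<le> Q * exp (- (real k * T)) * exp (real k * T)" using card by (intro mult_right_mono) auto
  also have "\<dots> = Q" by (simp add: exp_minus)
  finally show ?thesis .
qed

text \<open>The ratio of the two lengths is bounded independently of \<open>n\<close>. Rounding up
  and rounding down each cost at most a factor 2, whence 4 G / \<delta>.\<close>

lemma block_lengths:
  fixes \<delta> G \<Lambda> :: real
  assumes \<delta>: "\<delta> > 0" "\<delta> \<le> G" and \<Lambda>: "\<delta> * \<Lambda> \<ge> 8" "G * \<Lambda> \<le> real n"
  defines "K \<equiv> nat \<lceil>real n / (\<delta> * \<Lambda>)\<rceil>" and "K\<^sub>0 \<equiv> nat \<lfloor>real n / (G * \<Lambda>)\<rfloor>"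
  shows "1 \<le> K\<^sub>0" "K\<^sub>0 \<le> K" "K \<le> n" "real K \<le> 2 * real n / (\<delta> * \<Lambda>)" "real n / real K \<le> \<delta> * \<Lambda>"
    "real K\<^sub>0 \<le> real n / (G * \<Lambda>)" "real K / real K\<^sub>0 \<le> 4 * G / \<delta>"
proof -
  define x where "x = real n / (\<delta> * \<Lambda>)"
  define y where "y = real n / (G * \<Lambda>)"
  have \<Lambda>0: "\<Lambda> > 0" using zero_less_mult_pos[of \<delta> \<Lambda>] \<delta> \<Lambda> by linarith
  have "\<delta> * \<Lambda> \<le> G * \<Lambda>" using \<delta> \<Lambda>0 by (intro mult_right_mono) auto
  then have G\<Lambda>: "8 \<le> G * \<Lambda>" "\<delta> * \<Lambda> \<le> real n" and n: "real n > 0" using \<Lambda> by linarith+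
  have y: "y \<ge> 1" using \<Lambda> G\<Lambda> unfolding y_def by simp
  have yx: "y \<le> x" unfolding x_def y_def
    using \<open>\<delta> * \<Lambda> \<le> G * \<Lambda>\<close> \<delta> \<Lambda>0 n by (intro divide_left_mono mult_pos_pos) auto
  have rnd: "z \<le> real (nat \<lceil>z\<rceil>)" "real (nat \<lceil>z\<rceil>) \<le> 2 * z" "real (nat \<lfloor>z\<rfloor>) \<le> z" "z / 2 \<le> real (nat \<lfloor>z\<rfloor>)"
    if "z \<ge> 1" for z :: real
  proof -
    have "real (nat \<lceil>z\<rceil>) = real_of_int \<lceil>z\<rceil>" "real (nat \<lfloor>z\<rfloor>) = real_of_int \<lfloor>z\<rfloor>" using that by auto
    moreover have "1 \<le> \<lfloor>z\<rfloor>" using that by simp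
    ultimately show "z \<le> real (nat \<lceil>z\<rceil>)" "real (nat \<lceil>z\<rceil>) \<le> 2 * z" "real (nat \<lfloor>z\<rfloor>) \<le> z" "z / 2 \<le> real (nat \<lfloor>z\<rfloor>)"
      using that by linarith+
  qed
  have x: "x \<ge> 1" using y yx by simp
  note K = rnd(1,2)[OF x, unfolded x_def, folded K_def x_def]
  note K0 = rnd(3,4)[OF y, unfolded y_def, folded K\<^sub>0_def y_def]
  have K0': "real K\<^sub>0 > 0" and K': "real K > 0" using K K0 y yx by linarith+
  show "1 \<le> K\<^sub>0" using K0' by simp
  have "real K\<^sub>0 \<le> real K" using K K0 yx by linarith
  then show "K\<^sub>0 \<le> K" by simp
  have "x \<le> real n / 8" unfolding x_def using \<Lambda> n by (intro divide_left_mono) auto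
  then have "real K \<le> real n" using K by linarith
  then show "K \<le> n" by simp
  show "real K \<le> 2 * real n / (\<delta> * \<Lambda>)" using K unfolding x_def by simp
  have "real n = x * (\<delta> * \<Lambda>)" unfolding x_def using \<delta> \<Lambda>0 by simp
  also have "\<dots> \<le> real K * (\<delta> * \<Lambda>)" using K \<Lambda> by (intro mult_right_mono) auto
  finally show "real n / real K \<le> \<delta> * \<Lambda>" using K' by (simp add: divide_le_eq mult.commute)
  show "real K\<^sub>0 \<le> real n / (G * \<Lambda>)" using K0 unfolding y_def by simp
  have "real K / real K\<^sub>0 \<le> (2 * x) / (y / 2)" using K K0 y yx by (intro frac_le) auto
  also have "\<dots> = 4 * G / \<delta>" unfolding x_def y_def using n \<Lambda>0 by simp
  finally show "real K / real K\<^sub>0 \<le> 4 * G / \<delta>" .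
qed

text \<open>The square-free polynomials are covered by four sets: values above n^A, a large block
  above \<open>K\<^sub>0\<close>, a large block below it, and the rest. On the two middle sets the
  values are below n^A, so a proportion n^(-k A) makes them harmless; this determines
  \<open>G\<close>. The rest gives the main term, and \<delta> enters its exponent twice, through n
  / K and through the upper block.\<close>

lemma L_fun_moment_le:
  fixes k n :: nat and \<delta> :: real
  defines "c \<equiv> bconst (real CARD('a::{field,finite}))" and "\<Lambda> \<equiv> ln (real n)"
  defines "A \<equiv> 19 + 4 * c + exp (16 * (real k + 2))"
  defines "G \<equiv> 324 * real k ^ 2 + real k * A + 1"
  assumes odd: "odd CARD('a)" and u: "norm u = real CARD('a) powr (- 1 / 2)" and k: "k > 0"
    and \<delta>: "\<delta> > 0" "\<delta> \<le> 1"
    and n: "\<delta> * \<Lambda> \<ge> 8" "G * \<Lambda> \<le> real n" "\<Lambda> / 2 + c < real n"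
  shows "(\<Sum>D\<in>(monic_squarefree n :: 'a poly set). norm (L_fun D u) ^ k) \<le>
    (2 * exp (real k) + exp (exp (2 * (4 * real k * A / \<delta>)) * ln (4 * G / \<delta>) / 2) + exp 2 +
      4 * exp (real k * c + real k ^ 2 / 2)) *
    real CARD('a) ^ n * exp ((real k * (real k + 1) / 2 + 2 * real k * \<delta>) * \<Lambda>)"
proof -
  let ?q = "real CARD('a)" and ?H = "monic_squarefree n :: 'a poly set"
  let ?F = "exp ((real k * (real k + 1) / 2 + 2 * real k * \<delta>) * \<Lambda>)"
  have "c \<ge> 0" unfolding c_def using card_gt_1[where 'a='a] by (intro bconst_nonneg) simp
  then have A: "A \<ge> 0" unfolding A_def by (intro add_nonneg_nonneg) auto
  have G: "G \<ge> 1" unfolding G_def using A by (simp add: mult_nonneg_nonneg)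
  have \<Lambda>0: "\<Lambda> > 0" using zero_less_mult_pos[of \<delta> \<Lambda>] \<delta> n by linarith
  have "\<delta> * \<Lambda> \<le> \<Lambda>" using \<delta> \<Lambda>0 by simp
  then have \<Lambda>8: "\<Lambda> \<ge> 8" using n by linarith
  have "1 * \<Lambda> \<le> G * \<Lambda>" using G \<Lambda>0 by (intro mult_right_mono) auto
  then have G\<Lambda>: "G * \<Lambda> \<ge> 4" using \<Lambda>8 by linarith
  define K where "K = nat \<lceil>real n / (\<delta> * \<Lambda>)\<rceil>"
  define K\<^sub>0 where "K\<^sub>0 = nat \<lfloor>real n / (G * \<Lambda>)\<rfloor>"
  have "\<delta> \<le> G" using \<delta> G by simp
  note K = block_lengths[OF \<delta>(1) this n(1,2), folded K_def K\<^sub>0_def]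
  have F1: "1 \<le> ?F" using \<Lambda>0 \<delta> by (simp add: mult_nonneg_nonneg)
  define S\<^sub>1 where "S\<^sub>1 = {D. D \<in> ?H \<and> exp (A * \<Lambda>) \<le> norm (L_fun D u)}"
  define S\<^sub>2 where "S\<^sub>2 = {D. D \<in> ?H \<and> norm (L_fun D u) < exp (A * \<Lambda>) \<and> \<delta> * \<Lambda> \<le> \<bar>prime_sum K u {K\<^sub>0<..K} D\<bar>}"
  define S\<^sub>3 where "S\<^sub>3 = {D. D \<in> ?H \<and> norm (L_fun D u) < exp (A * \<Lambda>) \<and> G * \<Lambda> / (6 * real k) \<le> \<bar>prime_sum K u {0<..K\<^sub>0} D\<bar>}"
  define S\<^sub>4 where "S\<^sub>4 = {D. D \<in> ?H \<and> \<bar>prime_sum K u {K\<^sub>0<..K} D\<bar> < \<delta> * \<Lambda> \<and> \<bar>prime_sum K u {0<..K\<^sub>0} D\<bar> < G * \<Lambda> / (6 * real k)}"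
  have fin: "finite ?H" by (rule finite_monic_squarefree)
  have finS: "finite S\<^sub>1" "finite S\<^sub>2" "finite S\<^sub>3" "finite S\<^sub>4"
    unfolding S\<^sub>1_def S\<^sub>2_def S\<^sub>3_def S\<^sub>4_def using fin by auto
  let ?f = "\<lambda>D :: 'a poly. norm (L_fun D u) ^ k"
  let ?Q2 = "?q ^ n * exp (exp (2 * (4 * real k * A / \<delta>)) * ln (4 * G / \<delta>) / 2)"
  have "?H \<subseteq> S\<^sub>1 \<union> S\<^sub>2 \<union> S\<^sub>3 \<union> S\<^sub>4" unfolding S\<^sub>1_def S\<^sub>2_def S\<^sub>3_def S\<^sub>4_def by auto
  then have "sum ?f ?H \<le> sum ?f (S\<^sub>1 \<union> S\<^sub>2 \<union> S\<^sub>3 \<union> S\<^sub>4)"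
    using finS by (intro sum_mono2) auto
  also have "\<dots> \<le> sum ?f S\<^sub>1 + sum ?f S\<^sub>2 + sum ?f S\<^sub>3 + sum ?f S\<^sub>4"
  proof -
    have U: "sum ?f (X' \<union> Y') \<le> sum ?f X' + sum ?f Y'" if "finite X'" "finite Y'" for X' Y'
      using sum.union_inter[OF that, of ?f] sum_nonneg[of "X' \<inter> Y'" ?f] by simp
    show ?thesis using U[of "S\<^sub>1 \<union> S\<^sub>2 \<union> S\<^sub>3" "S\<^sub>4"] U[of "S\<^sub>1 \<union> S\<^sub>2" "S\<^sub>3"] U[of "S\<^sub>1" "S\<^sub>2"] finS by simp
  qed
  also have "\<dots> \<le> 2 * exp (real k) * ?q ^ n + ?Q2 + ?q ^ n * exp 2 +
      4 * exp (real k * c + real k ^ 2 / 2) * ?q ^ n * ?F"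
  proof (intro add_mono)
    show "sum ?f S\<^sub>1 \<le> 2 * exp (real k) * ?q ^ n"
      unfolding S\<^sub>1_def \<Lambda>_def
      by (rule large_values_sum[OF odd u]) (use \<Lambda>8 n in \<open>auto simp: A_def c_def \<Lambda>_def\<close>)
    show "sum ?f S\<^sub>2 \<le> ?Q2"
    proof (rule bounded_values_sum[OF finS(2)])
      show "norm (L_fun D u) \<le> exp (A * \<Lambda>)" if "D \<in> S\<^sub>2" for D using that unfolding S\<^sub>2_def by simp
      have B: "0 \<le> 4 * real k * A / \<delta>" using A \<delta> by simp
      have "real (card S\<^sub>2) \<le> real (card {D \<in> ?H. \<delta> * \<Lambda> \<le> \<bar>prime_sum K u {K\<^sub>0<..K} D\<bar>})"
        unfolding of_nat_le_iff S\<^sub>2_def by (intro card_mono) (use fin in auto)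
      also have "\<dots> \<le> ?Q2 * exp (- (4 * real k * A / \<delta>) * (\<delta> * \<Lambda> / 4))"
        by (rule upper_block_count[OF odd u K(1,2) n(1) K(4,7) B])
      also have "- (4 * real k * A / \<delta>) * (\<delta> * \<Lambda> / 4) = - (real k * (A * \<Lambda>))" using \<delta> by simp
      finally show "real (card S\<^sub>2) \<le> ?Q2 * exp (- (real k * (A * \<Lambda>)))" .
    qed
    show "sum ?f S\<^sub>3 \<le> ?q ^ n * exp 2"
    proof (rule bounded_values_sum[OF finS(3)])
      show "norm (L_fun D u) \<le> exp (A * \<Lambda>)" if "D \<in> S\<^sub>3" for D using that unfolding S\<^sub>3_def by simp
      have n1: "ln (real n) \<ge> 1" using \<Lambda>8 unfolding \<Lambda>_def by simp
      have "real (card S\<^sub>3) \<le> real (card {D \<in> ?H. G * \<Lambda> / (6 * real k) \<le> \<bar>prime_sum K u {0<..K\<^sub>0} D\<bar>})"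
        unfolding of_nat_le_iff S\<^sub>3_def by (intro card_mono) (use fin in auto)
      also have "\<dots> \<le> ?q ^ n * exp 2 * exp (- (G - 324 * real k ^ 2) * \<Lambda>)"
        unfolding \<Lambda>_def by (rule lower_block_count[OF odd u K(1,2,3) n1 G K(6)[unfolded \<Lambda>_def] k])
      also have "\<dots> \<le> ?q ^ n * exp 2 * exp (- (real k * (A * \<Lambda>)))"
      proof (intro mult_left_mono)
        have "G - 324 * real k ^ 2 = real k * A + 1" unfolding G_def by simp
        then have "real k * (A * \<Lambda>) \<le> (G - 324 * real k ^ 2) * \<Lambda>" using \<Lambda>0 by (simp add: distrib_right)
        then show "exp (- (G - 324 * real k ^ 2) * \<Lambda>) \<le> exp (- (real k * (A * \<Lambda>)))"
          by (simp only: mult_minus_left exp_le_cancel_iff neg_le_iff_le)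
      qed simp
      finally show "real (card S\<^sub>3) \<le> ?q ^ n * exp 2 * exp (- (real k * (A * \<Lambda>)))" .
    qed
    have "real k * (2 * (\<delta> * \<Lambda>) + \<Lambda> / 2) + real k ^ 2 * \<Lambda> / 2 =
      (real k * (real k + 1) / 2 + 2 * real k * \<delta>) * \<Lambda>" by (simp add: field_simps power2_eq_square)
    moreover have "ln (real n) \<ge> 1" "G * ln (real n) \<ge> 4" using \<Lambda>8 G\<Lambda> unfolding \<Lambda>_def by simp_all
    note typical_values_sum[OF odd u K(1,2,3) this K(6)[unfolded \<Lambda>_def] k K(5), folded \<Lambda>_def c_def, folded S\<^sub>4_def]
    ultimately show "sum ?f S\<^sub>4 \<le> 4 * exp (real k * c + real k ^ 2 / 2) * ?q ^ n * ?F" by simp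
  qed
  also have "\<dots> \<le> (2 * exp (real k) + exp (exp (2 * (4 * real k * A / \<delta>)) * ln (4 * G / \<delta>) / 2) + exp 2 +
      4 * exp (real k * c + real k ^ 2 / 2)) * ?q ^ n * ?F"
  proof -
    have gen: "a * Q + Q * b + Q * d + e * Q * F \<le> (a + b + d + e) * Q * F"
      if "a \<ge> 0" "b \<ge> 0" "d \<ge> 0" "Q \<ge> 0" "1 \<le> F" for a b d e Q F :: real
    proof -
      have "(a + b + d) * Q * 1 \<le> (a + b + d) * Q * F" using that by (intro mult_left_mono) auto
      then show ?thesis by (simp add: algebra_simps)
    qed
    show ?thesis by (rule gen) (use F1 in auto)
  qed
  finally show ?thesis .
qed

lemma L_fun_moment:
  fixes k :: nat and \<epsilon> :: real
  assumes odd: "odd CARD('a::{field,finite})" and k: "k > 0" and \<epsilon>: "\<epsilon> > 0"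
  obtains C where "C \<ge> 0" "eventually (\<lambda>n. \<forall>u. norm u = real CARD('a) powr (- 1 / 2) \<longrightarrow>
    (\<Sum>D\<in>(monic_squarefree n :: 'a poly set). norm (L_fun D u) ^ k) \<le>
      C * real CARD('a) ^ n * real n powr (real k * (real k + 1) / 2 + \<epsilon>)) sequentially"
proof -
  define \<delta> where "\<delta> = min 1 (\<epsilon> / (2 * real k))"
  have \<delta>: "\<delta> > 0" "\<delta> \<le> 1" and "\<delta> \<le> \<epsilon> / (2 * real k)" unfolding \<delta>_def using k \<epsilon> by auto
  then have "2 * real k * \<delta> \<le> 2 * real k * (\<epsilon> / (2 * real k))" by (intro mult_left_mono) auto
  then have \<delta>2: "2 * real k * \<delta> \<le> \<epsilon>" using k by simp
  define c where "c = bconst (real CARD('a))"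
  define A where "A = 19 + 4 * c + exp (16 * (real k + 2))"
  define G where "G = 324 * real k ^ 2 + real k * A + 1"
  define C where "C = 2 * exp (real k) + exp (exp (2 * (4 * real k * A / \<delta>)) * ln (4 * G / \<delta>) / 2) + exp 2 +
      4 * exp (real k * c + real k ^ 2 / 2)"
  have C: "C \<ge> 0" unfolding C_def by (intro add_nonneg_nonneg) auto
  have "eventually (\<lambda>n. \<delta> * ln (real n) \<ge> 8) sequentially" using \<delta> by real_asymp
  moreover have "eventually (\<lambda>n. G * ln (real n) \<le> real n) sequentially" by real_asymp
  moreover have "eventually (\<lambda>n. ln (real n) / 2 + c < real n) sequentially" by real_asymp
  ultimately have "eventually (\<lambda>n. \<forall>u. norm u = real CARD('a) powr (- 1 / 2) \<longrightarrow>
    (\<Sum>D\<in>(monic_squarefree n :: 'a poly set). norm (L_fun D u) ^ k) \<le>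
      C * real CARD('a) ^ n * real n powr (real k * (real k + 1) / 2 + \<epsilon>)) sequentially"
    using eventually_gt_at_top[of 0]
  proof eventually_elim
    case (elim n)
    have n: "real n \<ge> 1" using elim by simp
    show ?case
    proof (intro allI impI)
      fix u :: complex assume u: "norm u = real CARD('a) powr (- 1 / 2)"
      have "(\<Sum>D\<in>(monic_squarefree n :: 'a poly set). norm (L_fun D u) ^ k) \<le>
        C * real CARD('a) ^ n * exp ((real k * (real k + 1) / 2 + 2 * real k * \<delta>) * ln (real n))"
        unfolding C_def A_def G_def c_def
        by (rule L_fun_moment_le[OF odd u k \<delta>]) (use elim in \<open>auto simp: A_def G_def c_def\<close>)
      also have "\<dots> = C * real CARD('a) ^ n * real n powr (real k * (real k + 1) / 2 + 2 * real k * \<delta>)"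
        using n by (simp add: powr_def)
      also have "\<dots> \<le> C * real CARD('a) ^ n * real n powr (real k * (real k + 1) / 2 + \<epsilon>)"
        using C n \<delta>2 by (intro mult_left_mono powr_mono mult_nonneg_nonneg) auto
      finally show "(\<Sum>D\<in>(monic_squarefree n :: 'a poly set). norm (L_fun D u) ^ k) \<le>
        C * real CARD('a) ^ n * real n powr (real k * (real k + 1) / 2 + \<epsilon>)" .
    qed
  qed
  with C show ?thesis by (rule that)
qed

section \<open>Moments of derivatives\<close>

definition root_unity :: "nat \<Rightarrow> complex" where
  "root_unity M = exp (2 * of_real pi * \<i> / of_nat M)"

lemma root_unity_power: "root_unity M ^ e = exp (2 * of_real pi * \<i> * of_nat e / of_nat M)"
  unfolding root_unity_def exp_of_nat_mult[symmetric] by (simp add: mult_ac)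

lemma norm_root_unity [simp]: "norm (root_unity M) = 1"
proof -
  have "root_unity M = exp (\<i> * of_real (2 * pi / real M))"
    unfolding root_unity_def by (simp add: mult_ac)
  then show ?thesis by (metis norm_exp_i_times)
qed

lemma root_unity_power_eq_1_iff: "M > 0 \<Longrightarrow> root_unity M ^ e = 1 \<longleftrightarrow> M dvd e"
  unfolding root_unity_power by (rule complex_root_unity_eq_1) simp

lemma sum_root_unity:
  assumes "M > 0"
  shows "(\<Sum>j<M. root_unity M ^ (j * e)) = (if M dvd e then of_nat M else 0)"
proof (cases "M dvd e")
  case True
  then have "root_unity M ^ (j * e) = 1" for j using assms by (simp add: root_unity_power_eq_1_iff)
  then show ?thesis using True by simp
next
  case False
  let ?z = "root_unity M ^ e"
  have z: "?z \<noteq> 1" using False assms by (simp add: root_unity_power_eq_1_iff)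
  have "(\<Sum>j<M. root_unity M ^ (j * e)) = (\<Sum>j<M. ?z ^ j)" by (simp add: mult.commute flip: power_mult)
  also have "\<dots> = (?z ^ M - 1) / (?z - 1)" using z by (rule geometric_sum)
  also have "?z ^ M = 1" unfolding power_mult[symmetric] using assms by (simp add: root_unity_power_eq_1_iff)
  finally show ?thesis using False by simp
qed

lemma cnj_root_unity_power:
  assumes "M > 0" "b \<le> M"
  shows "cnj (root_unity M ^ (b * j)) = root_unity M ^ ((M - b) * j)"
proof -
  let ?z = "root_unity M ^ (b * j)"
  have "?z * root_unity M ^ ((M - b) * j) = root_unity M ^ (M * j)"
    unfolding power_add[symmetric] distrib_right[symmetric] using assms by simp
  also have "\<dots> = 1" using assms by (simp add: root_unity_power_eq_1_iff)
  finally have 1: "?z * root_unity M ^ ((M - b) * j) = 1" .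
  have "?z * cnj ?z = 1" unfolding complex_norm_square[symmetric] by (simp add: norm_power)
  then have "cnj ?z * (?z * root_unity M ^ ((M - b) * j)) = root_unity M ^ ((M - b) * j)"
    by (metis mult.assoc mult.commute mult_1)
  then show ?thesis unfolding 1 by simp
qed

definition fejer :: "nat \<Rightarrow> nat \<Rightarrow> real" where
  "fejer n j = (norm (\<Sum>a<n. root_unity (2 * n) ^ (a * j)))\<^sup>2"

lemma fejer_nonneg [simp]: "fejer n j \<ge> 0"
  by (simp add: fejer_def)

text \<open>Summed over all 2 n roots, the kernel has Fourier coefficient 2 n (n - |s|) at
  frequencies |s| \<le> n. The alternating factor \<open>root_unity (2 * n) ^ (j * n)\<close> shifts
  the frequency by n, so for 0 \<le> m \<le> n the coefficient becomes 2 n m: the multiplier of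
  differentiation.\<close>

lemma fejer_moment:
  assumes n: "n > 0" and m: "m \<le> n"
  shows "(\<Sum>j<2*n. root_unity (2 * n) ^ (j * n) * of_real (fejer n j) * root_unity (2 * n) ^ (j * m)) =
    2 * of_nat n * of_nat m"
proof -
  let ?w = "root_unity (2 * n)"
  have M: "2 * n > 0" using n by simp
  have "of_real (fejer n j) = (\<Sum>b<n. \<Sum>a<n. ?w ^ (a * j) * ?w ^ ((2 * n - b) * j))" for j
  proof -
    have "of_real (fejer n j) = (\<Sum>a<n. ?w ^ (a * j)) * cnj (\<Sum>b<n. ?w ^ (b * j))"
      unfolding fejer_def complex_norm_square ..
    also have "cnj (\<Sum>b<n. ?w ^ (b * j)) = (\<Sum>b<n. ?w ^ ((2 * n - b) * j))"
      unfolding cnj_sum by (rule sum.cong) (use cnj_root_unity_power[OF M] in auto)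
    finally show ?thesis unfolding sum_product by (subst sum.swap)
  qed
  then have "(\<Sum>j<2*n. ?w ^ (j * n) * of_real (fejer n j) * ?w ^ (j * m)) =
    (\<Sum>j<2*n. \<Sum>b<n. \<Sum>a<n. ?w ^ (j * (n + a + (2 * n - b) + m)))"
    by (simp only: sum_distrib_left sum_distrib_right power_add distrib_left mult_ac)
  also have "\<dots> = (\<Sum>b<n. \<Sum>a<n. \<Sum>j<2*n. ?w ^ (j * (n + a + (2 * n - b) + m)))"
    by (subst sum.swap) (intro sum.cong refl sum.swap)
  also have "\<dots> = (\<Sum>b<n. \<Sum>a<n. if a = b + (n - m) then 2 * of_nat n else 0)"
  proof (intro sum.cong refl)
    fix a b assume ab: "b \<in> {..<n}" "a \<in> {..<n}"
    have "2 * n dvd n + a + (2 * n - b) + m \<longleftrightarrow> a = b + (n - m)"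
    proof
      assume "2 * n dvd n + a + (2 * n - b) + m"
      then obtain r where r: "n + a + (2 * n - b) + m = 2 * n * r" ..
      have "2 * n * 1 < 2 * n * r" "2 * n * r < 2 * n * 3"
        unfolding r[symmetric] using ab m by auto
      \<comment> \<open>The multiple of 2 n lies strictly between 2 n and 6 n.\<close>
      then have "r = 2" by (simp only: mult_less_cancel1) simp
      then show "a = b + (n - m)" using r ab m by auto
    next
      assume "a = b + (n - m)"
      then have "n + a + (2 * n - b) + m = 2 * n * 2" using ab m by auto
      then show "2 * n dvd n + a + (2 * n - b) + m" by (metis dvd_triv_left)
    qed
    then show "(\<Sum>j<2*n. ?w ^ (j * (n + a + (2 * n - b) + m))) = (if a = b + (n - m) then 2 * of_nat n else 0)"
      unfolding sum_root_unity[OF M] by simp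
  qed
  also have "\<dots> = (\<Sum>b<n. if b < m then 2 * of_nat n else 0)"
    by (intro sum.cong refl) (use m in auto)
  also have "\<dots> = (\<Sum>b<m. 2 * of_nat n)"
    by (rule sum.mono_neutral_cong_right) (use m in auto)
  finally show ?thesis by simp
qed

text \<open>The case m = n of \<open>fejer_moment\<close>, where the two powers of the root of unity
  cancel. It gives the total mass of the weights.\<close>

lemma sum_fejer:
  assumes n: "n > 0"
  shows "(\<Sum>j<2*n. fejer n j) = 2 * real n ^ 2"
proof -
  have "root_unity (2 * n) ^ (j * n) * root_unity (2 * n) ^ (j * n) = 1" for j
    unfolding power_add[symmetric] mult_2[symmetric] using n
    by (subst root_unity_power_eq_1_iff) (auto simp: mult_ac)
  then have "(\<Sum>j<2*n. root_unity (2 * n) ^ (j * n) * of_real (fejer n j) * root_unity (2 * n) ^ (j * n)) =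
    of_real (\<Sum>j<2*n. fejer n j)" by (simp add: mult_ac flip: mult.assoc)
  then have "complex_of_real (\<Sum>j<2*n. fejer n j) = of_real (2 * real n ^ 2)"
    unfolding fejer_moment[OF n order_refl] by (simp add: power2_eq_square mult.assoc)
  then show ?thesis by (simp only: of_real_eq_iff)
qed

lemma fejer_interpolation:
  fixes p :: "complex poly"
  assumes n: "n > 0" and p: "degree p \<le> n"
  shows "(\<Sum>j<2*n. root_unity (2 * n) ^ (j * n) * of_real (fejer n j) * poly p (\<zeta> * root_unity (2 * n) ^ j)) =
    2 * of_nat n * (\<zeta> * poly (pderiv p) \<zeta>)"
proof -
  let ?w = "root_unity (2 * n)"
  have pm: "p = (\<Sum>m\<le>n. monom (coeff p m) m)" using poly_as_sum_of_monoms'[OF p] by simp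
  have val: "poly p x = (\<Sum>m\<le>n. coeff p m * x ^ m)" for x
    by (subst pm) (simp add: poly_sum poly_monom)
  have der: "\<zeta> * poly (pderiv p) \<zeta> = (\<Sum>m\<le>n. coeff p m * \<zeta> ^ m * of_nat m)"
  proof -
    have "pderiv p = (\<Sum>m\<le>n. pderiv (monom (coeff p m) m))"
      using arg_cong[OF pm, of pderiv] higher_pderiv_sum[of 1 "\<lambda>m. monom (coeff p m) m" "{..n}"] by simp
    then have "\<zeta> * poly (pderiv p) \<zeta> = (\<Sum>m\<le>n. \<zeta> * poly (pderiv (monom (coeff p m) m)) \<zeta>)"
      by (simp only: poly_sum sum_distrib_left)
    also have "\<dots> = (\<Sum>m\<le>n. coeff p m * \<zeta> ^ m * of_nat m)"
      by (intro sum.cong refl, case_tac x) (auto simp: pderiv_monom poly_monom)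
    finally show ?thesis .
  qed
  have "(\<Sum>j<2*n. ?w ^ (j * n) * of_real (fejer n j) * poly p (\<zeta> * ?w ^ j)) =
    (\<Sum>j<2*n. \<Sum>m\<le>n. coeff p m * \<zeta> ^ m * (?w ^ (j * n) * of_real (fejer n j) * ?w ^ (j * m)))"
    unfolding val by (simp only: sum_distrib_left power_mult_distrib power_mult mult_ac)
  also have "\<dots> = (\<Sum>m\<le>n. coeff p m * \<zeta> ^ m * (\<Sum>j<2*n. ?w ^ (j * n) * of_real (fejer n j) * ?w ^ (j * m)))"
    by (subst sum.swap) (simp only: sum_distrib_left)
  also have "\<dots> = (\<Sum>m\<le>n. coeff p m * \<zeta> ^ m * (2 * of_nat n * of_nat m))"
    by (intro sum.cong refl arg_cong2[where f = "(*)"] fejer_moment[OF n]) simp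
  also have "\<dots> = 2 * of_nat n * (\<zeta> * poly (pderiv p) \<zeta>)"
    unfolding der sum_distrib_left by (simp only: mult_ac)
  finally show ?thesis .
qed

lemma weighted_power_mean:
  fixes a y :: "'b \<Rightarrow> real"
  assumes "finite I" "\<And>i. i \<in> I \<Longrightarrow> a i \<ge> 0" "\<And>i. i \<in> I \<Longrightarrow> y i \<ge> 0" "sum a I = 1"
  shows "(\<Sum>i\<in>I. a i * y i) ^ k \<le> (\<Sum>i\<in>I. a i * y i ^ k)"
proof -
  have "convex_on {0..} (\<lambda>x::real. x ^ k)"
    using convex_power_odd convex_on_subset[OF convex_power_even] by (cases "even k") auto
  moreover have "I \<noteq> {}" using assms by auto
  ultimately show ?thesis using convex_on_sum[of I "{0..}" "\<lambda>x. x ^ k" a y] assms by simp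
qed

text \<open>The nonnegative weights divided by their total mass 2 n^2 form a mean, and interpolation
  bounds R |p'| by n times a mean of |p| at points of the same circle. Jensen's inequality carries
  the k-th power inside, and interchanging the sums reduces to the hypothesis, which has to hold on
  the whole circle.\<close>

lemma pderiv_moment_le:
  fixes p :: "'d \<Rightarrow> complex poly"
  assumes n: "n > 0" and deg: "\<And>D. D \<in> S \<Longrightarrow> degree (p D) \<le> n" and R: "R > 0"
    and A: "\<And>\<zeta>. norm \<zeta> = R \<Longrightarrow> (\<Sum>D\<in>S. norm (poly (p D) \<zeta>) ^ k) \<le> A" and \<zeta>: "norm \<zeta> = R"
  shows "(\<Sum>D\<in>S. norm (poly (pderiv (p D)) \<zeta>) ^ k) \<le> (real n / R) ^ k * A"
proof -
  define a where "a j = fejer n j / (2 * real n ^ 2)" for j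
  have a: "a j \<ge> 0" for j unfolding a_def by simp
  have a1: "(\<Sum>j<2*n. a j) = 1"
    unfolding a_def sum_divide_distrib[symmetric] sum_fejer[OF n] using n by simp
  let ?w = "root_unity (2 * n)"
  have bound: "norm (poly (pderiv (p D)) \<zeta>) \<le> real n / R * (\<Sum>j<2*n. a j * norm (poly (p D) (\<zeta> * ?w ^ j)))"
    if "D \<in> S" for D
  proof -
    have "2 * real n * (R * norm (poly (pderiv (p D)) \<zeta>)) =
      norm (\<Sum>j<2*n. ?w ^ (j * n) * of_real (fejer n j) * poly (p D) (\<zeta> * ?w ^ j))"
      unfolding fejer_interpolation[OF n deg[OF that]] by (simp add: norm_mult \<zeta>)
    also have "\<dots> \<le> (\<Sum>j<2*n. norm (?w ^ (j * n) * of_real (fejer n j) * poly (p D) (\<zeta> * ?w ^ j)))"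
      by (rule norm_sum)
    also have "\<dots> = (\<Sum>j<2*n. 2 * real n ^ 2 * (a j * norm (poly (p D) (\<zeta> * ?w ^ j))))"
      unfolding a_def using n by (intro sum.cong refl) (simp add: norm_mult norm_power)
    also have "\<dots> = 2 * real n * (real n * (\<Sum>j<2*n. a j * norm (poly (p D) (\<zeta> * ?w ^ j))))"
      unfolding sum_distrib_left by (simp add: power2_eq_square mult_ac)
    finally have "R * norm (poly (pderiv (p D)) \<zeta>) \<le> real n * (\<Sum>j<2*n. a j * norm (poly (p D) (\<zeta> * ?w ^ j)))"
      using n by simp
    then show ?thesis using R by (simp add: field_simps)
  qed
  have "(\<Sum>D\<in>S. norm (poly (pderiv (p D)) \<zeta>) ^ k) \<le>
    (\<Sum>D\<in>S. (real n / R) ^ k * (\<Sum>j<2*n. a j * norm (poly (p D) (\<zeta> * ?w ^ j)) ^ k))"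
  proof (rule sum_mono)
    fix D assume "D \<in> S"
    then have "norm (poly (pderiv (p D)) \<zeta>) ^ k \<le> (real n / R * (\<Sum>j<2*n. a j * norm (poly (p D) (\<zeta> * ?w ^ j)))) ^ k"
      by (intro power_mono bound) auto
    also have "\<dots> \<le> (real n / R) ^ k * (\<Sum>j<2*n. a j * norm (poly (p D) (\<zeta> * ?w ^ j)) ^ k)"
      unfolding power_mult_distrib using R by (intro mult_left_mono weighted_power_mean) (auto simp: a a1)
    finally show "norm (poly (pderiv (p D)) \<zeta>) ^ k \<le> (real n / R) ^ k * (\<Sum>j<2*n. a j * norm (poly (p D) (\<zeta> * ?w ^ j)) ^ k)" .
  qed
  also have "\<dots> = (real n / R) ^ k * (\<Sum>j<2*n. a j * (\<Sum>D\<in>S. norm (poly (p D) (\<zeta> * ?w ^ j)) ^ k))"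
    unfolding sum_distrib_left by (rule sum.swap)
  also have "\<dots> \<le> (real n / R) ^ k * (\<Sum>j<2*n. a j * A)"
    using R by (intro mult_left_mono sum_mono A a) (auto simp: norm_mult norm_power \<zeta>)
  also have "\<dots> = (real n / R) ^ k * A" unfolding sum_distrib_right[symmetric] a1 by simp
  finally show ?thesis .
qed

lemma higher_pderiv_moment_le:
  fixes p :: "'d \<Rightarrow> complex poly"
  assumes n: "n > 0" and deg: "\<And>D. D \<in> S \<Longrightarrow> degree (p D) \<le> n" and R: "R > 0"
    and A: "\<And>\<zeta>. norm \<zeta> = R \<Longrightarrow> (\<Sum>D\<in>S. norm (poly (p D) \<zeta>) ^ k) \<le> A" and \<zeta>: "norm \<zeta> = R"
  shows "(\<Sum>D\<in>S. norm (poly ((pderiv ^^ l) (p D)) \<zeta>) ^ k) \<le> (real n / R) ^ (l * k) * A"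
  using \<zeta>
proof (induction l arbitrary: \<zeta>)
  case 0
  then show ?case using A by simp
next
  case (Suc l)
  have "degree ((pderiv ^^ l) (p D)) \<le> n" if "D \<in> S" for D
    using deg[OF that] by (simp add: degree_higher_pderiv)
  from pderiv_moment_le[OF n this R Suc.IH Suc.prems]
  have "(\<Sum>D\<in>S. norm (poly (pderiv ((pderiv ^^ l) (p D))) \<zeta>) ^ k) \<le> (real n / R) ^ k * ((real n / R) ^ (l * k) * A)"
    by simp
  then show ?case by (simp add: power_add mult_ac)
qed

lemma higher_deriv_poly: "(deriv ^^ l) (poly p) = poly ((pderiv ^^ l) p)" for p :: "complex poly"
proof (induction l)
  case (Suc l)
  have "deriv (poly r) = poly (pderiv r)" for r :: "complex poly"
    by (rule ext) (rule DERIV_imp_deriv[OF poly_DERIV])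
  then show ?case using Suc by simp
qed simp

section \<open>The number of square-free polynomials\<close>

lemma not_squarefree_monicE:
  fixes D :: "'a::field poly"
  assumes "D \<in> monic_polys" "\<not> squarefree D"
  obtains B where "B \<in> monic_polys" "degree B > 0" "B\<^sup>2 dvd D"
proof -
  have D0: "D \<noteq> 0" using assms(1) by (rule monic_nonzero)
  obtain x where x: "x\<^sup>2 dvd D" "\<not> x dvd 1" using assms(2) unfolding squarefree_def by blast
  have x0: "x \<noteq> 0" using x(1) D0 by auto
  define B where "B = smult (inverse (lead_coeff x)) x"
  have "B \<in> monic_polys" unfolding B_def monic_polys_def using x0 by simp
  moreover have "degree B > 0" unfolding B_def using x0 x(2) by (simp add: is_unit_iff_degree)
  moreover have "B\<^sup>2 dvd D" unfolding B_def using x(1) x0 by (simp add: power2_eq_square smult_dvd)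
  ultimately show ?thesis by (rule that)
qed

lemma not_squarefree_subset:
  "monic_deg n - monic_squarefree n \<subseteq>
    (\<Union>d\<in>{1..n div 2}. (\<lambda>(B, C). B\<^sup>2 * C) ` (monic_deg d \<times> (monic_deg (n - 2 * d) :: 'a::field poly set)))"
proof
  fix D :: "'a poly" assume "D \<in> monic_deg n - monic_squarefree n"
  then have D: "D \<in> monic_polys" "degree D = n" "\<not> squarefree D"
    by (auto simp: monic_deg_def monic_squarefree_def)
  obtain B C where B: "B \<in> monic_polys" "degree B > 0" "D = B\<^sup>2 * C"
    using not_squarefree_monicE[OF D(1,3)] by (metis dvdE)
  have C: "C \<in> monic_polys" using monic_cancel[OF monic_power[OF B(1), of 2]] D(1) B(3) by simp
  have "n = 2 * degree B + degree C"
    using monic_nonzero[OF B(1)] monic_nonzero[OF C] D(2) unfolding B(3)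
    by (simp add: degree_mult_eq degree_power_eq)
  then have "degree B \<in> {1..n div 2}" "(B, C) \<in> monic_deg (degree B) \<times> monic_deg (n - 2 * degree B)"
    using B C by (auto simp: monic_deg_def)
  then show "D \<in> (\<Union>d\<in>{1..n div 2}. (\<lambda>(B, C). B\<^sup>2 * C) ` (monic_deg d \<times> monic_deg (n - 2 * d)))"
    using B(3) by force
qed

text \<open>The additional term on the left makes the induction close: it is at least three times
  its successor, which pays for the two copies of the new summand.\<close>

lemma two_geometric_le:
  fixes q :: nat
  assumes "q \<ge> 3" "m \<le> n"
  shows "2 * (\<Sum>d\<in>{1..m}. q ^ (n - d)) + q ^ (n - m) \<le> q ^ n"
  using assms(2)
proof (induction m)
  case (Suc m)
  have "3 * q ^ (n - Suc m) \<le> q * q ^ (n - Suc m)" using assms(1) by (rule mult_right_mono) simp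
  also have "\<dots> = q ^ (n - m)" using Suc.prems by (simp add: Suc_diff_Suc flip: power_Suc)
  finally show ?case using Suc by simp
qed simp

text \<open>A union bound over the squares that can divide \<open>D\<close>: for each degree d at
  most q^(n-d) polynomials are lost, and odd q, hence q \<ge> 3, keeps the total at half. It
  converts q^n into the number of square-free polynomials.\<close>

lemma card_monic_squarefree_ge:
  assumes "odd CARD('a::{field,finite})"
  shows "CARD('a) ^ n \<le> 2 * card (monic_squarefree n :: 'a poly set)"
proof -
  let ?q = "CARD('a)" and ?H = "monic_squarefree n :: 'a poly set"
  have "?q \<noteq> 2" using assms by auto
  then have q: "?q \<ge> 3" using card_gt_1[where 'a='a] by linarith
  let ?N = "monic_deg n - ?H"
  have "card ?N \<le> card (\<Union>d\<in>{1..n div 2}. (\<lambda>(B, C). B\<^sup>2 * C) ` (monic_deg d \<times> (monic_deg (n - 2 * d) :: 'a poly set)))"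
    by (rule card_mono[OF _ not_squarefree_subset]) auto
  also have "\<dots> \<le> (\<Sum>d\<in>{1..n div 2}. card ((\<lambda>(B, C). B\<^sup>2 * C) ` (monic_deg d \<times> (monic_deg (n - 2 * d) :: 'a poly set))))"
    by (rule card_UN_le) simp
  also have "\<dots> \<le> (\<Sum>d\<in>{1..n div 2}. ?q ^ (n - d))"
  proof (rule sum_mono)
    fix d assume d: "d \<in> {1..n div 2}"
    have "card ((\<lambda>(B, C). B\<^sup>2 * C) ` (monic_deg d \<times> (monic_deg (n - 2 * d) :: 'a poly set))) \<le>
      card ((monic_deg d :: 'a poly set) \<times> (monic_deg (n - 2 * d) :: 'a poly set))"
      by (rule card_image_le) simp
    also have "\<dots> = ?q ^ (d + (n - 2 * d))" by (simp add: card_cartesian_product card_monic_deg power_add)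
    also have "d + (n - 2 * d) = n - d" using d by auto
    finally show "card ((\<lambda>(B, C). B\<^sup>2 * C) ` (monic_deg d \<times> (monic_deg (n - 2 * d) :: 'a poly set))) \<le> ?q ^ (n - d)" .
  qed
  finally have "2 * card ?N \<le> ?q ^ n" using two_geometric_le[OF q, of "n div 2" n] by simp
  moreover have "card ?N = ?q ^ n - card ?H"
    using card_Diff_subset[OF finite_monic_squarefree monic_squarefree_subset, where 'a2='a] by (simp add: card_monic_deg)
  ultimately show ?thesis by linarith
qed

text \<open>For even n the claim reads n \<le> 2 n - 4, whence the bound 4; at n = 2 the genus is
  0.\<close>

lemma genus_ge: "n \<ge> 4 \<Longrightarrow> n \<le> 4 * genus n"
  by (cases "even n") (auto simp: genus_def elim!: evenE oddE)

lemma L_fun_deriv_moment: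
  fixes k l :: nat and \<epsilon> :: real
  assumes odd: "odd CARD('a::{field,finite})" and k: "k > 0" and \<epsilon>: "\<epsilon> > 0"
  obtains C where "C \<ge> 0" "eventually (\<lambda>n. \<forall>u. norm u = real CARD('a) powr (- 1 / 2) \<longrightarrow>
    (\<Sum>D\<in>(monic_squarefree n :: 'a poly set). norm ((deriv ^^ l) (L_fun D) u) ^ k) \<le>
      C * real CARD('a) ^ n * real n powr (real k * (real k + 1) / 2 + real l * real k + \<epsilon>)) sequentially"
proof -
  define R where "R = real CARD('a) powr (- 1 / 2)"
  have R: "R > 0" unfolding R_def by simp
  define a where "a = real k * (real k + 1) / 2"
  obtain C where C: "C \<ge> 0" and ev: "eventually (\<lambda>n. \<forall>u. norm u = R \<longrightarrow>
    (\<Sum>D\<in>(monic_squarefree n :: 'a poly set). norm (L_fun D u) ^ k) \<le>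
      C * real CARD('a) ^ n * real n powr (a + \<epsilon>)) sequentially"
    using L_fun_moment[OF odd k \<epsilon>] unfolding R_def a_def by blast
  from ev eventually_gt_at_top[of 0]
  have "eventually (\<lambda>n. \<forall>u. norm u = R \<longrightarrow>
    (\<Sum>D\<in>(monic_squarefree n :: 'a poly set). norm ((deriv ^^ l) (L_fun D) u) ^ k) \<le>
      C / R ^ (l * k) * real CARD('a) ^ n * real n powr (a + real l * real k + \<epsilon>)) sequentially"
  proof eventually_elim
    case (elim n)
    have L: "L_fun D = poly (L_poly D)" for D :: "'a poly" by (rule ext) (simp add: L_fun_def)
    have deg: "degree (L_poly D) \<le> n" if "D \<in> (monic_squarefree n :: 'a poly set)" for D
      using degree_L_poly[OF odd that elim(2)] by simp
    show ?case
    proof (intro allI impI)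
      fix u :: complex assume u: "norm u = R"
      have "(\<Sum>D\<in>(monic_squarefree n :: 'a poly set). norm (poly ((pderiv ^^ l) (L_poly D)) u) ^ k) \<le>
        (real n / R) ^ (l * k) * (C * real CARD('a) ^ n * real n powr (a + \<epsilon>))"
        by (rule higher_pderiv_moment_le[OF elim(2) deg R _ u]) (use elim(1) in \<open>auto simp: L_fun_def\<close>)
      also have "\<dots> = C / R ^ (l * k) * real CARD('a) ^ n * (real n ^ (l * k) * real n powr (a + \<epsilon>))"
        by (simp add: power_divide)
      also have "real n ^ (l * k) * real n powr (a + \<epsilon>) = real n powr (a + real l * real k + \<epsilon>)"
        using elim(2) by (simp add: powr_add powr_realpow[symmetric])
      finally show "(\<Sum>D\<in>(monic_squarefree n :: 'a poly set). norm ((deriv ^^ l) (L_fun D) u) ^ k) \<le>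
        C / R ^ (l * k) * real CARD('a) ^ n * real n powr (a + real l * real k + \<epsilon>)"
        unfolding L higher_deriv_poly .
    qed
  qed
  then show ?thesis using C R unfolding R_def a_def by (intro that[of "C / R ^ (l * k)"]) (auto simp: R_def)
qed

theorem theorem1p6:
  fixes k l :: nat and \<epsilon> :: real
  assumes "odd CARD('a::{field,finite})"
    and "\<epsilon> > 0"
  shows "(\<lambda>n. \<Sum>D \<in> (monic_squarefree n :: 'a poly set).
            norm ((deriv ^^ l) (L_fun D) (complex_of_real (real CARD('a) powr (-1/2)))) ^ k)
         \<in> O(\<lambda>n. real (card (monic_squarefree n :: 'a poly set)) *
                real (genus n) powr (real k * (real k + 1) / 2 + real l * real k + \<epsilon>))"
proof -
  let ?H = "\<lambda>n. monic_squarefree n :: 'a poly set"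
  define a where "a = real k * (real k + 1) / 2 + real l * real k + \<epsilon>"
  have a: "a > 0" unfolding a_def using assms(2) by (simp add: add_nonneg_pos)
  define u where "u = complex_of_real (real CARD('a) powr (-1/2))"
  have u: "norm u = real CARD('a) powr (-1/2)" unfolding u_def by simp
  obtain C where C: "C \<ge> 0" and ev: "eventually (\<lambda>n.
    (\<Sum>D\<in>?H n. norm ((deriv ^^ l) (L_fun D) u) ^ k) \<le> C * real CARD('a) ^ n * real n powr a) sequentially"
  proof (cases "k = 0")
    \<comment> \<open>The moment bounds assume \<open>k > 0\<close>. For \<open>k = 0\<close> the
      sum is the number of square-free polynomials, and the power of \<open>n\<close> is at least 1
      because \<epsilon> makes the exponent positive.\<close>
    case True
    have "eventually (\<lambda>n. (\<Sum>D\<in>?H n. norm ((deriv ^^ l) (L_fun D) u) ^ k) \<le> 1 * real CARD('a) ^ n * real n powr a) sequentially"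
      using eventually_gt_at_top[of 0]
    proof eventually_elim
      case (elim n)
      have "card (?H n) \<le> CARD('a) ^ n"
        using card_mono[OF finite_monic_deg monic_squarefree_subset, where 'a2='a] by (simp add: card_monic_deg)
      then have "real (card (?H n)) * 1 \<le> real CARD('a) ^ n * real n powr a"
        using elim a by (intro mult_mono ge_one_powr_ge_zero) (auto simp flip: of_nat_power)
      then show ?case using True by simp
    qed
    then show ?thesis using that[of 1] by simp
  next
    case False
    obtain C where C: "C \<ge> 0" "eventually (\<lambda>n. \<forall>u. norm u = real CARD('a) powr (-1/2) \<longrightarrow>
      (\<Sum>D\<in>?H n. norm ((deriv ^^ l) (L_fun D) u) ^ k) \<le> C * real CARD('a) ^ n * real n powr a) sequentially"
      using L_fun_deriv_moment[OF assms(1) _ assms(2)] False unfolding a_def by blast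
    from C(2) have "eventually (\<lambda>n.
      (\<Sum>D\<in>?H n. norm ((deriv ^^ l) (L_fun D) u) ^ k) \<le> C * real CARD('a) ^ n * real n powr a) sequentially"
      by eventually_elim (use u in blast)
    with C(1) show ?thesis by (rule that)
  qed
  have "(\<lambda>n. \<Sum>D\<in>?H n. norm ((deriv ^^ l) (L_fun D) u) ^ k) \<in> O(\<lambda>n. real (card (?H n)) * real (genus n) powr a)"
  proof (rule bigoI[where c = "2 * C * 4 powr a"])
    from ev eventually_ge_at_top[of 4]
    show "eventually (\<lambda>n. norm (\<Sum>D\<in>?H n. norm ((deriv ^^ l) (L_fun D) u) ^ k) \<le>
      2 * C * 4 powr a * norm (real (card (?H n)) * real (genus n) powr a)) sequentially"
    proof eventually_elim
      case (elim n)
      have "real n powr a \<le> real (4 * genus n) powr a"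
        using a genus_ge[OF elim(2)] by (intro powr_mono2) (simp_all only: of_nat_le_iff of_nat_0_le_iff less_imp_le)
      also have "\<dots> = 4 powr a * real (genus n) powr a" by (simp add: powr_mult)
      finally have n: "real n powr a \<le> 4 powr a * real (genus n) powr a" .
      have "real (CARD('a) ^ n) \<le> real (2 * card (?H n))"
        unfolding of_nat_le_iff by (rule card_monic_squarefree_ge[OF assms(1)])
      then have q: "real CARD('a) ^ n \<le> 2 * real (card (?H n))" by simp
      have "(\<Sum>D\<in>?H n. norm ((deriv ^^ l) (L_fun D) u) ^ k) \<le> C * real CARD('a) ^ n * real n powr a"
        by (rule elim(1))
      also have "\<dots> \<le> C * (2 * real (card (?H n))) * (4 powr a * real (genus n) powr a)"
        using C by (intro mult_mono[OF mult_left_mono[OF q C] n]) auto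
      also have "\<dots> = 2 * C * 4 powr a * (real (card (?H n)) * real (genus n) powr a)" by (simp only: mult_ac)
      finally show ?case by (simp add: sum_nonneg abs_mult)
    qed
  qed
  then show ?thesis unfolding u_def a_def .
qed

end
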